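(* \textsc{Colored Cycle Deletion} is W[2]-hard when parameterized by $k$, even when restricted to instances with $c=4$ in which the input graph is non-cascading and has $n^{\mathcal{O}(1)}$ induced $c$-colored $C_\ell$s, and such that all induced $c$-colored $C_\ell$s of the input graph can be enumerated in polynomial time.
   Context: A $c$-colored graph is a simple graph $G=(V,E)$ with $E=E_1\sqcup\dots\sqcup E_c$ (non-empty color classes); $n=|V|$. A cycle is $c$-colored if its edges have exactly $c$ distinct colors; $C_\ell$ is a cycle on $\ell$ vertices. \textsc{Colored Cycle Deletion}: given a $c$-colored graph $G$ and integers $c,\ell,k$, decide whether there is a set $S$ of at most $k$ edges such that $G-S$ contains no induced $c$-colored $C_\ell$. An edge is a conflict edge if it lies in some induced $c$-colored $C_\ell$ of $G$; let $X$ be the set of conflict edges. $G$ is non-cascading if every subgraph of $G$ that is a $c$-colored $C_\ell$ but is not induced in $G$ is also not an induced subgraph of $G-X'$ for any $X'\subseteq X$. *)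

theory Defs
  imports Main
begin

section \<open>Machine model\<close>

text \<open>
  Structured programs over finitely many stacks of bits, at unit cost per operation.  A multi-tape
  Turing machine simulates a run of \<open>t\<close> steps in \<open>O(t)\<close> steps and vice versa, since a tape is a pair
  of stacks; hence the polynomial-time, fixed-parameter and computable functions are the usual ones.
\<close>

type_synonym store = "nat \<Rightarrow> bool list"

datatype com =
    Skip
  | Push nat bool
  | Pop nat
  | Seq com com
  | Branch nat com com com
  | While nat com

text \<open>
  \<open>exec p s t s'\<close>: started in \<open>s\<close>, program \<open>p\<close> halts after \<open>t\<close> steps in \<open>s'\<close>.  \<open>Branch r p q u\<close>
  selects according to whether stack \<open>r\<close> is empty, has top \<open>True\<close>, or has top \<open>False\<close>;
  \<open>While r p\<close> iterates \<open>p\<close> as long as stack \<open>r\<close> is non-empty.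
\<close>

inductive exec :: "com \<Rightarrow> store \<Rightarrow> nat \<Rightarrow> store \<Rightarrow> bool" where
  Skip: "exec Skip s 1 s"
| Push: "exec (Push r b) s 1 (s(r := b # s r))"
| Pop: "exec (Pop r) s 1 (s(r := tl (s r)))"
| Seq: "exec p s t s' \<Longrightarrow> exec q s' t' s'' \<Longrightarrow> exec (Seq p q) s (t + t') s''"
| Branch_Empty: "s r = [] \<Longrightarrow> exec p s t s' \<Longrightarrow> exec (Branch r p q u) s (Suc t) s'"
| Branch_True: "s r = True # w \<Longrightarrow> exec q s t s' \<Longrightarrow> exec (Branch r p q u) s (Suc t) s'"
| Branch_False: "s r = False # w \<Longrightarrow> exec u s t s' \<Longrightarrow> exec (Branch r p q u) s (Suc t) s'"
| While_Empty: "s r = [] \<Longrightarrow> exec (While r p) s 1 s"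
| While_Step: "s r \<noteq> [] \<Longrightarrow> exec p s t s' \<Longrightarrow> exec (While r p) s' t' s'' \<Longrightarrow>
    exec (While r p) s (Suc (t + t')) s''"

definition unary :: "nat \<Rightarrow> bool list" where
  "unary k = replicate k True"

definition input1 :: "bool list \<Rightarrow> store" where
  "input1 x = (\<lambda>_. [])(0 := x)"

definition input2 :: "bool list \<Rightarrow> bool list \<Rightarrow> store" where
  "input2 x y = (\<lambda>_. [])(0 := x, 1 := y)"

definition computable :: "(nat \<Rightarrow> nat) \<Rightarrow> bool" where
  "computable f \<longleftrightarrow> (\<exists>p. \<forall>k. \<exists>t s. exec p (input1 (unary k)) t s \<and> s 0 = unary (f k))"


section \<open>Parameterized problems and reductions\<close>

type_synonym instance_word = "bool list \<times> nat"
type_synonym problem = "instance_word set"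

text \<open>
  Parameterized reduction from \<open>P\<close> to the restriction of \<open>Q\<close> to the instances in \<open>I\<close>: all produced
  instances belong to \<open>I\<close>.  The shift by one in the time bound only concerns the empty word.
\<close>

definition fpt_reducible :: "problem \<Rightarrow> problem \<Rightarrow> instance_word set \<Rightarrow> bool" where
  "fpt_reducible P Q I \<longleftrightarrow>
    (\<exists>p f g a. computable f \<and> computable g \<and>
      (\<forall>x k. \<exists>x' k' t s.
        exec p (input2 x (unary k)) t s \<and> s 0 = x' \<and> s 1 = unary k' \<and>
        t \<le> f k * (length x + 1) ^ a \<and>
        k' \<le> g k \<and>
        (x', k') \<in> I \<and>
        ((x, k) \<in> P \<longleftrightarrow> (x', k') \<in> Q)))"


section \<open>Words for numbers and lists\<close>

definition enc_nat :: "nat \<Rightarrow> bool list" where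
  "enc_nat n = unary n @ [False]"

definition enc_list :: "('a \<Rightarrow> bool list) \<Rightarrow> 'a list \<Rightarrow> bool list" where
  "enc_list e xs = enc_nat (length xs) @ concat (map e xs)"


section \<open>The W-hierarchy\<close>

datatype gate = Input | Neg nat | Conj "nat list" | Disj "nat list"

fun preds :: "gate \<Rightarrow> nat list" where
  "preds Input = []"
| "preds (Neg j) = [j]"
| "preds (Conj js) = js"
| "preds (Disj js) = js"

text \<open>
  A circuit lists the nodes of a directed acyclic graph in a topological order, with the output node,
  which has outdegree 0, in last position.
\<close>

type_synonym circuit = "gate list"

definition circuit :: "circuit \<Rightarrow> bool" where
  "circuit C \<longleftrightarrow> C \<noteq> [] \<and>
    (\<forall>i < length C. distinct (preds (C ! i)) \<and> (\<forall>j \<in> set (preds (C ! i)). j < i)) \<and>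
    (\<forall>js. Conj js \<in> set C \<or> Disj js \<in> set C \<longrightarrow> length js \<ge> 2)"

definition inputs :: "circuit \<Rightarrow> nat set" where
  "inputs C = {i. i < length C \<and> C ! i = Input}"

text \<open>The node values under the assignment that sets exactly the input nodes in \<open>A\<close> to true.\<close>

definition valuation :: "circuit \<Rightarrow> nat set \<Rightarrow> (nat \<Rightarrow> bool) \<Rightarrow> bool" where
  "valuation C A v \<longleftrightarrow> (\<forall>i < length C. v i \<longleftrightarrow>
    (case C ! i of
      Input \<Rightarrow> i \<in> A
    | Neg j \<Rightarrow> \<not> v j
    | Conj js \<Rightarrow> (\<forall>j \<in> set js. v j)
    | Disj js \<Rightarrow> (\<exists>j \<in> set js. v j)))"

definition satisfies :: "nat set \<Rightarrow> circuit \<Rightarrow> bool" where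
  "satisfies A C \<longleftrightarrow> (\<exists>v. valuation C A v \<and> v (length C - 1))"

definition input_output_paths :: "circuit \<Rightarrow> nat list set" where
  "input_output_paths C = {p. p \<noteq> [] \<and> set p \<subseteq> {..<length C} \<and>
    hd p \<in> inputs C \<and> last p = length C - 1 \<and>
    (\<forall>i. Suc i < length p \<longrightarrow> p ! i \<in> set (preds (C ! (p ! Suc i))))}"

definition depth :: "circuit \<Rightarrow> nat" where
  "depth C = Max ((\<lambda>p. length p - 1) ` input_output_paths C)"

definition large :: "gate \<Rightarrow> bool" where
  "large g \<longleftrightarrow> length (preds g) > 2"

definition weft :: "circuit \<Rightarrow> nat" where
  "weft C = Max ((\<lambda>p. length (filter (\<lambda>i. large (C ! i)) p)) ` input_output_paths C)"

fun enc_gate :: "gate \<Rightarrow> bool list" where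
  "enc_gate Input = enc_nat 0"
| "enc_gate (Neg j) = enc_nat 1 @ enc_nat j"
| "enc_gate (Conj js) = enc_nat 2 @ enc_list enc_nat js"
| "enc_gate (Disj js) = enc_nat 3 @ enc_list enc_nat js"

definition enc_circuit :: "circuit \<Rightarrow> bool list" where
  "enc_circuit C = enc_list enc_gate C"

definition weighted_circuit_sat :: problem where
  "weighted_circuit_sat = {(enc_circuit C, k) | C k. circuit C \<and>
    (\<exists>A \<subseteq> inputs C. card A = k \<and> satisfies A C)}"

definition bounded_circuits :: "nat \<Rightarrow> nat \<Rightarrow> instance_word set" where
  "bounded_circuits t d = {(enc_circuit C, k) | C k. circuit C \<and> weft C \<le> t \<and> depth C \<le> d}"

definition W :: "nat \<Rightarrow> problem set" where
  "W t = {P. \<exists>d \<ge> 1. fpt_reducible P weighted_circuit_sat (bounded_circuits t d)}"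

definition W_hard_on :: "nat \<Rightarrow> problem \<Rightarrow> instance_word set \<Rightarrow> bool" where
  "W_hard_on t Q I \<longleftrightarrow> (\<forall>P \<in> W t. fpt_reducible P Q I)"


section \<open>Edge-colored graphs and Colored Cycle Deletion\<close>

record 'a cgraph =
  verts :: "'a set"
  edges :: "'a set set"
  color :: "'a set \<Rightarrow> nat"

definition colored_graph :: "nat \<Rightarrow> 'a cgraph \<Rightarrow> bool" where
  "colored_graph c G \<longleftrightarrow> finite (verts G) \<and>
    (\<forall>e \<in> edges G. e \<subseteq> verts G \<and> card e = 2) \<and>
    color G ` edges G = {1..c}"

definition delete_edges :: "'a cgraph \<Rightarrow> 'a set set \<Rightarrow> 'a cgraph" where
  "delete_edges G S = G\<lparr>edges := edges G - S\<rparr>"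

definition cycle_edges :: "'a list \<Rightarrow> 'a set set" where
  "cycle_edges vs = {{vs ! i, vs ! (Suc i mod length vs)} | i. i < length vs}"

definition cyclic_sequence :: "'a list \<Rightarrow> bool" where
  "cyclic_sequence vs \<longleftrightarrow> distinct vs \<and> length vs \<ge> 3"

text \<open>Cycles are subgraphs, identified with their edge sets; their vertex set is the union.\<close>

definition colored_cycle :: "'a cgraph \<Rightarrow> nat \<Rightarrow> nat \<Rightarrow> 'a set set \<Rightarrow> bool" where
  "colored_cycle G c l F \<longleftrightarrow> F \<subseteq> edges G \<and>
    (\<exists>vs. cyclic_sequence vs \<and> length vs = l \<and> F = cycle_edges vs) \<and>
    card (color G ` F) = c"

definition induced_in :: "'a cgraph \<Rightarrow> 'a set set \<Rightarrow> bool" where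
  "induced_in G F \<longleftrightarrow> {e \<in> edges G. e \<subseteq> \<Union>F} = F"

definition induced_colored_cycles :: "'a cgraph \<Rightarrow> nat \<Rightarrow> nat \<Rightarrow> 'a set set set" where
  "induced_colored_cycles G c l = {F. colored_cycle G c l F \<and> induced_in G F}"

definition conflict_edges :: "'a cgraph \<Rightarrow> nat \<Rightarrow> nat \<Rightarrow> 'a set set" where
  "conflict_edges G c l = \<Union>(induced_colored_cycles G c l)"

definition non_cascading :: "'a cgraph \<Rightarrow> nat \<Rightarrow> nat \<Rightarrow> bool" where
  "non_cascading G c l \<longleftrightarrow>
    (\<forall>F. colored_cycle G c l F \<and> \<not> induced_in G F \<longrightarrow>
      (\<forall>X' \<subseteq> conflict_edges G c l. \<not> induced_in (delete_edges G X') F))"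

definition has_cycle_deletion :: "'a cgraph \<Rightarrow> nat \<Rightarrow> nat \<Rightarrow> nat \<Rightarrow> bool" where
  "has_cycle_deletion G c l k \<longleftrightarrow>
    (\<exists>S \<subseteq> edges G. card S \<le> k \<and> induced_colored_cycles (delete_edges G S) c l = {})"

text \<open>
  An input consists of the number of vertices, the list of edges \<open>(u, v, i)\<close> with end vertices \<open>u\<close>
  and \<open>v\<close> and color \<open>i\<close>, the number of colors, the cycle length and the deletion budget.
\<close>

record ccd_instance =
  order :: nat
  edge_list :: "(nat \<times> nat \<times> nat) list"
  num_colors :: nat
  cycle_length :: nat
  budget :: nat

definition graph_of :: "ccd_instance \<Rightarrow> nat cgraph" where
  "graph_of J = \<lparr>
    verts = {..<order J},
    edges = (\<lambda>(u, v, i). {u, v}) ` set (edge_list J),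
    color = (\<lambda>e. THE i. \<exists>u v. (u, v, i) \<in> set (edge_list J) \<and> e = {u, v})\<rparr>"

definition ccd_instances :: "ccd_instance set" where
  "ccd_instances = {J. distinct (map (\<lambda>(u, v, i). {u, v}) (edge_list J)) \<and>
    colored_graph (num_colors J) (graph_of J)}"

definition enc_ccd :: "ccd_instance \<Rightarrow> bool list" where
  "enc_ccd J = enc_nat (order J) @
    enc_list (\<lambda>(u, v, i). enc_nat u @ enc_nat v @ enc_nat i) (edge_list J) @
    enc_nat (num_colors J) @ enc_nat (cycle_length J)"

definition ccd_word :: "ccd_instance \<Rightarrow> instance_word" where
  "ccd_word J = (enc_ccd J, budget J)"

definition colored_cycle_deletion :: problem where
  "colored_cycle_deletion = ccd_word ` {J \<in> ccd_instances.
    has_cycle_deletion (graph_of J) (num_colors J) (cycle_length J) (budget J)}"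

definition instance_cycles :: "ccd_instance \<Rightarrow> nat set set set" where
  "instance_cycles J = induced_colored_cycles (graph_of J) (num_colors J) (cycle_length J)"

text \<open>
  One algorithm lists, for every instance in \<open>I\<close>, each induced colored cycle exactly once, as the
  sequence of its vertices in cyclic order.
\<close>

definition poly_time_enumerable :: "ccd_instance set \<Rightarrow> bool" where
  "poly_time_enumerable I \<longleftrightarrow>
    (\<exists>p a b. \<forall>J \<in> I. \<exists>vss t s.
      exec p (input1 (enc_ccd J)) t s \<and> s 0 = enc_list (enc_list enc_nat) vss \<and>
      t \<le> b * length (enc_ccd J) ^ a \<and>
      (\<forall>vs \<in> set vss. cyclic_sequence vs) \<and>
      distinct (map cycle_edges vss) \<and>
      cycle_edges ` set vss = instance_cycles J)"

end

theory Submission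
  imports Defs
begin

text \<open>
  A circuit of weft two and depth \<open>d\<close> is a disjunction of polynomially many conjunctive normal forms whose
  literals are nodes of weft zero, each depending on at most \<open>2 ^ d\<close> inputs.  An assignment of weight \<open>k\<close> is
  represented by its \<open>k + 1\<close> pairs of consecutive true inputs, so that the falsity of an input is witnessed
  positively, by the gap it lies in.  For every list of \<open>2 ^ d\<close> gaps there is one block of elements, an element
  fixing the end points of all gaps in the list and the chosen normal form.  With a budget equal to the number of
  blocks and one set per block, a hitting set selects exactly one element per block; then the negation of an element
  is the disjunction of the others in its block, consistency of two blocks is expressed by sets, and a clause is
  satisfied iff some block forces one of its literals.

  In the graph, the elements are shared edges and every set has a private class of vertices that completes the shared edges
  of its elements to a cycle.  Any two vertices from different private classes are adjacent.  Hence a long induced cycle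
  visits only one private class, whatever conflict edges are deleted, and is the cycle of a set.

  Polynomial time is handled through a class of functions on tree-like data that is closed under composition,
  pairing, case distinction and bounded iteration.
\<close>

section \<open>Polynomial time on the stack machine\<close>

text \<open>Hitting sets are monotone, whereas a circuit may use its inputs negatively, and the
  falsity of an input depends on all \<open>k\<close> members of an assignment. This obstacle is the
  origin of the gaps: an input is false iff a single gap contains it, so \<open>2 ^ d\<close> slots
  witness the value of any literal, positive or negative. There are \<open>k + 1\<close> slots,
  hence \<open>(k + 1) ^ (2 ^ d)\<close> blocks, a budget that depends on \<open>k\<close> and the
  fixed \<open>d\<close> only. A disjunction of normal forms is not a conjunction of clauses; for
  this reason every element also fixes a normal form, and the clauses of all others are excused.

  Deleting edges may in general create new induced cycles. The chords between private classes
  prevent this: they lie on no induced colored cycle, so they are never conflict edges and survive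
  every deletion considered for non-cascading. The vertex that links two consecutive columns is
  always private, even when both columns use shared edges; this keeps a third of every cycle
  private, and five columns are enough for the counting argument. Color \<open>4\<close> occurs on
  one edge of each cycle only, which makes the number of colors exactly four.\<close>

notation Seq (infixr ";;" 60)

text \<open>Running times are kept as upper bounds, so they can be weakened and added without being
  computed exactly.\<close>

definition runs :: "com \<Rightarrow> store \<Rightarrow> nat \<Rightarrow> store \<Rightarrow> bool" where
  "runs p s t s' \<longleftrightarrow> (\<exists>t' \<le> t. exec p s t' s')"

lemma runs_mono: "runs p s t s' \<Longrightarrow> t \<le> u \<Longrightarrow> runs p s u s'"
  unfolding runs_def using le_trans by blast

lemma runs_Skip: "runs Skip s 1 s"
  unfolding runs_def using exec.Skip by blast

lemma runs_Push: "runs (Push r b) s 1 (s(r := b # s r))"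
  unfolding runs_def using exec.Push by blast

lemma runs_Pop: "runs (Pop r) s 1 (s(r := tl (s r)))"
  unfolding runs_def using exec.Pop by blast

lemma runs_Seq: "runs p s t s' \<Longrightarrow> runs q s' u s'' \<Longrightarrow> runs (p ;; q) s (t + u) s''"
  unfolding runs_def using exec.Seq add_mono by meson

lemma runs_Branch_True: "s r = True # w \<Longrightarrow> runs q s t s' \<Longrightarrow> runs (Branch r p q u) s (Suc t) s'"
  unfolding runs_def using exec.Branch_True Suc_le_mono by meson

lemma runs_Branch_False: "s r = False # w \<Longrightarrow> runs u s t s' \<Longrightarrow> runs (Branch r p q u) s (Suc t) s'"
  unfolding runs_def using exec.Branch_False Suc_le_mono by meson

lemma runs_Branch_Cons:
  "s r = x # w \<Longrightarrow> runs (if x then q else u) s t s' \<Longrightarrow> runs (Branch r p q u) s (Suc t) s'"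
  by (cases x) (auto intro: runs_Branch_True runs_Branch_False)

lemma runs_While_Empty: "s r = [] \<Longrightarrow> runs (While r p) s 1 s"
  unfolding runs_def using exec.While_Empty by blast

lemma runs_While_Step:
  "s r \<noteq> [] \<Longrightarrow> runs p s t s' \<Longrightarrow> runs (While r p) s' u s'' \<Longrightarrow> runs (While r p) s (Suc (t + u)) s''"
  unfolding runs_def using exec.While_Step add_mono Suc_le_mono by meson

text \<open>A step pushes at most one bit. This turns time bounds into bounds on the size of the
  output.\<close>

lemma exec_length_le: "exec p s t s' \<Longrightarrow> length (s' r) \<le> length (s r) + t"
  by (induction rule: exec.induct) auto

fun regs :: "com \<Rightarrow> nat set" where
  "regs Skip = {}"
| "regs (Push r b) = {r}"
| "regs (Pop r) = {r}"
| "regs (Seq p q) = regs p \<union> regs q"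
| "regs (Branch r p q u) = insert r (regs p \<union> regs q \<union> regs u)"
| "regs (While r p) = insert r (regs p)"

lemma finite_regs: "finite (regs p)"
  by (induction p) auto

lemma exec_frame: "exec p s t s' \<Longrightarrow> r \<notin> regs p \<Longrightarrow> s' r = s r"
  by (induction rule: exec.induct) auto

definition clear :: "nat \<Rightarrow> com" where
  "clear r = While r (Pop r)"

lemma runs_clear: "runs (clear r) s (2 * length (s r) + 1) (s(r := []))"
proof (induction "s r" arbitrary: s)
  case Nil
  then show ?case using runs_While_Empty[of s r "Pop r"] by (simp add: clear_def fun_upd_idem)
next
  case (Cons b w)
  let ?s = "s(r := tl (s r))"
  have w: "w = ?s r" using Cons(2) by (metis fun_upd_same list.sel(3))
  have "runs (While r (Pop r)) ?s (2 * length (?s r) + 1) (?s(r := []))"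
    using Cons(1)[of ?s] w by (simp add: clear_def)
  moreover have "s r \<noteq> []" using Cons(2) by auto
  ultimately have "runs (While r (Pop r)) s (Suc (1 + (2 * length (?s r) + 1))) (?s(r := []))"
    using runs_While_Step runs_Pop by blast
  then show ?case using Cons(2)[symmetric] by (simp add: clear_def)
qed

text \<open>Moving a stack reverses it; a second move restores the order.\<close>

definition pour :: "nat \<Rightarrow> nat \<Rightarrow> com" where
  "pour a b = While a (Branch a Skip (Pop a ;; Push b True) (Pop a ;; Push b False))"

lemma runs_pour:
  assumes "a \<noteq> b"
  shows "runs (pour a b) s (4 * length (s a) + 1) (s(a := [], b := rev (s a) @ s b))"
proof (induction "s a" arbitrary: s)
  case Nil
  then show ?case using runs_While_Empty[of s a] by (simp add: pour_def fun_upd_idem)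
next
  case (Cons x w)
  let ?s = "s(a := w, b := x # s b)"
  let ?body = "Branch a Skip (Pop a ;; Push b True) (Pop a ;; Push b False)"
  have "runs (Pop a ;; Push b x) s (1 + 1) ?s"
    using runs_Seq[OF runs_Pop[of a s] runs_Push[of b x]] Cons(2)[symmetric] assms by simp
  then have "runs (if x then Pop a ;; Push b True else Pop a ;; Push b False) s (1 + 1) ?s"
    by (cases x) simp_all
  then have "runs ?body s (Suc (1 + 1)) ?s"
    by (rule runs_Branch_Cons[of s a x w, OF Cons(2)[symmetric]])
  moreover have "runs (pour a b) ?s (4 * length (?s a) + 1) (?s(a := [], b := rev (?s a) @ ?s b))"
    using Cons(1)[of ?s] assms by auto
  ultimately have "runs (pour a b) s (Suc (Suc (1 + 1) + (4 * length (?s a) + 1))) (?s(a := [], b := rev (?s a) @ ?s b))"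
    unfolding pour_def by (intro runs_While_Step) (use Cons(2) in auto)
  moreover have "?s(a := [], b := rev (?s a) @ ?s b) = s(a := [], b := rev (s a) @ s b)"
    using assms Cons(2)[symmetric] by (auto simp: fun_eq_iff)
  ultimately have "runs (pour a b) s (Suc (Suc (1 + 1) + (4 * length (?s a) + 1))) (s(a := [], b := rev (s a) @ s b))"
    by simp
  then show ?case by (rule runs_mono) (use Cons(2)[symmetric] assms in simp)
qed

definition pour2 :: "nat \<Rightarrow> nat \<Rightarrow> nat \<Rightarrow> com" where
  "pour2 a b c = While a (Branch a Skip (Pop a ;; Push b True ;; Push c True) (Pop a ;; Push b False ;; Push c False))"

lemma runs_pour2:
  assumes "a \<noteq> b" "a \<noteq> c" "b \<noteq> c"
  shows "runs (pour2 a b c) s (5 * length (s a) + 1) (s(a := [], b := rev (s a) @ s b, c := rev (s a) @ s c))"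
proof (induction "s a" arbitrary: s)
  case Nil
  then show ?case using runs_While_Empty[of s a] by (simp add: pour2_def fun_upd_idem)
next
  case (Cons x w)
  let ?s = "s(a := w, b := x # s b, c := x # s c)"
  let ?body = "Branch a Skip (Pop a ;; Push b True ;; Push c True) (Pop a ;; Push b False ;; Push c False)"
  have "runs (Pop a ;; Push b x ;; Push c x) s (1 + (1 + 1)) ?s"
    using runs_Seq[OF runs_Pop[of a s] runs_Seq[OF runs_Push[of b x] runs_Push[of c x]]] Cons(2)[symmetric] assms by simp
  then have "runs (if x then Pop a ;; Push b True ;; Push c True else Pop a ;; Push b False ;; Push c False)
      s (1 + (1 + 1)) ?s"
    by (cases x) simp_all
  then have "runs ?body s (Suc (1 + (1 + 1))) ?s"
    by (rule runs_Branch_Cons[of s a x w, OF Cons(2)[symmetric]])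
  moreover have "runs (pour2 a b c) ?s (5 * length (?s a) + 1) (?s(a := [], b := rev (?s a) @ ?s b, c := rev (?s a) @ ?s c))"
    using Cons(1)[of ?s] assms by auto
  ultimately have "runs (pour2 a b c) s (Suc (Suc (1 + (1 + 1)) + (5 * length (?s a) + 1)))
      (?s(a := [], b := rev (?s a) @ ?s b, c := rev (?s a) @ ?s c))"
    unfolding pour2_def by (intro runs_While_Step) (use Cons(2) in auto)
  moreover have "?s(a := [], b := rev (?s a) @ ?s b, c := rev (?s a) @ ?s c) =
      s(a := [], b := rev (s a) @ s b, c := rev (s a) @ s c)"
    using assms Cons(2)[symmetric] by (auto simp: fun_eq_iff)
  ultimately have "runs (pour2 a b c) s (Suc (Suc (1 + (1 + 1)) + (5 * length (?s a) + 1)))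
      (s(a := [], b := rev (s a) @ s b, c := rev (s a) @ s c))"
    by simp
  then show ?case by (rule runs_mono) (use Cons(2)[symmetric] assms in simp)
qed

section \<open>Trees as universal data and their coding\<close>

datatype tree = Lf | Nd tree tree

text \<open>Preorder words are prefix-free: the end of a code is recognised from the code itself, so
  a value can lie above an arbitrary rest of the stack.\<close>

primrec codeT :: "tree \<Rightarrow> bool list" where
  "codeT Lf = [False]"
| "codeT (Nd a b) = True # codeT a @ codeT b"

text \<open>Stack \<open>c\<close> counts the subtrees that are still to be read from stack \<open>0\<close>.\<close>

definition grab_loop :: "nat \<Rightarrow> nat \<Rightarrow> com" where
  "grab_loop d c = While c (Branch 0 Skip (Pop 0 ;; Push d True ;; Push c True) (Pop 0 ;; Push d False ;; Pop c))"

definition grab :: "nat \<Rightarrow> nat \<Rightarrow> com" where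
  "grab d c = Push c True ;; grab_loop d c"

text \<open>The loop does not stop between two subtrees. The lemma is therefore phrased with a
  continuation: a run from the state after the tree extends to a run from the state before it, which
  is the form that the induction on the tree needs.\<close>

lemma runs_grab_loop:
  assumes "d \<noteq> 0" "c \<noteq> 0" "c \<noteq> d"
  shows "s 0 = codeT t @ w \<Longrightarrow> s c = True # v \<Longrightarrow>
    runs (grab_loop d c) (s(0 := w, d := rev (codeT t) @ s d, c := v)) u s'' \<Longrightarrow>
    runs (grab_loop d c) s (5 * length (codeT t) + u) s''"
proof (induction t arbitrary: s w v u)
  case Lf
  let ?s = "s(0 := w, d := False # s d, c := v)"
  have "runs (Pop 0 ;; Push d False ;; Pop c) s (1 + (1 + 1)) ?s"
    using runs_Seq[OF runs_Pop[of 0 s] runs_Seq[OF runs_Push[of d False] runs_Pop[of c]]] Lf assms by simp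
  then have "runs (Branch 0 Skip (Pop 0 ;; Push d True ;; Push c True) (Pop 0 ;; Push d False ;; Pop c)) s (Suc (1 + (1 + 1))) ?s"
    by (rule runs_Branch_False[rotated]) (use Lf in simp)
  moreover have "runs (grab_loop d c) ?s u s''" using Lf(3) by (simp only: codeT.simps rev.simps append.simps)
  ultimately have "runs (grab_loop d c) s (Suc (Suc (1 + (1 + 1)) + u)) s''"
    unfolding grab_loop_def by (rule runs_While_Step[rotated]) (use Lf in simp)
  then show ?case by (simp add: numeral_eq_Suc)
next
  case (Nd a b)
  let ?s1 = "s(0 := codeT a @ codeT b @ w, d := True # s d, c := True # True # v)"
  let ?s2 = "s(0 := codeT b @ w, d := rev (codeT a) @ True # s d, c := True # v)"
  have "runs (Pop 0 ;; Push d True ;; Push c True) s (1 + (1 + 1)) ?s1"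
    using runs_Seq[OF runs_Pop[of 0 s] runs_Seq[OF runs_Push[of d True] runs_Push[of c True]]] Nd(3,4) assms by simp
  then have 1: "runs (Branch 0 Skip (Pop 0 ;; Push d True ;; Push c True) (Pop 0 ;; Push d False ;; Pop c)) s (Suc (1 + (1 + 1))) ?s1"
    by (rule runs_Branch_True[rotated]) (use Nd(3) in simp)
  have eq: "s(0 := w, d := rev (codeT (Nd a b)) @ s d, c := v) =
      ?s2(0 := w, d := rev (codeT b) @ ?s2 d, c := v)"
    using assms by (auto simp: fun_eq_iff)
  have 2: "runs (grab_loop d c) ?s2 (5 * length (codeT b) + u) s''"
  proof (rule Nd(2)[of ?s2 w v u])
    show "runs (grab_loop d c) (?s2(0 := w, d := rev (codeT b) @ ?s2 d, c := v)) u s''"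
      using Nd(5) unfolding eq .
  qed (use assms in auto)
  have 3: "?s2 = ?s1(0 := codeT b @ w, d := rev (codeT a) @ ?s1 d, c := True # v)"
    using assms by (auto simp: fun_eq_iff)
  have "runs (grab_loop d c) ?s1 (5 * length (codeT a) + (5 * length (codeT b) + u)) s''"
  proof (rule Nd(1)[of ?s1 "codeT b @ w" "True # v"])
    show "runs (grab_loop d c) (?s1(0 := codeT b @ w, d := rev (codeT a) @ ?s1 d, c := True # v))
        (5 * length (codeT b) + u) s''"
      using 2 unfolding 3 .
  qed (use assms in auto)
  with 1 have "runs (grab_loop d c) s (Suc (Suc (1 + (1 + 1)) + (5 * length (codeT a) + (5 * length (codeT b) + u)))) s''"
    unfolding grab_loop_def by (rule runs_While_Step[rotated]) (use Nd in simp)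
  then show ?case by (rule runs_mono) simp
qed

lemma runs_grab:
  assumes "d \<noteq> 0" "c \<noteq> 0" "c \<noteq> d" "s 0 = codeT t @ w" "s c = []"
  shows "runs (grab d c) s (5 * length (codeT t) + 2) (s(0 := w, d := rev (codeT t) @ s d))"
proof -
  let ?s = "s(c := [True])"
  let ?s' = "s(0 := w, d := rev (codeT t) @ s d)"
  have "?s(0 := w, d := rev (codeT t) @ ?s d, c := []) = ?s'"
    using assms by (auto simp: fun_eq_iff)
  moreover have "runs (grab_loop d c) ?s' 1 ?s'"
    unfolding grab_loop_def by (rule runs_While_Empty) (use assms in auto)
  ultimately have "runs (grab_loop d c) ?s (5 * length (codeT t) + 1) ?s'"
    using assms by (intro runs_grab_loop[of d c ?s t w "[]"]) auto
  with runs_Push[of c True s] have "runs (grab d c) s (1 + (5 * length (codeT t) + 1)) ?s'"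
    unfolding grab_def using assms by (intro runs_Seq) auto
  then show ?thesis by simp
qed

text \<open>Values of different types may share a tree, for instance a list cell and a pair, or a
  number and a list of units. Conversions between them cost no step.\<close>

class treeable =
  fixes tree_of :: "'a \<Rightarrow> tree"
  assumes tree_of_inject: "tree_of x = tree_of y \<Longrightarrow> x = y"

lemma tree_of_eq_iff [simp]: "tree_of x = tree_of y \<longleftrightarrow> x = y"
  using tree_of_inject by blast

instantiation tree :: treeable
begin
definition tree_of_tree :: "tree \<Rightarrow> tree" where "tree_of_tree t = t"
instance by standard (simp add: tree_of_tree_def)
end

instantiation unit :: treeable
begin
definition tree_of_unit :: "unit \<Rightarrow> tree" where "tree_of_unit t = Lf"
instance by standard simp
end

instantiation bool :: treeable
begin
definition tree_of_bool :: "bool \<Rightarrow> tree" where "tree_of_bool b = (if b then Nd Lf Lf else Lf)"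
instance by standard (auto simp: tree_of_bool_def split: if_splits)
end

text \<open>Unary as in \<open>enc_nat\<close>, so the value of a number and its size are linearly
  related.\<close>

instantiation nat :: treeable
begin
primrec tree_of_nat :: "nat \<Rightarrow> tree" where
  "tree_of_nat 0 = Lf"
| "tree_of_nat (Suc n) = Nd Lf (tree_of_nat n)"
instance
proof
  fix x y :: nat
  show "tree_of x = tree_of y \<Longrightarrow> x = y"
  proof (induction x arbitrary: y)
    case 0 then show ?case by (cases y) auto
  next
    case (Suc x) then show ?case by (cases y) auto
  qed
qed
end

instantiation list :: (treeable) treeable
begin
primrec tree_of_list :: "'a list \<Rightarrow> tree" where
  "tree_of_list [] = Lf"
| "tree_of_list (x # xs) = Nd (tree_of x) (tree_of_list xs)"
instance
proof
  fix x y :: "'a list"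
  show "tree_of x = tree_of y \<Longrightarrow> x = y"
  proof (induction x arbitrary: y)
    case Nil then show ?case by (cases y) auto
  next
    case (Cons a x) then show ?case by (cases y) auto
  qed
qed
end

instantiation prod :: (treeable, treeable) treeable
begin
primrec tree_of_prod :: "'a \<times> 'b \<Rightarrow> tree" where
  "tree_of_prod (x, y) = Nd (tree_of x) (tree_of y)"
instance by standard auto
end

definition code :: "'a::treeable \<Rightarrow> bool list" where
  "code x = codeT (tree_of x)"

definition sz :: "'a::treeable \<Rightarrow> nat" where
  "sz x = length (code x)"

lemma code_simps [simp]:
  "code (x, y) = True # code x @ code y"
  "code [] = [False]"
  "code (z # zs) = True # code z @ code zs"
  "code (0::nat) = [False]"
  "code (Suc n) = True # False # code n"
  "code True = [True, False, False]"
  "code False = [False]"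
  "code (u::unit) = [False]"
  by (auto simp: code_def tree_of_bool_def tree_of_unit_def)

lemma sz_simps [simp]:
  "sz (x, y) = Suc (sz x + sz y)"
  "sz [] = 1"
  "sz (z # zs) = Suc (sz z + sz zs)"
  "sz (n::nat) = Suc (2 * n)"
  by (auto simp: sz_def) (induction n, auto)

lemma sz_bool_le: "sz (b::bool) \<le> 3"
  by (cases b) (auto simp: sz_def)

lemma sz_pos [simp]: "sz x > 0"
  unfolding sz_def code_def by (cases "tree_of x") auto

section \<open>Polynomial bounds\<close>

definition poly_bd :: "(nat \<Rightarrow> nat) \<Rightarrow> bool" where
  "poly_bd T \<longleftrightarrow> mono T \<and> (\<exists>c a. \<forall>n. T n \<le> c * Suc n ^ a)"

named_theorems poly_bd_intros

text \<open>Sizes of intermediate values are known only up to an upper bound; monotonicity is part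
  of \<open>poly_bd\<close> so that time bounds can be applied to them.\<close>

lemma poly_bd_monoD: "poly_bd T \<Longrightarrow> m \<le> n \<Longrightarrow> T m \<le> T n"
  unfolding poly_bd_def mono_def by blast

lemma poly_bdE:
  assumes "poly_bd T"
  obtains c a where "\<forall>n. T n \<le> c * Suc n ^ a"
  using assms unfolding poly_bd_def by blast

lemma poly_bd_id [poly_bd_intros]: "poly_bd (\<lambda>n. n)"
  unfolding poly_bd_def by (auto simp: mono_def intro!: exI[of _ 1])

lemma poly_bd_const [poly_bd_intros]: "poly_bd (\<lambda>n. k)"
  unfolding poly_bd_def mono_def by (rule conjI, simp, rule exI[of _ k], rule exI[of _ 0], simp)

lemma poly_bd_add [poly_bd_intros]:
  assumes "poly_bd S" "poly_bd T"
  shows "poly_bd (\<lambda>n. S n + T n)"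
proof -
  obtain c a where 1: "\<forall>n. S n \<le> c * Suc n ^ a" using assms(1) by (rule poly_bdE)
  obtain d b where 2: "\<forall>n. T n \<le> d * Suc n ^ b" using assms(2) by (rule poly_bdE)
  have "S n + T n \<le> (c + d) * Suc n ^ (a + b)" for n
  proof -
    have "S n \<le> c * Suc n ^ (a + b)"
      using 1[rule_format, of n] by (rule le_trans) (intro mult_le_mono2 power_increasing; simp)
    moreover have "T n \<le> d * Suc n ^ (a + b)"
      using 2[rule_format, of n] by (rule le_trans) (intro mult_le_mono2 power_increasing; simp)
    ultimately show ?thesis by (simp only: add_mult_distrib)
  qed
  then show ?thesis using assms unfolding poly_bd_def mono_def by (meson add_mono)
qed

lemma poly_bd_mult [poly_bd_intros]:
  assumes "poly_bd S" "poly_bd T"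
  shows "poly_bd (\<lambda>n. S n * T n)"
proof -
  obtain c a where 1: "\<forall>n. S n \<le> c * Suc n ^ a" using assms(1) by (rule poly_bdE)
  obtain d b where 2: "\<forall>n. T n \<le> d * Suc n ^ b" using assms(2) by (rule poly_bdE)
  have "S n * T n \<le> (c * d) * Suc n ^ (a + b)" for n
    using mult_le_mono[OF 1[rule_format, of n] 2[rule_format, of n]] by (simp only: power_add mult_ac)
  then show ?thesis using assms unfolding poly_bd_def mono_def by (meson mult_le_mono)
qed

lemma poly_bd_Suc [poly_bd_intros]: "poly_bd S \<Longrightarrow> poly_bd (\<lambda>n. Suc (S n))"
  using poly_bd_add[of S "\<lambda>_. 1"] poly_bd_const[of 1] by simp

lemma poly_bd_power [poly_bd_intros]: "poly_bd S \<Longrightarrow> poly_bd (\<lambda>n. S n ^ b)"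
  by (induction b) (auto intro: poly_bd_intros)

lemma poly_bd_comp:
  assumes "poly_bd S" "poly_bd T"
  shows "poly_bd (\<lambda>n. S (T n))"
proof -
  obtain c a where 1: "\<forall>n. S n \<le> c * Suc n ^ a" using assms(1) by (rule poly_bdE)
  have "poly_bd (\<lambda>n. c * Suc (T n) ^ a)" by (intro poly_bd_intros assms)
  then obtain d b where "\<forall>n. c * Suc (T n) ^ a \<le> d * Suc n ^ b" by (rule poly_bdE)
  then have "S (T n) \<le> d * Suc n ^ b" for n using 1 le_trans by blast
  then show ?thesis using assms unfolding poly_bd_def mono_def by meson
qed

text \<open>
  A value lies on top of stack \<open>0\<close>, above an arbitrary rest \<open>w\<close>.  The stacks \<open>1, \<dots>, m - 1\<close> are scratch space, empty
  before and after the run, and no other stack is touched; so programs compose without renaming stacks, and an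
  enclosing loop can use stack \<open>m\<close> for its control.
\<close>

definition computes :: "com \<Rightarrow> nat \<Rightarrow> (nat \<Rightarrow> nat) \<Rightarrow> 'a::treeable set \<Rightarrow> ('a \<Rightarrow> 'b::treeable) \<Rightarrow> bool" where
  "computes p m T D f \<longleftrightarrow> (\<forall>x \<in> D. \<forall>s w. s 0 = code x @ w \<longrightarrow>
    (\<forall>i. 0 < i \<and> i < m \<longrightarrow> s i = []) \<longrightarrow> runs p s (T (sz x)) (s(0 := code (f x) @ w)))"

lemma computesD:
  assumes "computes p m T D f" "x \<in> D" "s 0 = code x @ w" "\<And>i. 0 < i \<Longrightarrow> i < m \<Longrightarrow> s i = []"
  shows "runs p s (T (sz x)) (s(0 := code (f x) @ w))"
  using assms unfolding computes_def by simp

text \<open>The domain \<open>D\<close> accommodates partial operations such as taking the head of a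
  list; in a case distinction each branch answers only for its own cases.\<close>

definition ptime_on :: "'a::treeable set \<Rightarrow> ('a \<Rightarrow> 'b::treeable) \<Rightarrow> bool" where
  "ptime_on D f \<longleftrightarrow> (\<exists>p m T. poly_bd T \<and> computes p m T D f)"

abbreviation ptime :: "('a::treeable \<Rightarrow> 'b::treeable) \<Rightarrow> bool" where
  "ptime \<equiv> ptime_on UNIV"

lemma ptime_onI:
  assumes "poly_bd T"
    and "\<And>x s w. x \<in> D \<Longrightarrow> s 0 = code x @ w \<Longrightarrow> (\<And>i. 0 < i \<Longrightarrow> i < m \<Longrightarrow> s i = []) \<Longrightarrow>
      runs p s (T (sz x)) (s(0 := code (f x) @ w))"
  shows "ptime_on D f"
proof -
  have "computes p m T D f" unfolding computes_def using assms(2) by auto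
  then show ?thesis unfolding ptime_on_def using assms(1) by blast
qed

lemma ptime_onE:
  assumes "ptime_on D f"
  obtains p m T where "poly_bd T" "computes p m T D f"
  using assms unfolding ptime_on_def by blast

lemma ptime_on_subset: "ptime_on D f \<Longrightarrow> E \<subseteq> D \<Longrightarrow> ptime_on E f"
  unfolding ptime_on_def computes_def by (meson subsetD)

lemma ptime_on_cong: "ptime_on D f \<Longrightarrow> (\<And>x. x \<in> D \<Longrightarrow> f x = g x) \<Longrightarrow> ptime_on D g"
  unfolding ptime_on_def computes_def by simp

text \<open>Programs see trees only, so a function keeps its program when its argument and result
  are read at other types.\<close>

lemma ptime_on_coerce:
  assumes "ptime_on (h ` D) g" "\<And>x. x \<in> D \<Longrightarrow> tree_of (h x) = tree_of x"
    "\<And>x. x \<in> D \<Longrightarrow> tree_of (f x) = tree_of (g (h x))"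
  shows "ptime_on D f"
proof -
  obtain p m T where T: "poly_bd T" and p0: "computes p m T (h ` D) g"
    using assms(1) by (rule ptime_onE)
  note p = computesD[OF p0]
  show ?thesis
  proof (rule ptime_onI[OF T, of _ m p])
    fix x s w assume x: "x \<in> D" and "s 0 = code x @ w" and m: "\<And>i. 0 < i \<Longrightarrow> i < m \<Longrightarrow> s i = []"
    moreover have "code x = code (h x)" "sz x = sz (h x)" "code (f x) = code (g (h x))"
      using assms(2,3)[OF x] by (auto simp: sz_def code_def)
    ultimately show "runs p s (T (sz x)) (s(0 := code (f x) @ w))"
      using p[of "h x" s w] by auto
  qed
qed

text \<open>The output cannot outgrow the running time, by \<open>exec_length_le\<close>. Chained
  computations need this to bound the input of the later one.\<close>

lemma ptime_on_size:
  assumes "ptime_on D f"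
  obtains S where "poly_bd S" "\<forall>x \<in> D. sz (f x) \<le> S (sz x)"
proof -
  obtain p m T where T: "poly_bd T" and p0: "computes p m T D f"
    using assms by (rule ptime_onE)
  note p = computesD[OF p0]
  have "sz (f x) \<le> sz x + T (sz x)" if "x \<in> D" for x
  proof -
    have "runs p ((\<lambda>_. [])(0 := code x)) (T (sz x)) ((\<lambda>_. [])(0 := code (f x)))"
      using p[of x "(\<lambda>_. [])(0 := code x)" "[]"] that by simp
    then obtain t where "t \<le> T (sz x)" "exec p ((\<lambda>_. [])(0 := code x)) t ((\<lambda>_. [])(0 := code (f x)))"
      unfolding runs_def by blast
    with exec_length_le[OF this(2), of 0] show ?thesis by (simp add: sz_def)
  qed
  moreover have "poly_bd (\<lambda>n. n + T n)" by (intro poly_bd_intros T)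
  ultimately show thesis using that by blast
qed

lemma ptime_on_id: "ptime_on D (\<lambda>x. x)"
  by (rule ptime_onI[where T = "\<lambda>_. 1" and p = Skip and m = 0])
    (auto intro: poly_bd_intros simp: fun_upd_idem runs_Skip[simplified])

lemma ptime_on_comp:
  assumes "ptime_on E g" "ptime_on D f" "f ` D \<subseteq> E"
  shows "ptime_on D (\<lambda>x. g (f x))"
proof -
  obtain p m T where T: "poly_bd T" and p0: "computes p m T D f"
    using assms(2) by (rule ptime_onE)
  note p = computesD[OF p0]
  obtain q m' T' where T': "poly_bd T'" and q0: "computes q m' T' E g"
    using assms(1) by (rule ptime_onE)
  note q = computesD[OF q0]
  obtain S where S: "poly_bd S" "\<forall>x \<in> D. sz (f x) \<le> S (sz x)"
    using assms(2) by (rule ptime_on_size)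
  show ?thesis
  proof (rule ptime_onI[where T = "\<lambda>n. T n + T' (S n)" and m = "max m m'" and p = "p ;; q"])
    show "poly_bd (\<lambda>n. T n + T' (S n))" by (intro poly_bd_intros poly_bd_comp[OF T'] T S)
    fix x s w assume *: "x \<in> D" "s 0 = code x @ w" "\<And>i. 0 < i \<Longrightarrow> i < max m m' \<Longrightarrow> s i = []"
    have 1: "runs p s (T (sz x)) (s(0 := code (f x) @ w))" using * by (intro p) auto
    have "runs q (s(0 := code (f x) @ w)) (T' (sz (f x))) ((s(0 := code (f x) @ w))(0 := code (g (f x)) @ w))"
      using * assms(3) by (intro q) auto
    then have "runs q (s(0 := code (f x) @ w)) (T' (S (sz x))) (s(0 := code (g (f x)) @ w))"
      using poly_bd_monoD[OF T' S(2)[rule_format, OF *(1)]] runs_mono by simp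
    with 1 show "runs (p ;; q) s (T (sz x) + T' (S (sz x))) (s(0 := code (g (f x)) @ w))"
      by (rule runs_Seq)
  qed
qed

lemma ptime_comp: "ptime g \<Longrightarrow> ptime_on D f \<Longrightarrow> ptime_on D (\<lambda>x. g (f x))"
  by (rule ptime_on_comp) auto

text \<open>\<open>grab\<close> reverses the value, and \<open>pour2\<close> reverses it again onto
  stacks \<open>0\<close> and \<open>3\<close>; the second copy needs two more moves to keep its
  order.\<close>

definition dup_prog :: com where
  "dup_prog = grab 1 2 ;; pour2 1 0 3 ;; pour 3 1 ;; pour 1 0"

lemma runs_dup:
  assumes "s 0 = code x @ w" "\<And>i. 0 < i \<Longrightarrow> i < 4 \<Longrightarrow> s i = []"
  shows "runs dup_prog s (18 * sz x + 5) (s(0 := code x @ code x @ w))"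
proof -
  have z: "s (Suc 0) = []" "s 2 = []" "s 3 = []" using assms(2) by auto
  let ?n = "length (code x)"
  let ?s1 = "s(0 := w, 1 := rev (code x))"
  let ?s2 = "s(0 := code x @ w, 3 := code x)"
  let ?s3 = "s(0 := code x @ w, 1 := rev (code x))"
  have 1: "runs (grab 1 2) s (5 * ?n + 2) ?s1"
    using runs_grab[of 1 2 s "tree_of x" w] assms(1) z by (simp add: code_def)
  have "?s1(1 := [], 0 := rev (?s1 1) @ ?s1 0, 3 := rev (?s1 1) @ ?s1 3) = ?s2"
    using z by (auto simp: fun_eq_iff)
  then have 2: "runs (pour2 1 0 3) ?s1 (5 * ?n + 1) ?s2"
    using runs_pour2[of 1 0 3 ?s1] by simp
  have "?s2(3 := [], 1 := rev (?s2 3) @ ?s2 1) = ?s3"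
    using z by (auto simp: fun_eq_iff)
  then have 3: "runs (pour 3 1) ?s2 (4 * ?n + 1) ?s3"
    using runs_pour[of 3 1 ?s2] by simp
  have "?s3(1 := [], 0 := rev (?s3 1) @ ?s3 0) = s(0 := code x @ code x @ w)"
    using z by (auto simp: fun_eq_iff)
  then have 4: "runs (pour 1 0) ?s3 (4 * ?n + 1) (s(0 := code x @ code x @ w))"
    using runs_pour[of 1 0 ?s3] by simp
  show ?thesis unfolding dup_prog_def
    using runs_Seq[OF 1 runs_Seq[OF 2 runs_Seq[OF 3 4]]] by (rule runs_mono) (simp add: sz_def)
qed

definition swap_prog :: com where
  "swap_prog = grab 1 2 ;; grab 3 2 ;; pour 1 0 ;; pour 3 0"

lemma runs_swap:
  assumes "s 0 = code x @ code y @ w" "\<And>i. 0 < i \<Longrightarrow> i < 4 \<Longrightarrow> s i = []"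
  shows "runs swap_prog s (9 * sz x + 9 * sz y + 6) (s(0 := code y @ code x @ w))"
proof -
  have z: "s (Suc 0) = []" "s 2 = []" "s 3 = []" using assms(2) by auto
  let ?s1 = "s(0 := code y @ w, 1 := rev (code x))"
  let ?s2 = "s(0 := w, 1 := rev (code x), 3 := rev (code y))"
  let ?s3 = "s(0 := code x @ w, 3 := rev (code y))"
  have 1: "runs (grab 1 2) s (5 * sz x + 2) ?s1"
    using runs_grab[of 1 2 s "tree_of x" "code y @ w"] assms(1) z by (simp add: code_def sz_def)
  have "?s1(0 := w, 3 := rev (code y) @ ?s1 3) = ?s2"
    using z by (auto simp: fun_eq_iff)
  then have 2: "runs (grab 3 2) ?s1 (5 * sz y + 2) ?s2"
    using runs_grab[of 3 2 ?s1 "tree_of y" w] z by (simp add: code_def sz_def)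
  have "?s2(1 := [], 0 := rev (?s2 1) @ ?s2 0) = ?s3"
    using z by (auto simp: fun_eq_iff)
  then have 3: "runs (pour 1 0) ?s2 (4 * sz x + 1) ?s3"
    using runs_pour[of 1 0 ?s2] by (simp add: sz_def)
  have "?s3(3 := [], 0 := rev (?s3 3) @ ?s3 0) = s(0 := code y @ code x @ w)"
    using z by (auto simp: fun_eq_iff)
  then have 4: "runs (pour 3 0) ?s3 (4 * sz y + 1) (s(0 := code y @ code x @ w))"
    using runs_pour[of 3 0 ?s3] by (simp add: sz_def)
  show ?thesis unfolding swap_prog_def
    using runs_Seq[OF 1 runs_Seq[OF 2 runs_Seq[OF 3 4]]] by (rule runs_mono) simp
qed

definition drop_prog :: com where
  "drop_prog = grab 1 2 ;; clear 1"

lemma runs_drop: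
  assumes "s 0 = code x @ w" "\<And>i. 0 < i \<Longrightarrow> i < 4 \<Longrightarrow> s i = []"
  shows "runs drop_prog s (7 * sz x + 3) (s(0 := w))"
proof -
  have z: "s (Suc 0) = []" "s 2 = []" "s 3 = []" using assms(2) by auto
  let ?s1 = "s(0 := w, 1 := rev (code x))"
  have 1: "runs (grab 1 2) s (5 * sz x + 2) ?s1"
    using runs_grab[of 1 2 s "tree_of x" w] assms(1) z by (simp add: code_def sz_def)
  have "?s1(1 := []) = s(0 := w)"
    using z by (auto simp: fun_eq_iff)
  then have 2: "runs (clear 1) ?s1 (2 * sz x + 1) (s(0 := w))"
    using runs_clear[of 1 ?s1] by (simp add: sz_def)
  show ?thesis unfolding drop_prog_def
    using runs_Seq[OF 1 2] by (rule runs_mono) simp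
qed

fun push_word :: "bool list \<Rightarrow> com" where
  "push_word [] = Skip"
| "push_word (b # bs) = push_word bs ;; Push 0 b"

lemma runs_push_word: "runs (push_word bs) s (length bs + 1) (s(0 := bs @ s 0))"
proof (induction bs)
  case Nil
  then show ?case using runs_Skip by simp
next
  case (Cons b bs)
  have "(s(0 := bs @ s 0))(0 := b # (s(0 := bs @ s 0)) 0) = s(0 := (b # bs) @ s 0)" by simp
  then have "runs (push_word (b # bs)) s (length bs + 1 + 1) (s(0 := (b # bs) @ s 0))"
    using runs_Seq[OF Cons runs_Push[of 0 b]] by (simp only: push_word.simps)
  then show ?case by (rule runs_mono) simp
qed

lemma ptime_on_const: "ptime_on (D :: 'a::treeable set) (\<lambda>x. c)"
proof (rule ptime_onI[where T = "\<lambda>n. (7 * n + 3) + (sz c + 1)" and m = 4 and p = "drop_prog ;; push_word (code c)"])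
  show "poly_bd (\<lambda>n. 7 * n + 3 + (sz c + 1))" by (intro poly_bd_intros)
  fix x :: 'a and s :: store and w assume *: "s 0 = code x @ w" "\<And>i. 0 < i \<Longrightarrow> i < 4 \<Longrightarrow> s i = []"
  show "runs (drop_prog ;; push_word (code c)) s (7 * sz x + 3 + (sz c + 1)) (s(0 := code c @ w))"
    using runs_Seq[OF runs_drop[of s x w, OF *] runs_push_word[of "code c"]] by (simp add: sz_def)
qed

lemma ptime_on_Pair:
  assumes "ptime_on D f" "ptime_on D g"
  shows "ptime_on D (\<lambda>x. (f x, g x))"
proof -
  obtain p m T where T: "poly_bd T" and p0: "computes p m T D f"
    using assms(1) by (rule ptime_onE)
  note p = computesD[OF p0]
  obtain q m' T' where T': "poly_bd T'" and q0: "computes q m' T' D g"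
    using assms(2) by (rule ptime_onE)
  note q = computesD[OF q0]
  obtain S where S: "poly_bd S" "\<forall>x \<in> D. sz (g x) \<le> S (sz x)"
    using assms(2) by (rule ptime_on_size)
  let ?T = "\<lambda>n. (18 * n + 5) + (T' n + ((9 * S n + 9 * n + 6) + (T n + 1)))"
  \<comment> \<open>\<open>g\<close> works on the upper copy, with the other copy below it as rest.
    After the swap \<open>f\<close> works on the remaining copy, and the last \<open>Push\<close>
    adds the mark of a pair.\<close>
  show ?thesis
  proof (rule ptime_onI[where T = ?T and m = "max 4 (max m m')" and p = "dup_prog ;; q ;; swap_prog ;; p ;; Push 0 True"])
    show "poly_bd ?T" by (intro poly_bd_intros T T' S)
    fix x s w assume *: "x \<in> D" "s 0 = code x @ w" "\<And>i. 0 < i \<Longrightarrow> i < max 4 (max m m') \<Longrightarrow> s i = []"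
    let ?s1 = "s(0 := code x @ code x @ w)"
    let ?s2 = "s(0 := code (g x) @ code x @ w)"
    let ?s3 = "s(0 := code x @ code (g x) @ w)"
    let ?s4 = "s(0 := code (f x) @ code (g x) @ w)"
    have 1: "runs dup_prog s (18 * sz x + 5) ?s1" using * by (intro runs_dup) auto
    have 2: "runs q ?s1 (T' (sz x)) ?s2"
      using q[of x ?s1 "code x @ w"] * by simp
    have "runs swap_prog ?s2 (9 * sz (g x) + 9 * sz x + 6) ?s3"
      using runs_swap[of ?s2 "g x" x w] * by simp
    then have 3: "runs swap_prog ?s2 (9 * S (sz x) + 9 * sz x + 6) ?s3"
      by (rule runs_mono) (use S(2)[rule_format, OF *(1)] in simp)
    have 4: "runs p ?s3 (T (sz x)) ?s4"
      using p[of x ?s3 "code (g x) @ w"] * by simp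
    have 5: "runs (Push 0 True) ?s4 1 (s(0 := code (f x, g x) @ w))"
      using runs_Push[of 0 True ?s4] by simp
    show "runs (dup_prog ;; q ;; swap_prog ;; p ;; Push 0 True) s (?T (sz x)) (s(0 := code (f x, g x) @ w))"
      using runs_Seq[OF 1 runs_Seq[OF 2 runs_Seq[OF 3 runs_Seq[OF 4 5]]]] .
  qed
qed

lemma ptime_fst': "ptime (fst :: 'a::treeable \<times> 'b::treeable \<Rightarrow> 'a)"
proof (rule ptime_onI[where T = "\<lambda>n. 1 + ((9 * n + 9 * n + 6) + (7 * n + 3))" and m = 4 and
      p = "Pop 0 ;; swap_prog ;; drop_prog"])
  show "poly_bd (\<lambda>n. 1 + ((9 * n + 9 * n + 6) + (7 * n + 3)))" by (intro poly_bd_intros)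
  fix x :: "'a \<times> 'b" and s :: store and w
  assume *: "s 0 = code x @ w" "\<And>i. 0 < i \<Longrightarrow> i < 4 \<Longrightarrow> s i = []"
  obtain a b where x: "x = (a, b)" by fastforce
  let ?s1 = "s(0 := code a @ code b @ w)"
  let ?s2 = "s(0 := code b @ code a @ w)"
  have 1: "runs (Pop 0) s 1 ?s1" using runs_Pop[of 0 s] * x by simp
  have 2: "runs swap_prog ?s1 (9 * sz a + 9 * sz b + 6) ?s2"
    using runs_swap[of ?s1 a b w] * by simp
  have 3: "runs drop_prog ?s2 (7 * sz b + 3) (s(0 := code a @ w))"
    using runs_drop[of ?s2 b "code a @ w"] * by simp
  show "runs (Pop 0 ;; swap_prog ;; drop_prog) s (1 + (9 * sz x + 9 * sz x + 6 + (7 * sz x + 3)))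
      (s(0 := code (fst x) @ w))"
    using runs_Seq[OF 1 runs_Seq[OF 2 3]] unfolding x fst_conv by (rule runs_mono) simp
qed

lemma ptime_snd': "ptime (snd :: 'a::treeable \<times> 'b::treeable \<Rightarrow> 'b)"
proof (rule ptime_onI[where T = "\<lambda>n. 1 + (7 * n + 3)" and m = 4 and p = "Pop 0 ;; drop_prog"])
  show "poly_bd (\<lambda>n. 1 + (7 * n + 3))" by (intro poly_bd_intros)
  fix x :: "'a \<times> 'b" and s :: store and w
  assume *: "s 0 = code x @ w" "\<And>i. 0 < i \<Longrightarrow> i < 4 \<Longrightarrow> s i = []"
  obtain a b where x: "x = (a, b)" by fastforce
  let ?s1 = "s(0 := code a @ code b @ w)"
  have 1: "runs (Pop 0) s 1 ?s1" using runs_Pop[of 0 s] * x by simp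
  have 2: "runs drop_prog ?s1 (7 * sz a + 3) (s(0 := code b @ w))"
    using runs_drop[of ?s1 a "code b @ w"] * by simp
  show "runs (Pop 0 ;; drop_prog) s (1 + (7 * sz x + 3)) (s(0 := code (snd x) @ w))"
    using runs_Seq[OF 1 2] unfolding x snd_conv by (rule runs_mono) simp
qed

lemma ptime_on_if:
  assumes "ptime_on D b" "ptime_on {x \<in> D. b x} f" "ptime_on {x \<in> D. \<not> b x} g"
  shows "ptime_on D (\<lambda>x. if b x then f x else g x)"
proof -
  obtain p m T where T: "poly_bd T" and p0: "computes p m T D b"
    using assms(1) by (rule ptime_onE)
  note p = computesD[OF p0]
  obtain q m' T' where T': "poly_bd T'" and q0: "computes q m' T' {x \<in> D. b x} f"
    using assms(2) by (rule ptime_onE)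
  note q = computesD[OF q0]
  obtain u m'' T'' where T'': "poly_bd T''" and u0: "computes u m'' T'' {x \<in> D. \<not> b x} g"
    using assms(3) by (rule ptime_onE)
  note u = computesD[OF u0]
  let ?T = "\<lambda>n. (18 * n + 5) + (T n + Suc (3 + T' n + T'' n))"
  \<comment> \<open>\<open>True\<close> is coded by three bits and \<open>False\<close> by one; the
    branch removes the code of the condition before continuing on the saved argument.\<close>
  let ?br = "Branch 0 Skip (Pop 0 ;; Pop 0 ;; Pop 0 ;; q) (Pop 0 ;; u)"
  show ?thesis
  proof (rule ptime_onI[where T = ?T and m = "max (max 4 m) (max m' m'')" and p = "dup_prog ;; p ;; ?br"])
    show "poly_bd ?T" by (intro poly_bd_intros T T' T'')
    fix x s w assume *: "x \<in> D" "s 0 = code x @ w" "\<And>i. 0 < i \<Longrightarrow> i < max (max 4 m) (max m' m'') \<Longrightarrow> s i = []"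
    let ?s1 = "s(0 := code x @ code x @ w)"
    let ?s2 = "s(0 := code (b x) @ code x @ w)"
    let ?h = "if b x then f x else g x"
    have 1: "runs dup_prog s (18 * sz x + 5) ?s1" using * by (intro runs_dup) auto
    have 2: "runs p ?s1 (T (sz x)) ?s2" using p[of x ?s1 "code x @ w"] * by simp
    have 3: "runs ?br ?s2 (Suc (3 + T' (sz x) + T'' (sz x))) (s(0 := code ?h @ w))"
    proof (cases "b x")
      case True
      have "runs q (s(0 := code x @ w)) (T' (sz x)) (s(0 := code ?h @ w))"
        using q[of x "s(0 := code x @ w)" w] * True by simp
      then have "runs (Pop 0 ;; Pop 0 ;; Pop 0 ;; q) ?s2 (1 + (1 + (1 + T' (sz x)))) (s(0 := code ?h @ w))"
        using runs_Seq[OF runs_Pop[of 0 ?s2] runs_Seq[OF runs_Pop[of 0] runs_Seq[OF runs_Pop[of 0]]]] True by simp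
      then have "runs ?br ?s2 (Suc (1 + (1 + (1 + T' (sz x))))) (s(0 := code ?h @ w))"
        by (intro runs_Branch_True) (auto simp: True)
      then show ?thesis by (rule runs_mono) simp
    next
      case False
      have "runs u (s(0 := code x @ w)) (T'' (sz x)) (s(0 := code ?h @ w))"
        using u[of x "s(0 := code x @ w)" w] * False by simp
      then have "runs (Pop 0 ;; u) ?s2 (1 + T'' (sz x)) (s(0 := code ?h @ w))"
        using runs_Seq[OF runs_Pop[of 0 ?s2]] False by simp
      then have "runs ?br ?s2 (Suc (1 + T'' (sz x))) (s(0 := code ?h @ w))"
        by (intro runs_Branch_False) (auto simp: False)
      then show ?thesis by (rule runs_mono) simp
    qed
    show "runs (dup_prog ;; p ;; ?br) s (?T (sz x)) (s(0 := code ?h @ w))"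
      using runs_Seq[OF 1 runs_Seq[OF 2 3]] .
  qed
qed

text \<open>\<open>S\<close> has to bound the number of rounds and also the size of every
  intermediate state, since the time of a round depends on the latter.\<close>

lemma ptime_on_while:
  fixes F :: "'b::treeable list \<times> 'c::treeable \<Rightarrow> 'b list \<times> 'c"
  assumes F: "ptime_on E F" and S: "poly_bd S"
    and R: "\<And>x. x \<in> D \<Longrightarrow> \<exists>n \<le> S (sz x). (\<forall>i<n. (F ^^ i) x \<in> E \<and> fst ((F ^^ i) x) \<noteq> [] \<and> sz ((F ^^ i) x) \<le> S (sz x)) \<and>
      fst ((F ^^ n) x) = [] \<and> R x = (F ^^ n) x"
  shows "ptime_on D R"
proof -
  obtain p m T where T: "poly_bd T" and p0: "computes p m T E F"
    using F by (rule ptime_onE)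
  note p = computesD[OF p0]
  \<comment> \<open>A stack beyond the scratch space of \<open>p\<close>, and different from stack
    \<open>0\<close> even if \<open>m = 0\<close>.\<close>
  define c where "c = Suc m"
  \<comment> \<open>Below the mark of the pair, the next bit tells whether the list is empty; both
    branches put the mark back.\<close>
  define body where "body = Pop 0 ;; Branch 0 Skip (Push 0 True ;; p) (Push 0 True ;; Pop c)"
  have body_step: "runs body s (T (sz x) + 3) (s(0 := code (F x) @ w))"
    if *: "x \<in> E" "s 0 = code x @ w" "\<And>i. 0 < i \<Longrightarrow> i < m \<Longrightarrow> s i = []" "fst x \<noteq> []" for x and s :: store and w
  proof -
    obtain a l y where x: "x = (a # l, y)" using *(4) by (metis list.exhaust prod.collapse)
    let ?s = "s(0 := code (a # l) @ code y @ w)"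
    have "runs p s (T (sz x)) (s(0 := code (F x) @ w))" using * by (intro p) auto
    moreover have "s = ?s(0 := True # ?s 0)" using *(2) x by (auto simp: fun_eq_iff)
    ultimately have "runs (Push 0 True ;; p) ?s (1 + T (sz x)) (s(0 := code (F x) @ w))"
      using runs_Seq[OF runs_Push[of 0 True ?s], of p] by metis
    then have "runs (Branch 0 Skip (Push 0 True ;; p) (Push 0 True ;; Pop c)) ?s (Suc (1 + T (sz x))) (s(0 := code (F x) @ w))"
      by (intro runs_Branch_True) auto
    moreover have "runs (Pop 0) s 1 ?s" using runs_Pop[of 0 s] *(2) x by simp
    ultimately show ?thesis unfolding body_def by (intro runs_mono[OF runs_Seq]) auto
  qed
  have body_end: "runs body s 4 (s(c := []))"
    if *: "s 0 = code x @ w" "s c = [True]" "fst x = []" for x :: "'b list \<times> 'c" and s :: store and w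
  proof -
    obtain y where x: "x = ([], y)" using *(3) by (metis prod.collapse)
    let ?s = "s(0 := False # code y @ w)"
    have "(?s(0 := True # ?s 0)) = s" using *(1) x by (auto simp: fun_eq_iff)
    then have "runs (Push 0 True) ?s 1 s" using runs_Push[of 0 True ?s] by simp
    moreover have "runs (Pop c) s 1 (s(c := []))" using runs_Pop[of c s] * by simp
    ultimately have "runs (Push 0 True ;; Pop c) ?s (1 + 1) (s(c := []))" by (rule runs_Seq)
    then have "runs (Branch 0 Skip (Push 0 True ;; p) (Push 0 True ;; Pop c)) ?s (Suc (1 + 1)) (s(c := []))"
      by (intro runs_Branch_False) auto
    moreover have "runs (Pop 0) s 1 ?s" using runs_Pop[of 0 s] *(1) x by simp
    ultimately show ?thesis unfolding body_def by (intro runs_mono[OF runs_Seq]) auto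
  qed
  have loop: "runs (While c body) s (n * (T B + 4) + 6) (s(0 := code ((F ^^ n) x) @ w, c := []))"
    if "s 0 = code x @ w" "\<And>i. 0 < i \<Longrightarrow> i < m \<Longrightarrow> s i = []" "s c = [True]"
      "\<forall>i<n. (F ^^ i) x \<in> E \<and> fst ((F ^^ i) x) \<noteq> [] \<and> sz ((F ^^ i) x) \<le> B" "fst ((F ^^ n) x) = []" for n x w B and s :: store
    using that
  proof (induction n arbitrary: x s)
    case 0
    have "runs body s 4 (s(c := []))" using body_end 0 by simp
    moreover have "runs (While c body) (s(c := [])) 1 (s(c := []))" by (rule runs_While_Empty) simp
    ultimately have "runs (While c body) s (Suc (4 + 1)) (s(c := []))" using 0 by (intro runs_While_Step) auto
    moreover have "s(0 := code ((F ^^ 0) x) @ w, c := []) = s(c := [])" using 0 by (auto simp: fun_eq_iff)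
    ultimately have "runs (While c body) s (Suc (4 + 1)) (s(0 := code ((F ^^ 0) x) @ w, c := []))" by metis
    then show ?case by (rule runs_mono) simp
  next
    case (Suc n)
    let ?s = "s(0 := code (F x) @ w)"
    have x: "x \<in> E" "fst x \<noteq> []" "sz x \<le> B" using Suc.prems(4) by (metis funpow_0 zero_less_Suc)+
    have "runs body s (T (sz x) + 3) ?s" using Suc.prems x by (intro body_step) auto
    then have 1: "runs body s (T B + 3) ?s"
      by (rule runs_mono) (use poly_bd_monoD[OF T x(3)] in simp)
    have "\<forall>i<n. (F ^^ i) (F x) \<in> E \<and> fst ((F ^^ i) (F x)) \<noteq> [] \<and> sz ((F ^^ i) (F x)) \<le> B"
    proof (intro allI impI)
      fix i assume "i < n"
      then show "(F ^^ i) (F x) \<in> E \<and> fst ((F ^^ i) (F x)) \<noteq> [] \<and> sz ((F ^^ i) (F x)) \<le> B"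
        using Suc.prems(4)[rule_format, of "Suc i"] by (simp del: funpow.simps add: funpow_Suc_right)
    qed
    moreover have "fst ((F ^^ n) (F x)) = []"
      using Suc.prems(5) by (simp del: funpow.simps add: funpow_Suc_right)
    ultimately have 2: "runs (While c body) ?s (n * (T B + 4) + 6) (?s(0 := code ((F ^^ n) (F x)) @ w, c := []))"
      using Suc.prems by (intro Suc.IH) (auto simp: c_def)
    have "runs (While c body) s (Suc ((T B + 3) + (n * (T B + 4) + 6))) (?s(0 := code ((F ^^ n) (F x)) @ w, c := []))"
      using runs_While_Step[OF _ 1 2] Suc.prems(3) by simp
    then have "runs (While c body) s (Suc n * (T B + 4) + 6) (s(0 := code ((F ^^ Suc n) x) @ w, c := []))"
      by (simp del: funpow.simps add: funpow_Suc_right)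
    then show ?case .
  qed
  let ?T = "\<lambda>n. 1 + (S n * (T (S n) + 4) + 6)"
  show ?thesis
  proof (rule ptime_onI[where T = ?T and m = "Suc c" and p = "Push c True ;; While c body"])
    show "poly_bd ?T" by (intro poly_bd_intros poly_bd_comp[OF T] S)
    fix x s w assume *: "x \<in> D" "s 0 = code x @ w" "\<And>i. 0 < i \<Longrightarrow> i < Suc c \<Longrightarrow> s i = []"
    obtain n where n: "n \<le> S (sz x)" "\<forall>i<n. (F ^^ i) x \<in> E \<and> fst ((F ^^ i) x) \<noteq> [] \<and> sz ((F ^^ i) x) \<le> S (sz x)"
      "fst ((F ^^ n) x) = []" "R x = (F ^^ n) x" using R[OF *(1)] by blast
    let ?s = "s(c := [True])"
    have sc: "s c = []" using * by (simp add: c_def)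
    then have 1: "runs (Push c True) s 1 ?s" using runs_Push[of c True s] by simp
    have 2: "runs (While c body) ?s (n * (T (S (sz x)) + 4) + 6) (?s(0 := code ((F ^^ n) x) @ w, c := []))"
      using * n by (intro loop) (auto simp: c_def)
    have "?s(0 := code ((F ^^ n) x) @ w, c := []) = s(0 := code (R x) @ w)"
      using sc n(4) by (auto simp: fun_eq_iff c_def)
    then have "runs (Push c True ;; While c body) s (1 + (n * (T (S (sz x)) + 4) + 6)) (s(0 := code (R x) @ w))"
      using runs_Seq[OF 1 2] by simp
    then show "runs (Push c True ;; While c body) s (?T (sz x)) (s(0 := code (R x) @ w))"
      by (rule runs_mono) (use n(1) in \<open>simp add: mult_le_mono1\<close>)
  qed
qed

section \<open>Closure properties of polynomial time\<close>

named_theorems ptime_intros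

lemma ptime_id [ptime_intros]: "ptime (\<lambda>x. x)"
  by (rule ptime_on_id)

lemma ptime_const [ptime_intros]: "ptime (\<lambda>x. c)"
  by (rule ptime_on_const)

lemma ptime_Pair [ptime_intros]: "ptime f \<Longrightarrow> ptime g \<Longrightarrow> ptime (\<lambda>x. (f x, g x))"
  by (rule ptime_on_Pair)

lemma ptime_fst [ptime_intros]: "ptime f \<Longrightarrow> ptime (\<lambda>x. fst (f x))"
  by (rule ptime_comp[OF ptime_fst'])

lemma ptime_snd [ptime_intros]: "ptime f \<Longrightarrow> ptime (\<lambda>x. snd (f x))"
  by (rule ptime_comp[OF ptime_snd'])

lemma ptime_if [ptime_intros]:
  "ptime b \<Longrightarrow> ptime f \<Longrightarrow> ptime g \<Longrightarrow> ptime (\<lambda>x. if b x then f x else g x)"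
  by (rule ptime_on_if) (auto elim: ptime_on_subset)

lemma ptime_coerce_result:
  assumes "ptime_on D g" "\<And>x. x \<in> D \<Longrightarrow> tree_of (f x) = tree_of (g x)"
  shows "ptime_on D f"
  by (rule ptime_on_coerce[where h = "\<lambda>x. x" and g = g]) (use assms in auto)

text \<open>A list cell and a pair have the same tree.\<close>

lemma ptime_Cons [ptime_intros]: "ptime f \<Longrightarrow> ptime g \<Longrightarrow> ptime (\<lambda>x. f x # g x)"
  by (rule ptime_coerce_result[OF ptime_Pair]) auto

lemma ptime_Suc [ptime_intros]: "ptime f \<Longrightarrow> ptime (\<lambda>x. Suc (f x))"
  by (rule ptime_coerce_result[OF ptime_Pair[OF ptime_const[of "()"]]]) (auto simp: tree_of_unit_def)

lemma ptime_conj [ptime_intros]: "ptime f \<Longrightarrow> ptime g \<Longrightarrow> ptime (\<lambda>x. f x \<and> g x)"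
  by (rule ptime_on_cong[OF ptime_if[of f g "\<lambda>_. False"]]) (auto intro: ptime_const)

lemma ptime_not [ptime_intros]: "ptime f \<Longrightarrow> ptime (\<lambda>x. \<not> f x)"
  by (rule ptime_on_cong[OF ptime_if[of f "\<lambda>_. False" "\<lambda>_. True"]]) (auto intro: ptime_const)

lemma ptime_disj [ptime_intros]: "ptime f \<Longrightarrow> ptime g \<Longrightarrow> ptime (\<lambda>x. f x \<or> g x)"
  by (rule ptime_on_cong[OF ptime_not[OF ptime_conj[OF ptime_not ptime_not]]]) auto

lemma ptime_imp [ptime_intros]: "ptime f \<Longrightarrow> ptime g \<Longrightarrow> ptime (\<lambda>x. f x \<longrightarrow> g x)"
  by (rule ptime_on_cong[OF ptime_disj[OF ptime_not]]) auto

text \<open>The loop condition itself is the test: a loop that runs at most once records the outcome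
  in a flag.\<close>

lemma ptime_nonempty:
  fixes l :: "'a::treeable \<Rightarrow> 'b::treeable list"
  assumes "ptime l"
  shows "ptime (\<lambda>x. l x \<noteq> [])"
proof -
  define F :: "'b list \<times> bool \<Rightarrow> 'b list \<times> bool" where "F = (\<lambda>_. ([], True))"
  define R :: "'b list \<times> bool \<Rightarrow> 'b list \<times> bool" where "R = (\<lambda>(l, b). ([], b \<or> l \<noteq> []))"
  have "ptime R"
  proof (rule ptime_on_while[where F = F and E = UNIV and S = "\<lambda>n. n"])
    show "ptime F" unfolding F_def by (rule ptime_const)
    fix x :: "'b list \<times> bool"
    obtain l b where x: "x = (l, b)" by fastforce
    show "\<exists>n\<le>sz x. (\<forall>i<n. (F ^^ i) x \<in> UNIV \<and> fst ((F ^^ i) x) \<noteq> [] \<and> sz ((F ^^ i) x) \<le> sz x) \<and>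
          fst ((F ^^ n) x) = [] \<and> R x = (F ^^ n) x"
      by (rule exI[of _ "if l = [] then 0 else 1"]) (auto simp: x F_def R_def)
  qed (rule poly_bd_id)
  from ptime_snd[OF ptime_comp[OF this ptime_Pair[OF assms ptime_const[of False]]]]
  show ?thesis by (simp add: R_def)
qed

lemma ptime_case_list [ptime_intros]:
  fixes l :: "'a::treeable \<Rightarrow> 'b::treeable list"
  assumes "ptime (\<lambda>z. g (fst z) (fst (snd z)) (snd (snd z)))" "ptime f" "ptime l"
  shows "ptime (\<lambda>x. case l x of [] \<Rightarrow> f x | y # ys \<Rightarrow> g x y ys)"
proof -
  let ?D = "{x \<in> UNIV. l x \<noteq> []}"
  have "ptime (\<lambda>x. (x, l x))" by (intro ptime_intros assms)
  then have "ptime_on ?D (\<lambda>x. (x, l x))" by (rule ptime_on_subset) simp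
  \<comment> \<open>For a non-empty list, head and tail form the same tree as the list, so taking it
    apart is free.\<close>
  then have "ptime_on ?D (\<lambda>x. (x, hd (l x), tl (l x)))"
  proof (rule ptime_coerce_result)
    fix x assume "x \<in> ?D"
    then show "tree_of (x, hd (l x), tl (l x)) = tree_of (x, l x)" by (cases "l x") auto
  qed
  then have "ptime_on ?D (\<lambda>x. (\<lambda>z. g (fst z) (fst (snd z)) (snd (snd z))) (x, hd (l x), tl (l x)))"
    by (rule ptime_comp[OF assms(1)])
  then have "ptime_on ?D (\<lambda>x. g x (hd (l x)) (tl (l x)))" by simp
  then have "ptime (\<lambda>x. if l x \<noteq> [] then g x (hd (l x)) (tl (l x)) else f x)"
    by (intro ptime_on_if ptime_nonempty assms) (auto intro: ptime_on_subset[OF assms(2)])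
  then show ?thesis by (rule ptime_on_cong) (auto split: list.split)
qed

lemma ptime_tl [ptime_intros]: "ptime l \<Longrightarrow> ptime (\<lambda>x. tl (l x))"
  using ptime_case_list[of "\<lambda>_ _ ys. ys" "\<lambda>_. []" l]
  by (simp add: tl_def ptime_intros)

lemma sz_le_list: "a \<in> set l \<Longrightarrow> sz a < sz l"
  by (induction l) auto

lemma sz_append: "sz (xs @ ys) + 1 = sz xs + sz ys"
  by (induction xs) auto

lemma sz_take_drop: "sz (take i l) + sz (drop i l) = sz l + 1"
  using sz_append[of "take i l" "drop i l"] by simp

lemma length_less_sz: "length l < sz l"
proof (induction l)
  case (Cons a l) then show ?case using sz_pos[of a] by simp
qed simp

text \<open>A polynomial-time step function alone is not enough, since repeated doubling is
  exponential; hence the size bound on all intermediate accumulators.\<close>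

lemma ptime_foldl:
  fixes l :: "'a::treeable \<Rightarrow> 'b::treeable list" and init :: "'a \<Rightarrow> 'c::treeable"
  assumes f: "ptime (\<lambda>z. f (fst z) (fst (snd z)) (snd (snd z)))" and init: "ptime init" and l: "ptime l"
    and S: "poly_bd S" "\<And>x i. i \<le> length (l x) \<Longrightarrow> sz (foldl (f x) (init x) (take i (l x))) \<le> S (sz x)"
  shows "ptime (\<lambda>x. foldl (f x) (init x) (l x))"
proof -
  define F :: "'b list \<times> 'a \<times> 'c \<Rightarrow> 'b list \<times> 'a \<times> 'c" where
    "F = (\<lambda>z. case fst z of [] \<Rightarrow> z | a # l' \<Rightarrow> (l', fst (snd z), f (fst (snd z)) (snd (snd z)) a))"
  define R :: "'b list \<times> 'a \<times> 'c \<Rightarrow> 'b list \<times> 'a \<times> 'c" where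
    "R = (\<lambda>(l, x, acc). ([], x, foldl (f x) acc l))"
  define D where "D = range (\<lambda>x. (l x, x, init x))"
  have F_iter: "(F ^^ i) (l, x, acc) = (drop i l, x, foldl (f x) acc (take i l))" if "i \<le> length l" for i l x acc
    using that
  proof (induction i)
    case (Suc i)
    then have "drop i l = l ! i # drop (Suc i) l" by (simp add: Cons_nth_drop_Suc)
    then show ?case using Suc by (simp add: F_def take_Suc_conv_app_nth)
  qed simp
  have "ptime_on D R"
  proof (rule ptime_on_while[where F = F and E = UNIV and S = "\<lambda>n. 2 + n + n + S n"])
    have f': "ptime (\<lambda>y. (\<lambda>z. f (fst z) (fst (snd z)) (snd (snd z))) (fst (snd (fst y)), snd (snd (fst y)), fst (snd y)))"
      by (rule ptime_comp[OF f]) (intro ptime_intros)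
    then show "ptime F" unfolding F_def by (intro ptime_intros) simp
    show "poly_bd (\<lambda>n. 2 + n + n + S n)" by (intro poly_bd_intros S)
    fix z assume "z \<in> D"
    then obtain x where z: "z = (l x, x, init x)" unfolding D_def by auto
    show "\<exists>n\<le>2 + sz z + sz z + S (sz z). (\<forall>i<n. (F ^^ i) z \<in> UNIV \<and> fst ((F ^^ i) z) \<noteq> [] \<and>
        sz ((F ^^ i) z) \<le> 2 + sz z + sz z + S (sz z)) \<and> fst ((F ^^ n) z) = [] \<and> R z = (F ^^ n) z"
    proof (rule exI[of _ "length (l x)"], intro conjI allI impI)
      show "length (l x) \<le> 2 + sz z + sz z + S (sz z)" using length_less_sz[of "l x"] by (simp add: z)
      show "fst ((F ^^ length (l x)) z) = []" "R z = (F ^^ length (l x)) z"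
        unfolding z by (auto simp: F_iter R_def)
      fix i assume i: "i < length (l x)"
      then show "fst ((F ^^ i) z) \<noteq> []" unfolding z by (simp add: F_iter)
      have "sz (foldl (f x) (init x) (take i (l x))) \<le> S (sz x)" using S(2) i by simp
      also have "\<dots> \<le> S (sz z)" by (rule poly_bd_monoD[OF S(1)]) (simp add: z)
      finally show "sz ((F ^^ i) z) \<le> 2 + sz z + sz z + S (sz z)"
        using i sz_take_drop[of i "l x"] sz_pos[of "take i (l x)"] unfolding z by (simp add: F_iter)
    qed simp
  qed
  then have "ptime (\<lambda>x. R (l x, x, init x))"
    by (rule ptime_on_comp) (auto intro!: ptime_intros l init simp: D_def)
  then have "ptime (\<lambda>x. snd (snd (R (l x, x, init x))))" by (intro ptime_intros)
  then show ?thesis by (simp add: R_def)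
qed

text \<open>If the growth per step is bounded independently of the accumulator, the total growth is
  at most the length of the list times that bound.\<close>

lemma ptime_foldl_additive:
  fixes l :: "'a::treeable \<Rightarrow> 'b::treeable list" and init :: "'a \<Rightarrow> 'c::treeable"
  assumes f: "ptime (\<lambda>z. f (fst z) (fst (snd z)) (snd (snd z)))" and init: "ptime init" and l: "ptime l"
    and S: "poly_bd S" "\<And>x acc a. a \<in> set (l x) \<Longrightarrow> sz (f x acc a) \<le> sz acc + S (sz x)"
  shows "ptime (\<lambda>x. foldl (f x) (init x) (l x))"
proof -
  obtain A where A: "poly_bd A" "\<forall>x \<in> UNIV. sz (init x) \<le> A (sz x)" using init by (rule ptime_on_size)
  obtain B where B: "poly_bd B" "\<forall>x \<in> UNIV. sz (l x) \<le> B (sz x)" using l by (rule ptime_on_size)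
  have *: "sz (foldl (f x) (init x) (take i (l x))) \<le> A (sz x) + i * S (sz x)" if "i \<le> length (l x)" for x i
    using that
  proof (induction i)
    case (Suc i)
    then have "sz (foldl (f x) (init x) (take (Suc i) (l x))) \<le> sz (foldl (f x) (init x) (take i (l x))) + S (sz x)"
      using S(2)[of "l x ! i" x] by (simp add: take_Suc_conv_app_nth)
    then show ?case using Suc by simp
  qed (use A in simp)
  show ?thesis
  proof (rule ptime_foldl[OF f init l, where S = "\<lambda>n. A n + B n * S n"])
    show "poly_bd (\<lambda>n. A n + B n * S n)" by (intro poly_bd_intros A B S)
    fix x i assume i: "i \<le> length (l x)"
    have "i \<le> B (sz x)" using i length_less_sz[of "l x"] B(2) by (meson UNIV_I le_trans less_imp_le)
    then have "i * S (sz x) \<le> B (sz x) * S (sz x)" by simp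
    with *[OF i] show "sz (foldl (f x) (init x) (take i (l x))) \<le> A (sz x) + B (sz x) * S (sz x)" by linarith
  qed
qed

lemma foldl_Cons_map: "foldl (\<lambda>acc a. g a # acc) ys xs = rev (map g xs) @ ys"
  by (induction xs arbitrary: ys) auto

lemma ptime_list_elem_size:
  fixes l :: "'a::treeable \<Rightarrow> 'b::treeable list"
  assumes "ptime l" "ptime (\<lambda>z. f (fst z) (snd z))"
  obtains S where "poly_bd S" "\<forall>x. \<forall>a \<in> set (l x). sz (f x a) \<le> S (sz x)"
proof -
  obtain B where B: "poly_bd B" "\<forall>x \<in> UNIV. sz (l x) \<le> B (sz x)" using assms(1) by (rule ptime_on_size)
  obtain C where C: "poly_bd C" "\<forall>z \<in> UNIV. sz (f (fst z) (snd z)) \<le> C (sz z)"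
    using assms(2) by (rule ptime_on_size)
  have "sz (f x a) \<le> C (Suc (sz x + B (sz x)))" if "a \<in> set (l x)" for x a
  proof -
    have "sz (f x a) \<le> C (sz (x, a))" using C(2) by force
    also have "\<dots> \<le> C (Suc (sz x + B (sz x)))"
      using B(2)[rule_format, of x] sz_le_list[OF that] by (intro poly_bd_monoD[OF C(1)]) simp
    finally show ?thesis .
  qed
  moreover have "poly_bd (\<lambda>n. C (Suc (n + B n)))" by (intro poly_bd_comp[OF C(1)] poly_bd_intros B)
  ultimately show thesis using that by blast
qed

text \<open>Consing in a left fold reverses; reversal, map and append are all instances of this one
  fold.\<close>

lemma ptime_append_rev_map:
  fixes l :: "'a::treeable \<Rightarrow> 'b::treeable list"
  assumes "ptime (\<lambda>z. f (fst z) (snd z))" "ptime l" "ptime ys"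
  shows "ptime (\<lambda>x. rev (map (f x) (l x)) @ ys x)"
proof -
  obtain S where S: "poly_bd S" "\<forall>x. \<forall>a \<in> set (l x). sz (f x a) \<le> S (sz x)"
    using assms(2,1) by (rule ptime_list_elem_size)
  have f: "ptime (\<lambda>z. f (fst z) (snd (snd z)))"
    using ptime_comp[OF assms(1), of UNIV "\<lambda>z. (fst z, snd (snd z))"] by (simp add: ptime_intros)
  have "ptime (\<lambda>x. foldl (\<lambda>acc a. f x a # acc) (ys x) (l x))"
    by (rule ptime_foldl_additive[where S = "\<lambda>n. Suc (S n)"])
      (use S in \<open>auto intro!: ptime_intros poly_bd_intros assms f\<close>)
  then show ?thesis by (simp add: foldl_Cons_map)
qed

lemma ptime_rev [ptime_intros]: "ptime l \<Longrightarrow> ptime (\<lambda>x. rev (l x))"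
  using ptime_append_rev_map[of "\<lambda>_ a. a" l "\<lambda>_. []"] by (simp add: ptime_intros)

lemma ptime_map [ptime_intros]:
  "ptime (\<lambda>z. f (fst z) (snd z)) \<Longrightarrow> ptime l \<Longrightarrow> ptime (\<lambda>x. map (f x) (l x))"
  using ptime_rev[OF ptime_append_rev_map[of f l "\<lambda>_. []"]] by (simp add: ptime_intros)

lemma ptime_append [ptime_intros]: "ptime f \<Longrightarrow> ptime g \<Longrightarrow> ptime (\<lambda>x. f x @ g x)"
  using ptime_append_rev_map[of "\<lambda>_ a. a" "\<lambda>x. rev (f x)" g] by (simp add: ptime_intros)

lemma ptime_concat [ptime_intros]:
  fixes l :: "'a::treeable \<Rightarrow> 'b::treeable list list"
  assumes "ptime l"
  shows "ptime (\<lambda>x. concat (l x))"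
proof -
  have "ptime (\<lambda>z. snd z)" by (intro ptime_intros)
  then obtain S where S: "poly_bd S" "\<forall>x. \<forall>a \<in> set (l x). sz a \<le> S (sz x)"
    using ptime_list_elem_size[OF assms, of "\<lambda>_ a. a"] by auto
  have "ptime (\<lambda>x. foldl (\<lambda>acc a. acc @ a) [] (l x))"
  proof (rule ptime_foldl_additive[OF _ _ assms S(1)])
    fix x and acc a :: "'b list" assume "a \<in> set (l x)"
    then show "sz (acc @ a) \<le> sz acc + S (sz x)" using S(2) sz_append[of acc a] by fastforce
  qed (intro ptime_intros)+
  moreover have "foldl (\<lambda>acc a. acc @ a) ys xss = ys @ concat xss" for ys :: "'b list" and xss
    by (induction xss arbitrary: ys) auto
  ultimately show ?thesis by simp
qed

lemma ptime_filter [ptime_intros]: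
  fixes l :: "'a::treeable \<Rightarrow> 'b::treeable list"
  assumes "ptime (\<lambda>z. P (fst z) (snd z))" "ptime l"
  shows "ptime (\<lambda>x. filter (P x) (l x))"
proof -
  have "filter p xs = concat (map (\<lambda>a. if p a then [a] else []) xs)" for p and xs :: "'b list"
    by (induction xs) auto
  moreover have "ptime (\<lambda>x. concat (map (\<lambda>a. if P x a then [a] else []) (l x)))"
    by (intro ptime_intros assms)
  ultimately show ?thesis by simp
qed

lemma ptime_Bex [ptime_intros]:
  assumes "ptime (\<lambda>z. P (fst z) (snd z))" "ptime l"
  shows "ptime (\<lambda>x. \<exists>y \<in> set (l x). P x y)"
proof -
  have "ptime (\<lambda>x. filter (P x) (l x) \<noteq> [])" by (intro ptime_nonempty ptime_filter assms)
  then show ?thesis by (rule ptime_on_cong) (auto simp: filter_empty_conv)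
qed

lemma ptime_Ball [ptime_intros]:
  assumes "ptime (\<lambda>z. P (fst z) (snd z))" "ptime l"
  shows "ptime (\<lambda>x. \<forall>y \<in> set (l x). P x y)"
  using ptime_not[OF ptime_Bex[OF ptime_not[OF assms(1)] assms(2)]] by simp

section \<open>Testing equality\<close>

primrec subtrees :: "tree \<Rightarrow> tree list" where
  "subtrees Lf = []"
| "subtrees (Nd a b) = a # subtrees b"

lemma tree_of_subtrees [simp]: "tree_of (subtrees t) = t"
  by (induction t) (auto simp: tree_of_tree_def)

lemma subtrees_inject [simp]: "subtrees s = subtrees t \<longleftrightarrow> s = t"
  by (metis tree_of_subtrees)

lemma ptime_subtrees: "ptime f \<Longrightarrow> ptime (\<lambda>x. subtrees (tree_of (f x)))"
  by (rule ptime_coerce_result) auto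

text \<open>A work list for comparing two trees, each viewed as the list of left subtrees along its
  right spine; by \<open>tree_of_subtrees\<close> this view costs nothing. A mismatch empties the
  work list and thereby stops the loop.\<close>

definition eq_step :: "(tree list \<times> tree list) list \<times> bool \<Rightarrow> (tree list \<times> tree list) list \<times> bool" where
  "eq_step z = (case fst z of [] \<Rightarrow> z | st # r \<Rightarrow>
    (case fst st of
      [] \<Rightarrow> (case snd st of [] \<Rightarrow> (r, snd z) | _ # _ \<Rightarrow> ([], False))
    | a # s \<Rightarrow> (case snd st of [] \<Rightarrow> ([], False)
        | b # t \<Rightarrow> ((subtrees (tree_of a), subtrees (tree_of b)) # (s, t) # r, snd z))))"

lemma ptime_eq_step: "ptime eq_step"
  unfolding eq_step_def by (intro ptime_intros ptime_subtrees)

lemma sz_subtrees [simp]: "sz (subtrees a) = sz a"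
  by (simp add: sz_def code_def tree_of_tree_def)

text \<open>Taking two list cells apart lowers the measure by two, while the code of the state keeps
  its size: one new entry of the work list replaces the two cells.\<close>

lemma eq_step_terminates:
  "\<exists>n \<le> sum_list (map (\<lambda>(s, t). sz s + sz t) wl). (\<forall>i<n. fst ((eq_step ^^ i) (wl, b)) \<noteq> [] \<and> sz ((eq_step ^^ i) (wl, b)) \<le> sz (wl, b)) \<and>
    (eq_step ^^ n) (wl, b) = ([], b \<and> (\<forall>(s, t) \<in> set wl. s = t))"
proof (induction "sum_list (map (\<lambda>(s, t). sz s + sz t) wl)" arbitrary: wl rule: less_induct)
  case less
  let ?\<mu> = "\<lambda>wl :: (tree list \<times> tree list) list. sum_list (map (\<lambda>(s, t). sz s + sz t) wl)"
  have step: ?case if "eq_step (wl, b) = (wl', b)" "wl \<noteq> []" "?\<mu> wl' < ?\<mu> wl" "sz wl' \<le> sz wl"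
      "(\<forall>(s, t) \<in> set wl'. s = t) \<longleftrightarrow> (\<forall>(s, t) \<in> set wl. s = t)" for wl'
  proof -
    obtain n where n: "n \<le> ?\<mu> wl'" "\<forall>i<n. fst ((eq_step ^^ i) (wl', b)) \<noteq> [] \<and> sz ((eq_step ^^ i) (wl', b)) \<le> sz (wl', b)"
      "(eq_step ^^ n) (wl', b) = ([], b \<and> (\<forall>(s, t) \<in> set wl'. s = t))"
      using less[OF \<open>?\<mu> wl' < ?\<mu> wl\<close>] by blast
    have it: "(eq_step ^^ Suc i) (wl, b) = (eq_step ^^ i) (wl', b)" for i
      using that(1) by (simp del: funpow.simps add: funpow_Suc_right)
    show ?thesis
    proof (rule exI[of _ "Suc n"], intro conjI allI impI)
      show "Suc n \<le> ?\<mu> wl" using n(1) that(3) by simp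
      show "(eq_step ^^ Suc n) (wl, b) = ([], b \<and> (\<forall>(s, t) \<in> set wl. s = t))"
        unfolding it n(3) using that(5) by simp
      fix i assume i: "i < Suc n"
      show "fst ((eq_step ^^ i) (wl, b)) \<noteq> []" "sz ((eq_step ^^ i) (wl, b)) \<le> sz (wl, b)"
        using i n(2) that(2,4) by (cases i; auto simp: it simp del: funpow.simps(2); fastforce)+
    qed
  qed
  have stop: ?case if "eq_step (wl, b) = ([], False)" "wl \<noteq> []" "\<not> (\<forall>(s, t) \<in> set wl. s = t)"
  proof (rule exI[of _ 1], intro conjI allI impI)
    show "1 \<le> ?\<mu> wl" using that(2) by (cases wl) (auto simp: Suc_le_eq)
  qed (use that in auto)
  show ?case
  proof (cases wl)
    case Nil
    then show ?thesis by (intro exI[of _ 0]) auto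
  next
    case (Cons st r)
    obtain s t where st: "st = (s, t)" by fastforce
    show ?thesis
    proof (cases s)
      case s: Nil
      show ?thesis
      proof (cases t)
        case Nil
        then show ?thesis using s Cons st by (intro step[of r]) (auto simp: eq_step_def)
      qed (use s Cons st in \<open>auto intro!: stop simp: eq_step_def\<close>)
    next
      case s: (Cons a s')
      show ?thesis
      proof (cases t)
        case (Cons c t')
        then show ?thesis using s \<open>wl = st # r\<close> st
          by (intro step[of "(subtrees a, subtrees c) # (s', t') # r"]) (auto simp: eq_step_def tree_of_tree_def)
      qed (use s Cons st in \<open>auto intro!: stop simp: eq_step_def\<close>)
    qed
  qed
qed

lemma ptime_eq [ptime_intros]:
  fixes f :: "'a::treeable \<Rightarrow> 'b::treeable"
  assumes "ptime f" "ptime g"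
  shows "ptime (\<lambda>x. f x = g x)"
proof -
  define R :: "(tree list \<times> tree list) list \<times> bool \<Rightarrow> (tree list \<times> tree list) list \<times> bool" where
    "R = (\<lambda>(wl, b). ([], b \<and> (\<forall>(s, t) \<in> set wl. s = t)))"
  have "ptime R"
  proof (rule ptime_on_while[OF ptime_eq_step, of "\<lambda>n. n"])
    fix z :: "(tree list \<times> tree list) list \<times> bool"
    obtain wl b where z: "z = (wl, b)" by fastforce
    have "sum_list (map (\<lambda>(s, t). sz s + sz t) wl) \<le> sz wl" by (induction wl) auto
    then have le: "sum_list (map (\<lambda>(s, t). sz s + sz t) wl) \<le> sz z" by (simp add: z)
    obtain n where n: "n \<le> sum_list (map (\<lambda>(s, t). sz s + sz t) wl)"
      "\<forall>i<n. fst ((eq_step ^^ i) (wl, b)) \<noteq> [] \<and> sz ((eq_step ^^ i) (wl, b)) \<le> sz (wl, b)"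
      "(eq_step ^^ n) (wl, b) = ([], b \<and> (\<forall>(s, t) \<in> set wl. s = t))"
      using eq_step_terminates[of wl b] by (elim exE conjE)
    show "\<exists>n\<le>sz z. (\<forall>i<n. (eq_step ^^ i) z \<in> UNIV \<and> fst ((eq_step ^^ i) z) \<noteq> [] \<and> sz ((eq_step ^^ i) z) \<le> sz z) \<and>
        fst ((eq_step ^^ n) z) = [] \<and> R z = (eq_step ^^ n) z"
      by (rule exI[of _ n], intro conjI) (use n le in \<open>simp_all add: z R_def del: sz_simps\<close>)
  qed (rule poly_bd_id)
  moreover have "ptime (\<lambda>x. ([(subtrees (tree_of (f x)), subtrees (tree_of (g x)))], True))"
    by (intro ptime_intros ptime_subtrees assms)
  ultimately have "ptime (\<lambda>x. snd (R ([(subtrees (tree_of (f x)), subtrees (tree_of (g x)))], True)))"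
    by (rule ptime_snd[OF ptime_comp])
  then show ?thesis by (simp add: R_def)
qed

section \<open>Arithmetic and operations on lists\<close>

lemma tree_of_replicate_unit: "tree_of (replicate n ()) = tree_of n"
  by (induction n) (auto simp: tree_of_unit_def)

text \<open>A number and the list of that many units have the same tree; arithmetic reduces to
  operations on such lists.\<close>

lemma ptime_replicate_unit: "ptime f \<Longrightarrow> ptime (\<lambda>x. replicate (f x) ())"
  by (rule ptime_coerce_result) (auto simp: tree_of_replicate_unit)

lemma ptime_length [ptime_intros]:
  assumes "ptime l"
  shows "ptime (\<lambda>x. length (l x))"
proof (rule ptime_coerce_result)
  show "ptime (\<lambda>x. map (\<lambda>_. ()) (l x))" by (intro ptime_intros assms)
  fix x show "tree_of (length (l x)) = tree_of (map (\<lambda>_. ()) (l x))"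
    by (simp add: map_replicate_const tree_of_replicate_unit)
qed

lemma ptime_replicate [ptime_intros]:
  assumes "ptime n" "ptime f"
  shows "ptime (\<lambda>x. replicate (n x) (f x))"
proof -
  have "ptime (\<lambda>z. f (fst z))" by (rule ptime_comp[OF assms(2)]) (intro ptime_intros)
  then have "ptime (\<lambda>x. map (\<lambda>_. f x) (replicate (n x) ()))" by (intro ptime_intros ptime_replicate_unit assms)
  then show ?thesis by (simp add: map_replicate)
qed

lemma ptime_add [ptime_intros]:
  assumes "ptime f" "ptime g"
  shows "ptime (\<lambda>x. (f x :: nat) + g x)"
proof -
  have "ptime (\<lambda>x. length (replicate (f x) () @ replicate (g x) ()))" by (intro ptime_intros assms)
  then show ?thesis by simp
qed

lemma ptime_mult [ptime_intros]:
  assumes "ptime f" "ptime g"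
  shows "ptime (\<lambda>x. (f x :: nat) * g x)"
proof -
  have "ptime (\<lambda>z. g (fst z))" by (rule ptime_comp[OF assms(2)]) (intro ptime_intros)
  then have "ptime (\<lambda>x. length (concat (map (\<lambda>_. replicate (g x) ()) (replicate (f x) ()))))"
    by (intro ptime_intros assms)
  then show ?thesis by (simp add: length_concat sum_list_triv o_def sum_list_replicate)
qed

lemma foldl_tl: "foldl (\<lambda>acc _. tl acc) xs us = drop (length us) xs"
  by (induction us arbitrary: xs) (auto simp: drop_Suc)

lemma ptime_drop [ptime_intros]:
  assumes "ptime n" "ptime f"
  shows "ptime (\<lambda>x. drop (n x) (f x))"
proof -
  have "ptime (\<lambda>x. foldl (\<lambda>acc _. tl acc) (f x) (replicate (n x) ()))"
  proof (rule ptime_foldl_additive[where S = "\<lambda>_. 0"])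
    fix acc :: "'b list" show "sz (tl acc) \<le> sz acc + 0" by (cases acc) auto
  qed (intro ptime_intros poly_bd_intros assms)+
  then show ?thesis by (simp add: foldl_tl)
qed

lemma ptime_take [ptime_intros]:
  assumes "ptime n" "ptime f"
  shows "ptime (\<lambda>x. take (n x) (f x))"
proof -
  have sub: "ptime (\<lambda>x. length (drop (n x) (replicate (length (f x)) ())))" by (intro ptime_intros assms)
  have "ptime (\<lambda>x. rev (drop (length (drop (n x) (replicate (length (f x)) ()))) (rev (f x))))"
    by (intro ptime_rev ptime_drop[OF sub] assms)
  moreover have "rev (drop (length (drop (n x) (replicate (length (f x)) ()))) (rev (f x))) = take (n x) (f x)" for x
    by (simp add: rev_drop) (metis diff_diff_cancel min_def nat_le_linear take_all_iff diff_is_0_eq' diff_zero)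
  ultimately show ?thesis by simp
qed

lemma ptime_diff [ptime_intros]:
  assumes "ptime f" "ptime g"
  shows "ptime (\<lambda>x. (f x :: nat) - g x)"
proof -
  have "ptime (\<lambda>x. length (drop (g x) (replicate (f x) ())))" by (intro ptime_intros assms)
  then show ?thesis by simp
qed

lemma ptime_le [ptime_intros]:
  assumes "ptime f" "ptime g"
  shows "ptime (\<lambda>x. (f x :: nat) \<le> g x)"
proof -
  have "ptime (\<lambda>x. f x - g x = 0)" by (intro ptime_intros assms)
  then show ?thesis by simp
qed

lemma ptime_less [ptime_intros]:
  assumes "ptime f" "ptime g"
  shows "ptime (\<lambda>x. (f x :: nat) < g x)"
proof -
  have "ptime (\<lambda>x. Suc (f x) \<le> g x)" by (intro ptime_intros assms)
  then show ?thesis by (simp add: Suc_le_eq)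
qed

lemma foldl_length_Cons: "foldl (\<lambda>acc _. length acc # acc) [] us = rev [0..<length us]"
  by (induction us rule: rev_induct) auto

lemma sz_rev [simp]: "sz (rev xs) = sz xs"
proof (induction xs)
  case (Cons a xs) then show ?case using sz_append[of "rev xs" "[a]"] by simp
qed simp

lemma sz_upt: "sz [0..<n] \<le> Suc n * (2 * n + 2)"
proof (induction n)
  case (Suc n)
  have "sz [0..<Suc n] \<le> sz [0..<n] + 2 * n + 2" using sz_append[of "[0..<n]" "[n]"] by simp
  also have "\<dots> \<le> Suc n * (2 * n + 2) + 2 * n + 2" using Suc by simp
  also have "\<dots> \<le> Suc (Suc n) * (2 * Suc n + 2)" by (simp add: algebra_simps)
  finally show ?case .
qed simp

text \<open>The number added in a step grows with the accumulator, so
  \<open>ptime_foldl_additive\<close> does not apply and the intermediate lists are bounded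
  explicitly.\<close>

lemma ptime_upt0:
  assumes "ptime n"
  shows "ptime (\<lambda>x. [0..<n x])"
proof -
  obtain S where S: "poly_bd S" "\<forall>x \<in> UNIV. sz (n x) \<le> S (sz x)" using assms by (rule ptime_on_size)
  have "ptime (\<lambda>x. foldl (\<lambda>acc _. length acc # acc) [] (replicate (n x) ()))"
  proof (rule ptime_foldl[where S = "\<lambda>m. Suc (S m) * (2 * S m + 2)"])
    show "poly_bd (\<lambda>m. Suc (S m) * (2 * S m + 2))" by (intro poly_bd_intros S)
    fix x i assume "i \<le> length (replicate (n x) ())"
    then have "i \<le> S (sz x)" using S(2)[rule_format, of x] by simp
    then have "Suc i * (2 * i + 2) \<le> Suc (S (sz x)) * (2 * S (sz x) + 2)" by (intro mult_le_mono) auto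
    then show "sz (foldl (\<lambda>acc _. length acc # acc) [] (take i (replicate (n x) ()))) \<le> Suc (S (sz x)) * (2 * S (sz x) + 2)"
      using sz_upt[of i] \<open>i \<le> length _\<close> by (simp only: foldl_length_Cons sz_rev) simp
  qed (intro ptime_intros assms)+
  then have "ptime (\<lambda>x. rev (foldl (\<lambda>acc _. length acc # acc) [] (replicate (n x) ())))" by (rule ptime_rev)
  then show ?thesis by (simp add: foldl_length_Cons)
qed

lemma ptime_upt [ptime_intros]:
  assumes "ptime m" "ptime n"
  shows "ptime (\<lambda>x. [m x..<n x])"
proof -
  have m: "ptime (\<lambda>z. m (fst z))" by (rule ptime_comp[OF assms(1)]) (intro ptime_intros)
  have "ptime (\<lambda>x. map (\<lambda>i. i + m x) [0..<n x - m x])" by (intro ptime_intros ptime_upt0 assms m)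
  moreover have "map (\<lambda>i. i + m x) [0..<n x - m x] = [m x..<n x]" for x
    by (rule nth_equalityI) auto
  ultimately show ?thesis by simp
qed

lemma ptime_product [ptime_intros]:
  assumes "ptime f" "ptime g"
  shows "ptime (\<lambda>x. List.product (f x) (g x))"
proof -
  have g: "ptime (\<lambda>z. g (fst z))" by (rule ptime_comp[OF assms(2)]) (intro ptime_intros)
  have "ptime (\<lambda>x. concat (map (\<lambda>a. map (\<lambda>b. (a, b)) (g x)) (f x)))" by (intro ptime_intros g assms)
  then show ?thesis by (simp add: product_concat_map)
qed

text \<open>The length \<open>r\<close> is a constant, so this is a product of a fixed number of
  factors. The blocks, of length \<open>2 ^ d\<close> with \<open>d\<close> fixed, depend on
  it.\<close>

lemma ptime_n_lists [ptime_intros]: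
  assumes "ptime f"
  shows "ptime (\<lambda>x. List.n_lists r (f x))"
proof (induction r)
  case (Suc r)
  have g: "ptime (\<lambda>z. f (fst z))" by (rule ptime_comp[OF assms]) (intro ptime_intros)
  show ?case unfolding List.n_lists.simps by (intro ptime_intros g Suc)
qed (simp add: ptime_const)

text \<open>A total variant of \<open>nth\<close>, so that no side condition on the index arises in
  polynomial-time claims.\<close>

definition get :: "'a \<Rightarrow> 'a list \<Rightarrow> nat \<Rightarrow> 'a" where
  "get d xs n = (case drop n xs of [] \<Rightarrow> d | y # _ \<Rightarrow> y)"

lemma get_nth [simp]: "n < length xs \<Longrightarrow> get d xs n = xs ! n"
  by (simp add: get_def Cons_nth_drop_Suc[symmetric])

lemma ptime_get [ptime_intros]:
  "ptime d \<Longrightarrow> ptime f \<Longrightarrow> ptime n \<Longrightarrow> ptime (\<lambda>x. get (d x) (f x) (n x))"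
  unfolding get_def by (intro ptime_intros)

subsection \<open>Functions on words\<close>

text \<open>The code of a list without its end mark, which makes it compatible with
  concatenation.\<close>

definition bits_code :: "bool list \<Rightarrow> bool list" where
  "bits_code bs = concat (map (\<lambda>b. True # code b) bs)"

lemma bits_code_simps:
  "bits_code [] = []" "bits_code (b # bs) = True # code b @ bits_code bs"
  "bits_code (bs @ cs) = bits_code bs @ bits_code cs"
  by (auto simp: bits_code_def)

lemma code_bits: "code (bs :: bool list) = bits_code bs @ [False]"
  by (induction bs) (auto simp: bits_code_simps)

lemma sz_bits_le: "sz (bs :: bool list) \<le> 4 * length bs + 1"
proof (induction bs)
  case (Cons b bs) then show ?case using sz_bool_le[of b] by simp
qed simp

definition read_loop :: com where
  "read_loop = While 1 (Branch 1 Skip (Pop 1 ;; push_word [True, True, False, False]) (Pop 1 ;; push_word [True, False]))"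

lemma runs_read_loop: "runs read_loop s (8 * length (s 1) + 1) (s(1 := [], 0 := bits_code (rev (s 1)) @ s 0))"
proof (induction "s 1" arbitrary: s)
  case Nil
  then show ?case using runs_While_Empty[of s 1] by (simp add: read_loop_def fun_upd_idem bits_code_simps)
next
  case (Cons x w)
  let ?s = "s(1 := w, 0 := bits_code [x] @ s 0)"
  have "runs (Pop 1 ;; push_word (bits_code [x])) s (1 + (length (bits_code [x]) + 1)) ?s"
    using runs_Seq[OF runs_Pop[of 1 s] runs_push_word[of "bits_code [x]"]] Cons(2)[symmetric] by simp
  moreover have "length (bits_code [x]) \<le> 4" by (cases x) (auto simp: bits_code_def)
  ultimately have "runs (Pop 1 ;; push_word (bits_code [x])) s 6 ?s" by (elim runs_mono) simp
  then have "runs (if x then Pop 1 ;; push_word [True, True, False, False] else Pop 1 ;; push_word [True, False]) s 6 ?s"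
    by (cases x) (simp_all add: bits_code_def)
  then have 1: "runs (Branch 1 Skip (Pop 1 ;; push_word [True, True, False, False]) (Pop 1 ;; push_word [True, False])) s (Suc 6) ?s"
    by (rule runs_Branch_Cons[of s 1 x w, OF Cons(2)[symmetric]])
  have 2: "runs read_loop ?s (8 * length (?s 1) + 1) (?s(1 := [], 0 := bits_code (rev (?s 1)) @ ?s 0))"
    by (rule Cons(1)) simp
  have "runs read_loop s (Suc (Suc 6 + (8 * length (?s 1) + 1))) (?s(1 := [], 0 := bits_code (rev (?s 1)) @ ?s 0))"
    unfolding read_loop_def by (rule runs_While_Step[OF _ 1 2[unfolded read_loop_def]]) (use Cons(2) in auto)
  moreover have "?s(1 := [], 0 := bits_code (rev (?s 1)) @ ?s 0) = s(1 := [], 0 := bits_code (rev (s 1)) @ s 0)"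
    using Cons(2)[symmetric] by (auto simp: fun_eq_iff bits_code_simps)
  ultimately have "runs read_loop s (Suc (Suc 6 + (8 * length (?s 1) + 1))) (s(1 := [], 0 := bits_code (rev (s 1)) @ s 0))"
    by (simp only:)
  then show ?case by (rule runs_mono) (use Cons(2)[symmetric] in simp)
qed

text \<open>Nothing may lie below the code here: the loop ends when stack \<open>0\<close> is empty,
  after the end mark has been removed.\<close>

definition write_loop :: com where
  "write_loop = While 0 (Branch 0 Skip
    (Pop 0 ;; Branch 0 Skip (Pop 0 ;; Pop 0 ;; Pop 0 ;; Push 1 True) (Pop 0 ;; Push 1 False))
    (Pop 0))"

lemma runs_write_loop: "s 0 = code bs \<Longrightarrow> runs write_loop s (8 * length bs + 4) (s(0 := [], 1 := rev bs @ s 1))"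
proof (induction bs arbitrary: s)
  case Nil
  let ?s = "s(0 := [])"
  have "runs (Pop 0) s 1 ?s" using runs_Pop[of 0 s] Nil by simp
  then have 1: "runs (Branch 0 Skip
    (Pop 0 ;; Branch 0 Skip (Pop 0 ;; Pop 0 ;; Pop 0 ;; Push 1 True) (Pop 0 ;; Push 1 False)) (Pop 0)) s (Suc 1) ?s"
    by (rule runs_Branch_False[rotated]) (use Nil in simp)
  have 2: "runs write_loop ?s 1 ?s" unfolding write_loop_def by (rule runs_While_Empty) simp
  have "runs write_loop s (Suc (Suc 1 + 1)) ?s"
    unfolding write_loop_def by (rule runs_While_Step[OF _ 1 2[unfolded write_loop_def]]) (use Nil in simp)
  then have "runs write_loop s (8 * length ([] :: bool list) + 4) ?s" by (rule runs_mono) simp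
  moreover have "s(0 := [], 1 := rev [] @ s 1) = ?s" by (auto simp: fun_eq_iff)
  ultimately show ?case by metis
next
  case (Cons b bs)
  let ?inner = "Branch 0 Skip (Pop 0 ;; Pop 0 ;; Pop 0 ;; Push 1 True) (Pop 0 ;; Push 1 False)"
  let ?s1 = "s(0 := code b @ code bs)"
  let ?s = "s(0 := code bs, 1 := b # s 1)"
  have 0: "runs (Pop 0) s 1 ?s1" using runs_Pop[of 0 s] Cons(2) by simp
  have 1: "runs ?inner ?s1 5 ?s"
  proof (cases b)
    case True
    have "runs (Pop 0 ;; Pop 0 ;; Pop 0 ;; Push 1 True) ?s1 (1 + (1 + (1 + 1))) ?s"
      using runs_Seq[OF runs_Pop[of 0 ?s1] runs_Seq[OF runs_Pop[of 0] runs_Seq[OF runs_Pop[of 0] runs_Push[of 1 True]]]] True by simp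
    then have "runs ?inner ?s1 (Suc (1 + (1 + (1 + 1)))) ?s"
      by (rule runs_Branch_True[rotated]) (simp add: True)
    then show ?thesis by (rule runs_mono) simp
  next
    case False
    have "runs (Pop 0 ;; Push 1 False) ?s1 (1 + 1) ?s"
      using runs_Seq[OF runs_Pop[of 0 ?s1] runs_Push[of 1 False]] False by simp
    then have "runs ?inner ?s1 (Suc (1 + 1)) ?s"
      by (rule runs_Branch_False[rotated]) (simp add: False)
    then show ?thesis by (rule runs_mono) simp
  qed
  have 2: "runs (Branch 0 Skip (Pop 0 ;; ?inner) (Pop 0)) s (Suc (1 + 5)) ?s"
    using runs_Seq[OF 0 1] by (rule runs_Branch_True[rotated]) (use Cons(2) in simp)
  have 3: "runs write_loop ?s (8 * length bs + 4) (?s(0 := [], 1 := rev bs @ ?s 1))"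
    by (rule Cons(1)) simp
  have "runs write_loop s (Suc (Suc (1 + 5) + (8 * length bs + 4))) (?s(0 := [], 1 := rev bs @ ?s 1))"
    unfolding write_loop_def by (rule runs_While_Step[OF _ 2 3[unfolded write_loop_def]]) (use Cons(2) in simp)
  moreover have "?s(0 := [], 1 := rev bs @ ?s 1) = s(0 := [], 1 := rev (b # bs) @ s 1)"
    by (auto simp: fun_eq_iff)
  ultimately have "runs write_loop s (Suc (Suc (1 + 5) + (8 * length bs + 4))) (s(0 := [], 1 := rev (b # bs) @ s 1))"
    by (simp only:)
  then show ?case by (rule runs_mono) simp
qed

text \<open>Raw words in stack \<open>0\<close>, as the notions of reduction and enumeration use
  them, in contrast to the coded values of \<open>computes\<close>.\<close>

definition word_program :: "com \<Rightarrow> nat \<Rightarrow> (nat \<Rightarrow> nat) \<Rightarrow> (bool list \<Rightarrow> bool list) \<Rightarrow> bool" where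
  "word_program p m T f \<longleftrightarrow> (\<forall>s. (\<forall>i. 0 < i \<and> i < m \<longrightarrow> s i = []) \<longrightarrow> runs p s (T (length (s 0))) (s(0 := f (s 0))))"

lemma ptime_word_program:
  assumes "ptime f"
  obtains p m T where "poly_bd T" "word_program p m T f"
proof -
  obtain p m T where T: "poly_bd T" and p: "computes p m T UNIV f" using assms by (rule ptime_onE)
  obtain S where S: "poly_bd S" "\<forall>x \<in> UNIV. sz (f x) \<le> S (sz x)" using assms by (rule ptime_on_size)
  let ?N = "\<lambda>n. 4 * n + 1"
  let ?T = "\<lambda>n. (4 * n + 1) + (1 + ((8 * n + 1) + (T (?N n) + ((8 * S (?N n) + 4) + (4 * S (?N n) + 1)))))"
  let ?p = "pour 0 1 ;; Push 0 False ;; read_loop ;; p ;; write_loop ;; pour 1 0"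
  have "poly_bd ?T" by (intro poly_bd_intros poly_bd_comp[OF T] poly_bd_comp[OF S(1)])
  moreover have "word_program ?p (max 2 m) ?T f"
    unfolding word_program_def
  proof (intro allI impI)
    fix s :: store assume *: "\<forall>i. 0 < i \<and> i < max 2 m \<longrightarrow> s i = []"
    define bs where "bs = s 0"
    have s1: "s (Suc 0) = []" using * by simp
    let ?n = "length bs"
    have 1: "runs (pour 0 1) s (4 * ?n + 1) (s(0 := [], 1 := rev bs))"
      using runs_pour[of 0 1 s] s1 by (simp add: bs_def)
    have 2: "runs (Push 0 False) (s(0 := [], 1 := rev bs)) 1 (s(0 := [False], 1 := rev bs))"
      using runs_Push[of 0 False "s(0 := [], 1 := rev bs)"] by (simp add: fun_upd_twist)
    have "(s(0 := [False], 1 := rev bs))(1 := [], 0 := bits_code (rev ((s(0 := [False], 1 := rev bs)) 1)) @ (s(0 := [False], 1 := rev bs)) 0)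
        = s(0 := code bs)" using s1 by (auto simp: code_bits fun_eq_iff)
    then have 3: "runs read_loop (s(0 := [False], 1 := rev bs)) (8 * ?n + 1) (s(0 := code bs))"
      using runs_read_loop[of "s(0 := [False], 1 := rev bs)"] by simp
    have "runs p (s(0 := code bs)) (T (sz bs)) (s(0 := code (f bs)))"
      using computesD[OF p, of bs "s(0 := code bs)" "[]"] * by simp
    then have 4: "runs p (s(0 := code bs)) (T (?N ?n)) (s(0 := code (f bs)))"
      by (rule runs_mono) (intro poly_bd_monoD[OF T] sz_bits_le)
    have len: "length (f bs) \<le> S (?N ?n)"
      using length_less_sz[of "f bs"] S(2)[rule_format, of bs] poly_bd_monoD[OF S(1) sz_bits_le[of bs]] by simp
    have "(s(0 := code (f bs)))(0 := [], 1 := rev (f bs) @ (s(0 := code (f bs))) 1) = s(0 := [], 1 := rev (f bs))"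
      using s1 by (auto simp: fun_eq_iff)
    then have "runs write_loop (s(0 := code (f bs))) (8 * length (f bs) + 4) (s(0 := [], 1 := rev (f bs)))"
      using runs_write_loop[of "s(0 := code (f bs))" "f bs"] by simp
    then have 5: "runs write_loop (s(0 := code (f bs))) (8 * S (?N ?n) + 4) (s(0 := [], 1 := rev (f bs)))"
      by (rule runs_mono) (use len in simp)
    have "(s(0 := [], 1 := rev (f bs)))(1 := [], 0 := rev ((s(0 := [], 1 := rev (f bs))) 1) @ (s(0 := [], 1 := rev (f bs))) 0) = s(0 := f bs)"
      using s1 by (auto simp: fun_eq_iff)
    then have "runs (pour 1 0) (s(0 := [], 1 := rev (f bs))) (4 * length (f bs) + 1) (s(0 := f bs))"
      using runs_pour[of 1 0 "s(0 := [], 1 := rev (f bs))"] by simp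
    then have 6: "runs (pour 1 0) (s(0 := [], 1 := rev (f bs))) (4 * S (?N ?n) + 1) (s(0 := f bs))"
      by (rule runs_mono) (use len in simp)
    show "runs ?p s (?T (length (s 0))) (s(0 := f (s 0)))"
      using runs_Seq[OF 1 runs_Seq[OF 2 runs_Seq[OF 3 runs_Seq[OF 4 runs_Seq[OF 5 6]]]]]
      by (simp only: bs_def)
  qed
  ultimately show thesis by (rule that)
qed

section \<open>Combination with arbitrary given programs\<close>

fun clears :: "nat list \<Rightarrow> com" where
  "clears [] = Skip"
| "clears (r # rs) = clear r ;; clears rs"

lemma runs_clears:
  assumes "\<And>r. length (s r) \<le> L"
  shows "runs (clears rs) s ((2 * L + 1) * length rs + 1) (\<lambda>r. if r \<in> set rs then [] else s r)"
  using assms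
proof (induction rs arbitrary: s)
  case Nil
  then show ?case using runs_Skip by simp
next
  case (Cons r rs)
  have 1: "runs (clear r) s (2 * L + 1) (s(r := []))"
    using runs_clear[of r s] by (rule runs_mono) (use Cons.prems in simp)
  have 2: "runs (clears rs) (s(r := [])) ((2 * L + 1) * length rs + 1) (\<lambda>i. if i \<in> set rs then [] else (s(r := [])) i)"
    by (rule Cons.IH) (use Cons.prems in simp)
  have "(\<lambda>i. if i \<in> set rs then [] else (s(r := [])) i) = (\<lambda>i. if i \<in> set (r # rs) then [] else s i)"
    by (auto simp: fun_eq_iff)
  then show ?case using runs_Seq[OF 1 2] by simp
qed

lemma regs_bound: obtains M where "\<forall>r \<in> regs p. r < M" "n \<le> M"
proof -
  have "r < max n (Suc (Max (regs p)))" if "r \<in> regs p" for r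
    using Max_ge[OF finite_regs that] by linarith
  then have "\<forall>r \<in> regs p. r < max n (Suc (Max (regs p)))" by blast
  then show thesis by (rule that) simp
qed

lemma rev_unary: "rev (unary k) = unary k"
  by (simp add: unary_def)

lemma length_unary [simp]: "length (unary k) = k"
  by (simp add: unary_def)

text \<open>A program behind a computable function is only known to work from a clean store.
  Locality allows running it beside a stack that keeps a copy of the argument.\<close>

lemma exec_local:
  "exec p s t s' \<Longrightarrow> (\<forall>r \<in> R. s0' r = s r) \<Longrightarrow> regs p \<subseteq> R \<Longrightarrow>
    \<exists>s''. exec p s0' t s'' \<and> (\<forall>r \<in> R. s'' r = s' r)"
proof (induction arbitrary: s0' rule: exec.induct)
  case (Skip s) then show ?case using exec.Skip by blast
next
  case (Push r b s)
  then have "\<forall>i \<in> R. (s0'(r := b # s0' r)) i = (s(r := b # s r)) i" by simp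
  then show ?case using exec.Push by blast
next
  case (Pop r s)
  then have "\<forall>i \<in> R. (s0'(r := tl (s0' r))) i = (s(r := tl (s r))) i" by simp
  then show ?case using exec.Pop by blast
next
  case (Seq p s t s' q t' s'')
  then show ?case by (metis Un_subset_iff exec.Seq regs.simps(4))
next
  case (Branch_Empty s r p t s' q u)
  then have "\<exists>s''. exec p s0' t s'' \<and> (\<forall>r \<in> R. s'' r = s' r)" by simp
  moreover have "s0' r = []" using Branch_Empty by simp
  ultimately show ?case using exec.Branch_Empty by blast
next
  case (Branch_True s r w q t s' p u)
  then have "\<exists>s''. exec q s0' t s'' \<and> (\<forall>r \<in> R. s'' r = s' r)" by simp
  moreover have "s0' r = True # w" using Branch_True by simp
  ultimately show ?case using exec.Branch_True by blast
next
  case (Branch_False s r w u t s' p q)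
  then have "\<exists>s''. exec u s0' t s'' \<and> (\<forall>r \<in> R. s'' r = s' r)" by simp
  moreover have "s0' r = False # w" using Branch_False by simp
  ultimately show ?case using exec.Branch_False by blast
next
  case (While_Empty s r p)
  then have "s0' r = []" by simp
  then show ?case using While_Empty exec.While_Empty by blast
next
  case (While_Step s r p t s' t' s'')
  have "regs p \<subseteq> R" using While_Step.prems(2) by simp
  then obtain u where u: "exec p s0' t u" "\<forall>r \<in> R. u r = s' r"
    using While_Step.IH(1)[OF While_Step.prems(1)] by blast
  then obtain u' where u': "exec (While r p) u t' u'" "\<forall>r \<in> R. u' r = s'' r"
    using While_Step.IH(2)[of u] While_Step.prems by blast
  have "s0' r \<noteq> []" using While_Step by simp
  then show ?case using exec.While_Step[OF _ u(1) u'(1)] u'(2) by blast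
qed

text \<open>The bounds of a composed reduction involve the old bound as well as the parameter; the
  single argument \<open>f k + k\<close> dominates both.\<close>

lemma computable_ptime:
  assumes "computable f" "ptime h"
  shows "computable (\<lambda>k. h (f k + k))"
proof -
  obtain p where p: "\<forall>k. \<exists>t s. exec p (input1 (unary k)) t s \<and> s 0 = unary (f k)"
    using assms(1) unfolding computable_def by blast
  have "ptime (\<lambda>w :: bool list. replicate (h (length w)) True)"
    using ptime_comp[OF assms(2), of UNIV "length :: bool list \<Rightarrow> nat"] by (simp add: ptime_intros)
  then obtain q m T where q: "word_program q m T (\<lambda>w. replicate (h (length w)) True)"
    by (rule ptime_word_program)
  \<comment> \<open>Stacks from \<open>M\<close> on are out of reach of \<open>p\<close>; stack
    \<open>M\<close> keeps the copy of \<open>k\<close>.\<close>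
  obtain M where M: "\<forall>r \<in> regs p. r < M" "1 \<le> M" by (rule regs_bound)
  let ?p = "pour2 0 M (Suc M) ;; pour (Suc M) 0 ;; p ;; clears [1..<M] ;; pour M 0 ;; q"
  have "\<exists>t s. exec ?p (input1 (unary k)) t s \<and> s 0 = unary (h (f k + k))" for k
  proof -
    let ?s0 = "input1 (unary k)"
    let ?s1 = "(\<lambda>_. [])(M := unary k, Suc M := unary k)"
    let ?s2 = "(input1 (unary k))(M := unary k)"
    have "?s0(0 := [], M := rev (?s0 0) @ ?s0 M, Suc M := rev (?s0 0) @ ?s0 (Suc M)) = ?s1"
      using M by (auto simp: fun_eq_iff input1_def rev_unary)
    then obtain t1 where 1: "exec (pour2 0 M (Suc M)) ?s0 t1 ?s1"
      using runs_pour2[of 0 M "Suc M" ?s0] M unfolding runs_def by auto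
    have "?s1(Suc M := [], 0 := rev (?s1 (Suc M)) @ ?s1 0) = ?s2"
      using M by (auto simp: fun_eq_iff input1_def rev_unary)
    then obtain t2 where 2: "exec (pour (Suc M) 0) ?s1 t2 ?s2"
      using runs_pour[of "Suc M" 0 ?s1] unfolding runs_def by auto
    obtain t s where ts: "exec p ?s0 t s" "s 0 = unary (f k)" using p by blast
    have 3: "\<exists>t s'. exec p ?s2 t s' \<and> (\<forall>r \<in> regs p. s' r = s r) \<and> (\<forall>r. r \<notin> regs p \<longrightarrow> s' r = ?s2 r)"
    proof -
      have "\<forall>r \<in> regs p. ?s2 r = ?s0 r" using M by auto
      then obtain s' where "exec p ?s2 t s'" "\<forall>r \<in> regs p. s' r = s r" using exec_local[OF ts(1)] by blast
      then show ?thesis using exec_frame by blast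
    qed
    then obtain t3 s3 where 3: "exec p ?s2 t3 s3" "\<forall>r \<in> regs p. s3 r = s r" "\<forall>r. r \<notin> regs p \<longrightarrow> s3 r = ?s2 r" by blast
    have s30: "s3 0 = unary (f k)"
    proof (cases "0 \<in> regs p")
      case False
      then have "s 0 = unary k" using exec_frame[OF ts(1)] by (simp add: input1_def)
      then show ?thesis using 3(3) False ts(2) M by (simp add: input1_def)
    qed (use 3 ts in auto)
    have s3M: "s3 M = unary k" using 3(3) M by auto
    have s3: "s3 r = []" if "r > M" for r
    proof -
      have "r \<notin> regs p" using M(1) that by (meson less_asym)
      then show ?thesis using 3(3) M(2) that by (simp add: input1_def)
    qed
    let ?L = "k + t3"
    have "length (s3 r) \<le> ?L" for r
      using exec_length_le[OF 3(1), of r] by (auto simp: input1_def split: if_splits)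
    then have "runs (clears [1..<M]) s3 ((2 * ?L + 1) * length [1..<M] + 1) (\<lambda>r. if r \<in> set [1..<M] then [] else s3 r)"
      by (rule runs_clears)
    moreover have "(\<lambda>r. if r \<in> set [1..<M] then [] else s3 r) = (input1 (unary (f k)))(M := unary k)" (is "_ = ?s4")
    proof
      fix r show "(if r \<in> set [1..<M] then [] else s3 r) = ?s4 r"
        using s30 s3M s3[of r] M(2) by (cases "r = 0"; cases "r = M"; cases "r < M") (auto simp: input1_def)
    qed
    ultimately obtain t4 where 4: "exec (clears [1..<M]) s3 t4 ?s4" unfolding runs_def by auto
    have "?s4(M := [], 0 := rev (?s4 M) @ ?s4 0) = input1 (unary (f k + k))"
      \<comment> \<open>Pouring one unary word onto another adds the two numbers.\<close>
      using M(2) by (auto simp: fun_eq_iff input1_def rev_unary unary_def replicate_add[symmetric] add.commute)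
    then obtain t5 where 5: "exec (pour M 0) ?s4 t5 (input1 (unary (f k + k)))"
      using runs_pour[of M 0 ?s4] M(2) unfolding runs_def by auto
    have "\<forall>i. 0 < i \<and> i < m \<longrightarrow> input1 (unary (f k + k)) i = []" by (simp add: input1_def)
    then obtain t6 where 6: "exec q (input1 (unary (f k + k))) t6
        ((input1 (unary (f k + k)))(0 := replicate (h (length (input1 (unary (f k + k)) 0))) True))"
      using q unfolding word_program_def runs_def by blast
    show ?thesis
      using exec.Seq[OF 1 exec.Seq[OF 2 exec.Seq[OF 3(1) exec.Seq[OF 4 exec.Seq[OF 5 6]]]]]
      by (intro exI conjI) (assumption, simp add: input1_def unary_def)
  qed
  then show ?thesis unfolding computable_def by blast
qed

lemma ptime_power [ptime_intros]: "ptime f \<Longrightarrow> ptime (\<lambda>x. (f x :: nat) ^ a)"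
  by (induction a) (auto intro: ptime_intros)

section \<open>Composing a parameterized reduction with a polynomial-time map\<close>

definition leading :: "bool list \<Rightarrow> nat" where
  "leading w = snd (foldl (\<lambda>acc b. if fst acc then acc else if b then (False, Suc (snd acc)) else (True, snd acc)) (False, 0) w)"

lemma leading_unary: "leading (unary k @ False # x) = k"
proof -
  let ?f = "\<lambda>acc b. if fst acc then acc else if b then (False, Suc (snd acc)) else (True, snd acc)"
  have 1: "foldl ?f (True, n) y = (True, n)" for n y by (induction y) auto
  have 2: "foldl ?f (False, n) (replicate k True) = (False, n + k)" for n by (induction k arbitrary: n) auto
  show ?thesis unfolding leading_def unary_def by (simp add: 1 2)
qed

lemma ptime_leading: "ptime leading"
proof -
  have "ptime (\<lambda>w. foldl (\<lambda>acc b. if fst acc then acc else if b then (False, Suc (snd acc)) else (True, snd acc)) (False, 0) w)"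
  proof (rule ptime_foldl_additive[where S = "\<lambda>_. 10"])
    fix acc :: "bool \<times> nat" and b :: bool
    show "sz (if fst acc then acc else if b then (False, Suc (snd acc)) else (True, snd acc)) \<le> sz acc + 10"
      using sz_bool_le[of True] sz_bool_le[of False] by (cases acc) auto
  qed (intro ptime_intros poly_bd_intros)+
  then show ?thesis unfolding leading_def by (rule ptime_snd)
qed

text \<open>Word and parameter travel as one word, the parameter in unary followed by
  \<open>False\<close>. This loop separates them again, with stack \<open>2\<close> as its
  switch.\<close>

definition extract_loop :: com where
  "extract_loop = While 2 (Branch 0 Skip (Pop 0 ;; Push 1 True) (Pop 0 ;; Pop 2))"

lemma runs_extract_loop:
  "s 0 = unary k @ False # x \<Longrightarrow> s 2 = [True] \<Longrightarrow>
    runs extract_loop s (4 * k + 5) (s(0 := x, 1 := unary k @ s 1, 2 := []))"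
proof (induction k arbitrary: s)
  case 0
  let ?s = "s(0 := x, 2 := [])"
  have "runs (Pop 0 ;; Pop 2) s (1 + 1) ?s"
    using runs_Seq[OF runs_Pop[of 0 s] runs_Pop[of 2]] 0 by (simp add: unary_def)
  then have 1: "runs (Branch 0 Skip (Pop 0 ;; Push 1 True) (Pop 0 ;; Pop 2)) s (Suc (1 + 1)) ?s"
    by (rule runs_Branch_False[rotated]) (use 0 in \<open>simp add: unary_def\<close>)
  have 2: "runs extract_loop ?s 1 ?s" unfolding extract_loop_def by (rule runs_While_Empty) simp
  have "runs extract_loop s (Suc (Suc (1 + 1) + 1)) ?s"
    unfolding extract_loop_def by (rule runs_While_Step[OF _ 1 2[unfolded extract_loop_def]]) (use 0 in simp)
  moreover have "s(0 := x, 1 := unary 0 @ s 1, 2 := []) = ?s" by (auto simp: unary_def fun_eq_iff)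
  ultimately have "runs extract_loop s (Suc (Suc (1 + 1) + 1)) (s(0 := x, 1 := unary 0 @ s 1, 2 := []))" by metis
  then show ?case by (rule runs_mono) simp
next
  case (Suc k)
  let ?s = "s(0 := unary k @ False # x, 1 := True # s 1)"
  have "runs (Pop 0 ;; Push 1 True) s (1 + 1) ?s"
    using runs_Seq[OF runs_Pop[of 0 s] runs_Push[of 1 True]] Suc(2) by (simp add: unary_def)
  then have 1: "runs (Branch 0 Skip (Pop 0 ;; Push 1 True) (Pop 0 ;; Pop 2)) s (Suc (1 + 1)) ?s"
    by (rule runs_Branch_True[rotated]) (use Suc(2) in \<open>simp add: unary_def\<close>)
  have 2: "runs extract_loop ?s (4 * k + 5) (?s(0 := x, 1 := unary k @ ?s 1, 2 := []))"
    by (rule Suc(1)) (use Suc(3) in auto)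
  have "runs extract_loop s (Suc (Suc (1 + 1) + (4 * k + 5))) (?s(0 := x, 1 := unary k @ ?s 1, 2 := []))"
    unfolding extract_loop_def by (rule runs_While_Step[OF _ 1 2[unfolded extract_loop_def]]) (use Suc(3) in simp)
  moreover have "?s(0 := x, 1 := unary k @ ?s 1, 2 := []) = s(0 := x, 1 := unary (Suc k) @ s 1, 2 := [])"
    by (auto simp: unary_def fun_eq_iff replicate_app_Cons_same)
  ultimately have "runs extract_loop s (Suc (Suc (1 + 1) + (4 * k + 5))) (s(0 := x, 1 := unary (Suc k) @ s 1, 2 := []))" by metis
  then show ?case by (rule runs_mono) simp
qed

text \<open>The map has to be correct on \<open>I\<close> only, since the first reduction produces
  no other instances. Its time is polynomial in the total \<open>length x + k + t\<close> of the
  first run, which is bounded by a computable function of \<open>k\<close> times a power of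
  \<open>length x + 1\<close>.\<close>

lemma fpt_reducible_trans_ptime:
  fixes F :: "bool list \<times> nat \<Rightarrow> bool list \<times> nat"
  assumes P: "fpt_reducible P Q I" and F: "ptime F" and B: "poly_bd B"
    and red: "\<And>x k. (x, k) \<in> I \<Longrightarrow> F (x, k) \<in> I' \<and> snd (F (x, k)) \<le> B k \<and> ((x, k) \<in> Q \<longleftrightarrow> F (x, k) \<in> Q')"
  shows "fpt_reducible P Q' I'"
proof -
  obtain p f g a where f: "computable f" and g: "computable g" and p: "\<forall>x k. \<exists>x' k' t s.
        exec p (input2 x (unary k)) t s \<and> s 0 = x' \<and> s 1 = unary k' \<and>
        t \<le> f k * (length x + 1) ^ a \<and> k' \<le> g k \<and> (x', k') \<in> I \<and> ((x, k) \<in> P \<longleftrightarrow> (x', k') \<in> Q)"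
    using P unfolding fpt_reducible_def by (elim exE conjE)
  let ?h = "\<lambda>w. unary (snd (F (drop (Suc (leading w)) w, leading w))) @ False # fst (F (drop (Suc (leading w)) w, leading w))"
  have "ptime (\<lambda>w. F (drop (Suc (leading w)) w, leading w))"
    by (rule ptime_comp[OF F]) (intro ptime_intros ptime_leading)
  then have "ptime ?h" unfolding unary_def by (intro ptime_intros)
  then obtain q m T where T: "poly_bd T" and q: "word_program q m T ?h" by (rule ptime_word_program)
  obtain M where M: "\<forall>r \<in> regs p. r < M" "3 \<le> M" by (rule regs_bound)
  let ?p = "p ;; clears [2..<M] ;; Push 0 False ;; pour 1 0 ;; q ;; Push 2 True ;; extract_loop"
  \<comment> \<open>The seven phases of \<open>?p\<close>, where \<open>L\<close> bounds the time of
    the first phase and all stacks after it.\<close>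
  let ?U = "\<lambda>L. L + (((2 * L + 1) * M + 1) + (1 + ((4 * L + 1) + (T (2 * L + 1) + (1 + (4 * ((2 * L + 1) + T (2 * L + 1)) + 5))))))"
  have "poly_bd ?U" by (intro poly_bd_intros poly_bd_comp[OF T])
  then obtain c b where cb: "\<forall>L. ?U L \<le> c * Suc L ^ b" by (rule poly_bdE)
  obtain c' b' where B': "\<forall>k. B k \<le> c' * Suc k ^ b'" using B by (rule poly_bdE)
  have f': "computable (\<lambda>k. c * Suc (f k + k) ^ b)"
    by (rule computable_ptime[OF f, of "\<lambda>n. c * Suc n ^ b"]) (intro ptime_intros)
  have g': "computable (\<lambda>k. c' * Suc (g k + k) ^ b')"
    by (rule computable_ptime[OF g, of "\<lambda>n. c' * Suc n ^ b'"]) (intro ptime_intros)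
  have "\<exists>x' k' t s. exec ?p (input2 x (unary k)) t s \<and> s 0 = x' \<and> s 1 = unary k' \<and>
        t \<le> c * Suc (f k + k) ^ b * (length x + 1) ^ (Suc a * b) \<and> k' \<le> c' * Suc (g k + k) ^ b' \<and>
        (x', k') \<in> I' \<and> ((x, k) \<in> P \<longleftrightarrow> (x', k') \<in> Q')" for x k
  proof -
    obtain x' k' t s where 1: "exec p (input2 x (unary k)) t s" and s: "s 0 = x'" "s 1 = unary k'"
      and t: "t \<le> f k * (length x + 1) ^ a" and k': "k' \<le> g k" and I: "(x', k') \<in> I" and PQ: "(x, k) \<in> P \<longleftrightarrow> (x', k') \<in> Q"
      using p by blast
    define L where "L = length x + k + t"
    have L: "length (s r) \<le> L" for r
      using exec_length_le[OF 1, of r] by (auto simp: input2_def L_def split: if_splits)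
    have "s r = []" if "r \<ge> M" for r
    proof -
      have "r \<notin> regs p" using M(1) that by (meson leD)
      then show ?thesis using exec_frame[OF 1, of r] M(2) that by (simp add: input2_def)
    qed
    then have "(\<lambda>r. if r \<in> set [2..<M] then [] else s r) = input2 x' (unary k')" (is "_ = ?s1")
      using s by (auto simp: fun_eq_iff input2_def not_le less_2_cases_iff)
    moreover have "runs (clears [2..<M]) s ((2 * L + 1) * length [2..<M] + 1) (\<lambda>r. if r \<in> set [2..<M] then [] else s r)"
      by (rule runs_clears) (rule L)
    ultimately have "runs (clears [2..<M]) s ((2 * L + 1) * length [2..<M] + 1) ?s1" by simp
    then have 2: "runs (clears [2..<M]) s ((2 * L + 1) * M + 1) ?s1"
      by (rule runs_mono) (intro add_mono mult_le_mono2; simp)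
    let ?s2 = "input2 (False # x') (unary k')"
    have 3: "runs (Push 0 False) ?s1 1 ?s2"
      using runs_Push[of 0 False ?s1] by (simp add: input2_def fun_upd_twist)
    let ?w = "unary k' @ False # x'"
    have "?s2(1 := [], 0 := rev (?s2 1) @ ?s2 0) = input1 ?w"
      by (auto simp: fun_eq_iff input1_def input2_def rev_unary)
    then have "runs (pour 1 0) ?s2 (4 * length (?s2 1) + 1) (input1 ?w)" using runs_pour[of 1 0 ?s2] by simp
    then have 4: "runs (pour 1 0) ?s2 (4 * L + 1) (input1 ?w)"
      by (rule runs_mono) (use L[of 1] s in \<open>simp add: input2_def\<close>)
    obtain x'' k'' where F': "F (x', k') = (x'', k'')" by fastforce
    let ?w' = "unary k'' @ False # x''"
    have h: "?h ?w = ?w'" using F' by (simp add: leading_unary)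
    have "\<forall>i. 0 < i \<and> i < m \<longrightarrow> input1 ?w i = []" by (simp add: input1_def)
    then have "runs q (input1 ?w) (T (length (input1 ?w 0))) ((input1 ?w)(0 := ?h (input1 ?w 0)))"
      using q unfolding word_program_def by blast
    moreover have "input1 ?w 0 = ?w" "(input1 ?w)(0 := ?w') = input1 ?w'" by (simp_all add: input1_def)
    ultimately have "runs q (input1 ?w) (T (length ?w)) (input1 ?w')" by (simp only: h)
    moreover have lw: "length ?w \<le> 2 * L + 1" using L[of 0] L[of 1] s by simp
    ultimately have 5: "runs q (input1 ?w) (T (2 * L + 1)) (input1 ?w')"
      using runs_mono poly_bd_monoD[OF T] by blast
    then obtain t5 where "t5 \<le> T (2 * L + 1)" "exec q (input1 ?w) t5 (input1 ?w')" unfolding runs_def by blast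
    with exec_length_le[OF this(2), of 0] lw have lw': "k'' \<le> 2 * L + 1 + T (2 * L + 1)"
      by (simp add: input1_def)
    have 6: "runs (Push 2 True) (input1 ?w') 1 ((input1 ?w')(2 := [True]))"
      using runs_Push[of 2 True "input1 ?w'"] by (simp add: input1_def)
    have "runs extract_loop ((input1 ?w')(2 := [True])) (4 * k'' + 5)
      (((input1 ?w')(2 := [True]))(0 := x'', 1 := unary k'' @ ((input1 ?w')(2 := [True])) 1, 2 := []))"
      by (rule runs_extract_loop) (simp_all add: input1_def)
    moreover have "((input1 ?w')(2 := [True]))(0 := x'', 1 := unary k'' @ ((input1 ?w')(2 := [True])) 1, 2 := []) = input2 x'' (unary k'')"
      by (auto simp: fun_eq_iff input1_def input2_def)
    ultimately have "runs extract_loop ((input1 ?w')(2 := [True])) (4 * k'' + 5) (input2 x'' (unary k''))" by metis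
    then have 7: "runs extract_loop ((input1 ?w')(2 := [True])) (4 * ((2 * L + 1) + T (2 * L + 1)) + 5) (input2 x'' (unary k''))"
      by (rule runs_mono) (use lw' in simp)
    have "runs p (input2 x (unary k)) L s" unfolding runs_def using 1 by (intro exI[of _ t]) (simp add: L_def)
    then have "runs ?p (input2 x (unary k)) (?U L) (input2 x'' (unary k''))"
      using runs_Seq[OF _ runs_Seq[OF 2 runs_Seq[OF 3 runs_Seq[OF 4 runs_Seq[OF 5 runs_Seq[OF 6 7]]]]]] by blast
    then obtain t' where t': "t' \<le> ?U L" "exec ?p (input2 x (unary k)) t' (input2 x'' (unary k''))"
      unfolding runs_def by blast
    let ?n = "length x + 1"
    have n1: "1 \<le> ?n ^ e" for e by simp
    \<comment> \<open>A time bound must be a product of a function of \<open>k\<close> and a power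
      of \<open>length x + 1\<close>, so the sum is absorbed into one product.\<close>
    have "Suc L = ?n + k + t" by (simp add: L_def)
    also have "\<dots> \<le> ?n ^ Suc a + k * ?n ^ Suc a + f k * ?n ^ Suc a"
    proof (intro add_mono)
      show "?n \<le> ?n ^ Suc a" using mult_le_mono2[OF n1[of a], of ?n] by simp
      show "k \<le> k * ?n ^ Suc a" using mult_le_mono2[OF n1[of "Suc a"], of k] by simp
      have "?n ^ a \<le> ?n ^ Suc a" by (intro power_increasing) auto
      then show "t \<le> f k * ?n ^ Suc a" using t mult_le_mono2 le_trans by blast
    qed
    also have "\<dots> = Suc (f k + k) * ?n ^ Suc a" by (simp only: add_mult_distrib mult_Suc)
    finally have "Suc L ^ b \<le> (Suc (f k + k) * ?n ^ Suc a) ^ b" by (rule power_mono) simp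
    also have "\<dots> = Suc (f k + k) ^ b * ?n ^ (Suc a * b)" by (simp only: power_mult_distrib power_mult)
    finally have "c * Suc L ^ b \<le> c * (Suc (f k + k) ^ b * ?n ^ (Suc a * b))" by (rule mult_le_mono2)
    then have tt: "t' \<le> c * Suc (f k + k) ^ b * ?n ^ (Suc a * b)"
      using t'(1) cb[rule_format, of L] by (simp only: mult.assoc)
    have R: "F (x', k') \<in> I'" "k'' \<le> B k'" "(x', k') \<in> Q \<longleftrightarrow> F (x', k') \<in> Q'" using red[OF I] F' by auto
    have "k'' \<le> c' * Suc k' ^ b'" using R(2) B' le_trans by blast
    also have "\<dots> \<le> c' * Suc (g k + k) ^ b'" using k' by (intro mult_le_mono2 power_mono) auto
    finally have kk: "k'' \<le> c' * Suc (g k + k) ^ b'" .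
    have "input2 x'' (unary k'') 0 = x''" "input2 x'' (unary k'') 1 = unary k''" by (simp_all add: input2_def)
    with t'(2) tt kk R F' PQ show ?thesis by (metis (no_types, lifting))
  qed
  with f' g' show ?thesis unfolding fpt_reducible_def by blast
qed

section \<open>Words as sequences of unary numbers\<close>

definition untok :: "nat list \<Rightarrow> bool list" where
  "untok ns = concat (map enc_nat ns)"

text \<open>Read from the right, \<open>False\<close> opens a number and \<open>True\<close>
  increments the one opened last, so a single fold suffices.\<close>

definition tok :: "bool list \<Rightarrow> nat list" where
  "tok w = foldl (\<lambda>acc b. if b then (case acc of [] \<Rightarrow> [] | n # r \<Rightarrow> Suc n # r) else 0 # acc) [] (rev w)"

lemma untok_simps [simp]: "untok [] = []" "untok (n # ns) = enc_nat n @ untok ns" "untok (ms @ ns) = untok ms @ untok ns"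
  by (auto simp: untok_def)

lemma tok_untok [simp]: "tok (untok ns) = ns"
proof -
  let ?f = "\<lambda>acc b. if b then (case acc of [] \<Rightarrow> [] | n # r \<Rightarrow> Suc n # r) else 0 # acc"
  have 1: "foldl ?f (n # r) (replicate m True) = (n + m) # r" for m n r by (induction m arbitrary: n) auto
  have "foldl ?f [] (rev (untok ns)) = ns"
    by (induction ns) (auto simp: enc_nat_def unary_def 1)
  then show ?thesis by (simp add: tok_def)
qed

lemma untok_inject [simp]: "untok ms = untok ns \<longleftrightarrow> ms = ns"
  by (metis tok_untok)

lemma ptime_untok [ptime_intros]: "ptime f \<Longrightarrow> ptime (\<lambda>x. untok (f x))"
  unfolding untok_def enc_nat_def unary_def by (intro ptime_intros)

lemma ptime_tok [ptime_intros]: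
  assumes "ptime f"
  shows "ptime (\<lambda>x. tok (f x))"
  unfolding tok_def
proof (rule ptime_foldl_additive[where S = "\<lambda>_. 2"])
  fix acc :: "nat list" and b :: bool
  show "sz (if b then (case acc of [] \<Rightarrow> [] | n # r \<Rightarrow> Suc n # r) else 0 # acc) \<le> sz acc + 2"
    by (cases acc) auto
qed (intro ptime_intros poly_bd_intros assms)+

section \<open>From hitting sets to edge-colored graphs\<close>

subsection \<open>Cyclic sequences\<close>

lemma Union_cycle_edges:
  assumes "cyclic_sequence vs"
  shows "\<Union>(cycle_edges vs) = set vs"
proof -
  have l: "0 < length vs" using assms by (auto simp: cyclic_sequence_def)
  show ?thesis
  proof
    show "\<Union>(cycle_edges vs) \<subseteq> set vs" using l by (auto simp: cycle_edges_def)
    show "set vs \<subseteq> \<Union>(cycle_edges vs)"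
    proof
      fix v assume "v \<in> set vs"
      then obtain i where "i < length vs" "v = vs ! i" by (auto simp: in_set_conv_nth)
      then have "{vs ! i, vs ! (Suc i mod length vs)} \<in> cycle_edges vs" "v \<in> {vs ! i, vs ! (Suc i mod length vs)}"
        unfolding cycle_edges_def by auto
      then show "v \<in> \<Union>(cycle_edges vs)" by blast
    qed
  qed
qed

lemma Suc_mod_eq: "i < l \<Longrightarrow> Suc i mod l = (if Suc i = l then 0 else Suc i)"
  by auto

lemma cycle_edges_image: "cycle_edges vs = (\<lambda>i. {vs ! i, vs ! (Suc i mod length vs)}) ` {..<length vs}"
  by (auto simp: cycle_edges_def)

lemma finite_cycle_edges: "finite (cycle_edges vs)"
  by (simp add: cycle_edges_image)

lemma card_cycle_edges:
  assumes "cyclic_sequence vs"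
  shows "card (cycle_edges vs) = length vs"
proof -
  have d: "distinct vs" and l: "3 \<le> length vs" using assms by (auto simp: cyclic_sequence_def)
  have "inj_on (\<lambda>i. {vs ! i, vs ! (Suc i mod length vs)}) {..<length vs}"
  proof (rule inj_onI)
    fix i j assume ij: "i \<in> {..<length vs}" "j \<in> {..<length vs}"
      and eq: "{vs ! i, vs ! (Suc i mod length vs)} = {vs ! j, vs ! (Suc j mod length vs)}"
    have m: "Suc i mod length vs < length vs" "Suc j mod length vs < length vs" using l by (auto intro!: mod_less_divisor)
    \<comment> \<open>In the second case each index would be the cyclic successor of the other,
      which needs length two.\<close>
    from eq have "i = j \<or> (i = Suc j mod length vs \<and> Suc i mod length vs = j)"
      using ij m d by (auto simp: doubleton_eq_iff nth_eq_iff_index_eq)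
    then show "i = j" using ij l by (auto simp: Suc_mod_eq split: if_splits)
  qed
  then show ?thesis by (simp add: cycle_edges_image card_image)
qed

text \<open>Serves to limit the chords at a vertex of an induced cycle, and to find an edge outside
  a given matching at every vertex.\<close>

lemma cycle_neighbours:
  assumes "cyclic_sequence vs" "p \<in> set vs"
  obtains q r where "q \<noteq> r" "{x. {p, x} \<in> cycle_edges vs} = {q, r}"
proof -
  have d: "distinct vs" and l: "3 \<le> length vs" using assms by (auto simp: cyclic_sequence_def)
  obtain i where i: "i < length vs" "p = vs ! i" using assms(2) by (auto simp: in_set_conv_nth)
  let ?n = "if Suc i = length vs then 0 else Suc i"
  let ?p = "if i = 0 then length vs - 1 else i - 1"
  have np: "?n < length vs" "?p < length vs" "?n \<noteq> ?p" using i l by auto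
  have "x = vs ! ?n \<or> x = vs ! ?p" if "{p, x} \<in> cycle_edges vs" for x
  proof -
    obtain j where j: "j < length vs" "{p, x} = {vs ! j, vs ! (Suc j mod length vs)}"
      using \<open>{p, x} \<in> cycle_edges vs\<close> by (auto simp: cycle_edges_def)
    have m: "Suc j mod length vs < length vs" using l by (auto intro!: mod_less_divisor)
    have "i = j \<and> x = vs ! (Suc j mod length vs) \<or> i = Suc j mod length vs \<and> x = vs ! j"
      using j(2) d i j(1) m by (auto simp: doubleton_eq_iff nth_eq_iff_index_eq)
    moreover have "j = length vs - 1" if "Suc j = length vs" using that by simp
    ultimately show ?thesis using j(1) l by (auto simp: Suc_mod_eq split: if_splits)
  qed
  moreover have "{p, vs ! ?n} \<in> cycle_edges vs"
    using i by (auto simp: cycle_edges_def Suc_mod_eq intro!: exI[of _ i])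
  moreover have "{p, vs ! ?p} \<in> cycle_edges vs"
  proof -
    have "Suc ?p mod length vs = i" using i l by (auto simp: Suc_mod_eq)
    then have "{vs ! ?p, p} = {vs ! ?p, vs ! (Suc ?p mod length vs)}" using i(2) by metis
    then have "{vs ! ?p, p} \<in> cycle_edges vs"
      unfolding cycle_edges_image using np(2) by (metis (no_types, lifting) imageI lessThan_iff)
    then show ?thesis by (simp add: insert_commute)
  qed
  ultimately have "{x. {p, x} \<in> cycle_edges vs} = {vs ! ?n, vs ! ?p}" by blast
  moreover have "vs ! ?n \<noteq> vs ! ?p" using np nth_eq_iff_index_eq[OF d np(1,2)] by blast
  ultimately show thesis using that by blast
qed

lemma distinct_concat_map:
  assumes "distinct is" "\<And>i. i \<in> set is \<Longrightarrow> distinct (F i)"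
    "\<And>i j. i \<in> set is \<Longrightarrow> j \<in> set is \<Longrightarrow> i \<noteq> j \<Longrightarrow> set (F i) \<inter> set (F j) = {}"
  shows "distinct (concat (map F is))"
  using assms
proof (induction "is")
  case (Cons a js)
  have "distinct (concat (map F js))" using Cons by simp
  moreover have "set (F a) \<inter> set (F j) = {}" if "j \<in> set js" for j
    using Cons.prems(1) Cons.prems(3)[of a j] that by auto
  ultimately show ?case using Cons.prems(2)[of a] by auto
qed simp

lemma concat_triples:
  "concat (map (\<lambda>u. [a u, b u, c u]) [0..<n]) =
    map (\<lambda>i. if i mod 3 = 0 then a (i div 3) else if i mod 3 = 1 then b (i div 3) else c (i div 3)) [0..<3 * n]"
proof (induction n)
  case (Suc n)
  have "[0..<3 * Suc n] = [0..<3 * n] @ [3 * n, 3 * n + 1, 3 * n + 2]"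
    using upt_add_eq_append[of 0 "3 * n" 3] by (simp add: numeral_3_eq_3)
  moreover have "Suc (3 * n) mod 3 = 1" "Suc (3 * n) div 3 = n" "Suc (Suc (3 * n)) mod 3 = 2" "Suc (Suc (3 * n)) div 3 = n"
    by presburger+
  ultimately show ?case using Suc by simp
qed simp

subsection \<open>The graph of a hitting set instance\<close>

text \<open>
  The sets to be hit are the rows of a bit matrix with \<open>n\<close> columns.  Vertex \<open>(f, u, j)\<close> belongs to
  column \<open>u\<close> and to class \<open>f\<close>, where class \<open>0\<close> is shared by all rows and class \<open>f \<ge> 1\<close> is private to row \<open>f\<close>.
\<close>

definition vtx :: "nat \<Rightarrow> nat \<Rightarrow> nat \<Rightarrow> nat \<Rightarrow> nat" where
  "vtx n f u j = 3 * (n * f + u) + j"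

text \<open>Rows are numbered from \<open>1\<close>, as class \<open>0\<close> is reserved for the
  shared vertices.\<close>

definition member :: "bool list list \<Rightarrow> nat \<Rightarrow> nat \<Rightarrow> bool" where
  "member rows f u = get False (get [] rows (f - 1)) u"

text \<open>A column outside the row gets a private edge in place of the shared one, so the cycles
  of all rows have the same length \<open>3 * n\<close>.\<close>

definition vx :: "nat \<Rightarrow> bool list list \<Rightarrow> nat \<Rightarrow> nat \<Rightarrow> nat" where
  "vx n rows f u = vtx n (if member rows f u then 0 else f) u 0"

definition vy :: "nat \<Rightarrow> bool list list \<Rightarrow> nat \<Rightarrow> nat \<Rightarrow> nat" where
  "vy n rows f u = vtx n (if member rows f u then 0 else f) u 1"

definition vz :: "nat \<Rightarrow> nat \<Rightarrow> nat \<Rightarrow> nat" where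
  "vz n f u = vtx n f u 2"

definition nxt :: "nat \<Rightarrow> nat \<Rightarrow> nat" where
  "nxt n u = (if Suc u = n then 0 else Suc u)"

text \<open>The closing edge has color \<open>4\<close> instead of \<open>3\<close>; together with
  color \<open>1\<close> between \<open>vx\<close> and \<open>vy\<close>, exactly four colors occur
  on each cycle.\<close>

definition path_edges :: "nat \<Rightarrow> bool list list \<Rightarrow> (nat \<times> nat \<times> nat) list" where
  "path_edges n rows = concat (map (\<lambda>f. concat (map (\<lambda>u.
    [(vy n rows f u, vz n f u, 2), (vz n f u, vx n rows f (nxt n u), if Suc u = n then 4 else 3)]) [0..<n]))
    [1..<Suc (length rows)])"

definition pair_edges :: "nat \<Rightarrow> nat \<Rightarrow> (nat \<times> nat \<times> nat) list" where
  "pair_edges n m = concat (map (\<lambda>f. map (\<lambda>u. (vtx n f u 0, vtx n f u 1, 1)) [0..<n]) [0..<Suc m])"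

text \<open>All pairs of vertices from different private classes, whether or not a cycle passes
  through them.\<close>

definition chord_edges :: "nat \<Rightarrow> nat \<Rightarrow> (nat \<times> nat \<times> nat) list" where
  "chord_edges n m = concat (map (\<lambda>f. concat (map (\<lambda>g. concat (map (\<lambda>i.
    map (\<lambda>j. (3 * n * f + i, 3 * n * g + j, 1)) [0..<3 * n]) [0..<3 * n])) [Suc f..<Suc m])) [1..<Suc m])"

definition hs_edges :: "nat \<Rightarrow> bool list list \<Rightarrow> (nat \<times> nat \<times> nat) list" where
  "hs_edges n rows = path_edges n rows @ pair_edges n (length rows) @ chord_edges n (length rows)"

definition hs_instance :: "nat \<Rightarrow> bool list list \<Rightarrow> nat \<Rightarrow> ccd_instance" where
  "hs_instance n rows k = \<lparr>order = 3 * n * Suc (length rows), edge_list = hs_edges n rows,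
    num_colors = 4, cycle_length = 3 * n, budget = k\<rparr>"

definition hittable :: "nat \<Rightarrow> bool list list \<Rightarrow> nat \<Rightarrow> bool" where
  "hittable n rows k \<longleftrightarrow> (\<exists>H \<subseteq> {..<n}. card H \<le> k \<and> (\<forall>row \<in> set rows. \<exists>u \<in> H. row ! u))"

text \<open>Five columns yield five private vertices on a cycle, one more than the count in
  \<open>induced_cycle_unique\<close> tolerates. One row makes all four colors occur, and non-empty
  rows allow any deleted edge to be traded for a column.\<close>

definition hs_valid :: "nat \<Rightarrow> bool list list \<Rightarrow> bool" where
  "hs_valid n rows \<longleftrightarrow> 5 \<le> n \<and> rows \<noteq> [] \<and> (\<forall>row \<in> set rows. length row = n \<and> (\<exists>u < n. row ! u))"

locale hs =
  fixes n :: nat and rows :: "bool list list"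
  assumes valid: "hs_valid n rows"
begin

abbreviation "m \<equiv> length rows"
abbreviation "V \<equiv> vtx n"
abbreviation "X \<equiv> vx n rows"
abbreviation "Y \<equiv> vy n rows"
abbreviation "Z \<equiv> vz n"
abbreviation "mem \<equiv> member rows"

lemma n5: "5 \<le> n" and m1: "1 \<le> m"
  using valid by (auto simp: hs_valid_def Suc_le_eq)

lemma mem_row: "1 \<le> f \<Longrightarrow> f \<le> m \<Longrightarrow> u < n \<Longrightarrow> mem f u \<longleftrightarrow> (rows ! (f - 1)) ! u"
  using valid by (simp add: hs_valid_def member_def)

lemma ex_mem: "1 \<le> f \<Longrightarrow> f \<le> m \<Longrightarrow> \<exists>u < n. mem f u"
proof -
  assume f: "1 \<le> f" "f \<le> m"
  then have "rows ! (f - 1) \<in> set rows" by simp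
  then obtain u where "u < n" "rows ! (f - 1) ! u" using valid unfolding hs_valid_def by blast
  then show ?thesis using mem_row[OF f] by blast
qed

section \<open>Vertex classes and edge families\<close>

definition cl :: "nat \<Rightarrow> nat" where "cl v = v div 3 div n"

lemma V_parts:
  assumes "u < n" "j < 3"
  shows "cl (V f u j) = f" "V f u j div 3 mod n = u" "V f u j mod 3 = j"
proof -
  have "V f u j div 3 = n * f + u" and 1: "V f u j mod 3 = j" using assms(2) by (simp_all add: vtx_def del: distrib_left_numeral)
  then show "cl (V f u j) = f" "V f u j div 3 mod n = u" "V f u j mod 3 = j" using assms(1) by (simp_all add: cl_def)
qed

lemma V_eq_iff:
  assumes "u < n" "j < 3" "u' < n" "j' < 3"
  shows "V f u j = V f' u' j' \<longleftrightarrow> f = f' \<and> u = u' \<and> j = j'"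
  using V_parts[of u j f] V_parts[of u' j' f'] assms by metis

lemma cl_XYZ:
  assumes "u < n"
  shows "cl (X f u) = (if mem f u then 0 else f)" "cl (Y f u) = (if mem f u then 0 else f)" "cl (Z f u) = f"
  using assms by (auto simp: vx_def vy_def vz_def V_parts)

lemma nxt_less: "u < n \<Longrightarrow> nxt n u < n"
  using n5 by (auto simp: nxt_def)

lemma nxt_surj: "u < n \<Longrightarrow> \<exists>w < n. nxt n w = u"
  using n5 by (cases u) (auto simp: nxt_def intro: exI[of _ "n - 1"])

lemma XYZ_eq_iff:
  assumes "u < n" "w < n"
  shows "X f u = X f w \<longleftrightarrow> u = w" "Y f u = Y f w \<longleftrightarrow> u = w" "Z f u = Z g w \<longleftrightarrow> f = g \<and> u = w"
    "X f u \<noteq> Y g w" "X f u \<noteq> Z g w" "Y f u \<noteq> Z g w" "Y g w \<noteq> X f u" "Z g w \<noteq> X f u" "Z g w \<noteq> Y f u"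
  using assms by (auto simp: vx_def vy_def vz_def V_eq_iff)

definition PE :: "nat \<Rightarrow> nat set set" where
  "PE f = (\<Union>u<n. {{Y f u, Z f u}, {Z f u, X f (nxt n u)}})"

definition QE :: "nat set set" where
  "QE = {{V f u 0, V f u 1} | f u. f \<le> m \<and> u < n}"

definition CE :: "nat set set" where
  "CE = {{a, b} | a b. 1 \<le> cl a \<and> cl a < cl b \<and> cl b \<le> m}"

abbreviation ends :: "nat \<times> nat \<times> nat \<Rightarrow> nat set" where
  "ends \<equiv> (\<lambda>(u, v, i). {u, v})"

lemma path_edges_iff: "e \<in> set (path_edges n rows) \<longleftrightarrow> (\<exists>f u. 1 \<le> f \<and> f \<le> m \<and> u < n \<and>
    (e = (Y f u, Z f u, 2) \<or> e = (Z f u, X f (nxt n u), if Suc u = n then 4 else 3)))"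
proof -
  have "set (path_edges n rows) = (\<Union>f\<in>{1..m}. \<Union>u\<in>{..<n}. {(Y f u, Z f u, 2), (Z f u, X f (nxt n u), if Suc u = n then 4 else 3)})"
    unfolding path_edges_def by (simp add: lessThan_atLeast0 atLeastLessThanSuc_atLeastAtMost del: upt_Suc)
  then show ?thesis by (simp only: UN_iff atLeastAtMost_iff lessThan_iff insert_iff empty_iff Bex_def ex_simps conj_assoc simp_thms)
qed

lemma pair_edges_iff: "e \<in> set (pair_edges n m) \<longleftrightarrow> (\<exists>f u. f \<le> m \<and> u < n \<and> e = (V f u 0, V f u 1, 1))"
proof -
  have "set (pair_edges n m) = (\<Union>f\<in>{..m}. \<Union>u\<in>{..<n}. {(V f u 0, V f u 1, 1)})"
    unfolding pair_edges_def by (simp add: lessThan_atLeast0 atLeastLessThanSuc_atLeastAtMost atMost_atLeast0 UNION_singleton_eq_range del: upt_Suc)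
  then show ?thesis by (simp only: UN_iff atMost_iff lessThan_iff insert_iff empty_iff Bex_def ex_simps conj_assoc simp_thms)
qed

lemma chord_edges_iff: "e \<in> set (chord_edges n m) \<longleftrightarrow> (\<exists>f g i j. 1 \<le> f \<and> f \<le> m \<and> f < g \<and> g \<le> m \<and> i < 3 * n \<and> j < 3 * n \<and>
    e = (3 * n * f + i, 3 * n * g + j, 1))"
proof -
  have "set (chord_edges n m) = (\<Union>f\<in>{1..m}. \<Union>g\<in>{Suc f..m}. \<Union>i\<in>{..<3 * n}. \<Union>j\<in>{..<3 * n}. {(3 * n * f + i, 3 * n * g + j, 1)})"
    unfolding chord_edges_def by (simp add: lessThan_atLeast0 atLeastLessThanSuc_atLeastAtMost UNION_singleton_eq_range del: upt_Suc)
  then show ?thesis by (simp only: UN_iff atLeastAtMost_iff lessThan_iff insert_iff empty_iff Bex_def ex_simps conj_assoc simp_thms Suc_le_eq)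
qed

lemma set_path_edges: "ends ` set (path_edges n rows) = (\<Union>f\<in>{1..m}. PE f)"
proof
  show "ends ` set (path_edges n rows) \<subseteq> (\<Union>f\<in>{1..m}. PE f)"
  proof (rule image_subsetI)
    fix x assume "x \<in> set (path_edges n rows)"
    then obtain f u where fu: "1 \<le> f" "f \<le> m" "u < n"
      "x = (Y f u, Z f u, 2) \<or> x = (Z f u, X f (nxt n u), if Suc u = n then 4 else 3)"
      unfolding path_edges_iff by blast
    then have "ends x \<in> PE f" by (auto simp: PE_def)
    then show "ends x \<in> (\<Union>f\<in>{1..m}. PE f)" using fu by auto
  qed
  show "(\<Union>f\<in>{1..m}. PE f) \<subseteq> ends ` set (path_edges n rows)"
  proof
    fix e assume "e \<in> (\<Union>f\<in>{1..m}. PE f)"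
    then obtain f u where "1 \<le> f" "f \<le> m" "u < n" "e = ends (Y f u, Z f u, 2) \<or> e = ends (Z f u, X f (nxt n u), if Suc u = n then 4 else 3)"
      by (auto simp: PE_def)
    then show "e \<in> ends ` set (path_edges n rows)" using path_edges_iff by blast
  qed
qed

lemma set_pair_edges: "ends ` set (pair_edges n m) = QE"
proof
  show "ends ` set (pair_edges n m) \<subseteq> QE"
  proof (rule image_subsetI)
    fix x assume "x \<in> set (pair_edges n m)"
    then obtain f u where "f \<le> m" "u < n" "x = (V f u 0, V f u 1, 1)" unfolding pair_edges_iff by blast
    then show "ends x \<in> QE" unfolding QE_def by auto
  qed
  show "QE \<subseteq> ends ` set (pair_edges n m)"
  proof
    fix e assume "e \<in> QE"
    then obtain f u where "f \<le> m" "u < n" "e = ends (V f u 0, V f u 1, 1)" by (auto simp: QE_def)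
    then show "e \<in> ends ` set (pair_edges n m)" using pair_edges_iff by blast
  qed
qed

lemma cl_chord: "i < 3 * n \<Longrightarrow> cl (3 * n * f + i) = f"
proof -
  assume "i < 3 * n"
  then have "i div 3 < n" by auto
  moreover have "(3 * n * f + i) div 3 = n * f + i div 3"
    using div_mult_self3[of 3 "n * f" i] by (simp add: mult.assoc)
  ultimately show ?thesis by (simp add: cl_def)
qed

lemma chord_decomp:
  obtains i where "i < 3 * n" "v = 3 * n * cl v + i"
proof -
  have "v = 3 * n * (v div (3 * n)) + v mod (3 * n)" by simp
  moreover have "v div (3 * n) = cl v" by (simp add: cl_def div_mult2_eq)
  ultimately show thesis using that[of "v mod (3 * n)"] n5 by simp
qed

lemma set_chord_edges: "ends ` set (chord_edges n m) = CE"
proof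
  show "ends ` set (chord_edges n m) \<subseteq> CE"
    unfolding CE_def by (force simp: chord_edges_iff cl_chord)
  show "CE \<subseteq> ends ` set (chord_edges n m)"
  proof
    fix e assume "e \<in> CE"
    then obtain a b where e: "e = {a, b}" "1 \<le> cl a" "cl a < cl b" "cl b \<le> m" by (auto simp: CE_def)
    obtain i where i: "i < 3 * n" "a = 3 * n * cl a + i" by (rule chord_decomp)
    obtain j where j: "j < 3 * n" "b = 3 * n * cl b + j" by (rule chord_decomp)
    have "(a, b, 1) \<in> set (chord_edges n m)"
      unfolding chord_edges_iff using e i j by (intro exI[of _ "cl a"] exI[of _ "cl b"] exI[of _ i] exI[of _ j]) simp
    then show "e \<in> ends ` set (chord_edges n m)" using e(1) by force
  qed
qed

lemma distinct_path: "distinct (map ends (path_edges n rows))"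
proof -
  have 1: "map ends (path_edges n rows) = concat (map (\<lambda>f. concat (map (\<lambda>u.
      [{Y f u, Z f u}, {Z f u, X f (nxt n u)}]) [0..<n])) [1..<Suc m])"
    by (simp add: path_edges_def map_concat o_def)
  show ?thesis unfolding 1
    by (intro distinct_concat_map) (auto simp: doubleton_eq_iff XYZ_eq_iff nxt_less)
qed

lemma distinct_pair: "distinct (map ends (pair_edges n m))"
proof -
  have 1: "map ends (pair_edges n m) = concat (map (\<lambda>f. map (\<lambda>u. {V f u 0, V f u 1}) [0..<n]) [0..<Suc m])"
    by (simp add: pair_edges_def map_concat o_def)
  show ?thesis unfolding 1
    by (intro distinct_concat_map) (auto simp: doubleton_eq_iff V_eq_iff distinct_map inj_on_def)
qed

lemma distinct_chord: "distinct (map ends (chord_edges n m))"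
proof -
  have 1: "map ends (chord_edges n m) = concat (map (\<lambda>f. concat (map (\<lambda>g. concat (map (\<lambda>i.
      map (\<lambda>j. {3 * n * f + i, 3 * n * g + j}) [0..<3 * n]) [0..<3 * n])) [Suc f..<Suc m])) [1..<Suc m])"
    by (simp add: chord_edges_def map_concat o_def)
  have 2: "f = f' \<and> g = g' \<and> i = i' \<and> j = j'"
    if "{3 * n * f + i, 3 * n * g + j} = {3 * n * f' + i', 3 * n * g' + j'}" "f < g" "f' < g'"
      "i < 3 * n" "j < 3 * n" "i' < 3 * n" "j' < 3 * n" for f g i j f' g' i' j'
  proof -
    \<comment> \<open>The classes of the end points recover \<open>f\<close> and \<open>g\<close>,
      and \<open>f < g\<close> fixes the orientation.\<close>
    have "cl ` {3 * n * f + i, 3 * n * g + j} = cl ` {3 * n * f' + i', 3 * n * g' + j'}" using that(1) by simp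
    moreover have "cl ` {3 * n * f + i, 3 * n * g + j} = {f, g}" "cl ` {3 * n * f' + i', 3 * n * g' + j'} = {f', g'}"
      unfolding image_insert image_empty using that by (simp_all only: cl_chord)
    ultimately have "{f, g} = {f', g'}" by simp
    then have "f = f' \<and> g = g'" using that(2,3) by (auto simp: doubleton_eq_iff)
    moreover have "3 * n * f + i \<noteq> 3 * n * g' + j'" if "f = f'" "g = g'" using cl_chord \<open>f < g\<close> \<open>i < 3 * n\<close> \<open>j' < 3 * n\<close> that
      by (metis less_irrefl)
    ultimately show ?thesis using that(1) by (auto simp: doubleton_eq_iff)
  qed
  show ?thesis unfolding 1
  proof (intro distinct_concat_map)
    fix f g i assume "f \<in> set [1..<Suc m]" "g \<in> set [Suc f..<Suc m]" "i \<in> set [0..<3 * n]"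
    then show "distinct (map (\<lambda>j. {3 * n * f + i, 3 * n * g + j}) [0..<3 * n])"
      by (auto simp: distinct_map inj_on_def dest!: 2)
  qed (auto simp del: upt_Suc dest!: 2)
qed

lemma Z_in_PE: "e \<in> PE f \<Longrightarrow> \<exists>u < n. Z f u \<in> e"
  by (auto simp: PE_def)

lemma PE_QE: "PE f \<inter> QE = {}"
  using n5 by (auto simp: PE_def QE_def doubleton_eq_iff vz_def V_eq_iff nxt_less)

text \<open>The classes of the end points separate the families: chords join different private
  classes, pair edges stay inside a class, and path edges stay inside a class or touch class
  \<open>0\<close>.\<close>

lemma CE_classes: "{a, b} \<in> CE \<Longrightarrow> 1 \<le> cl a \<and> 1 \<le> cl b \<and> cl a \<noteq> cl b"
  by (auto simp: CE_def doubleton_eq_iff)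

lemma PE_classes: "f \<ge> 1 \<Longrightarrow> {a, b} \<in> PE f \<Longrightarrow> cl a = 0 \<or> cl b = 0 \<or> cl a = cl b"
  by (auto simp: PE_def doubleton_eq_iff cl_XYZ nxt_less split: if_splits)

lemma QE_classes: "{a, b} \<in> QE \<Longrightarrow> cl a = cl b"
  by (auto simp: QE_def doubleton_eq_iff V_parts)

lemma disjoint_CE: "1 \<le> f \<Longrightarrow> PE f \<inter> CE = {}" "QE \<inter> CE = {}"
proof -
  show "PE f \<inter> CE = {}" if "1 \<le> f"
  proof (rule ccontr)
    assume "PE f \<inter> CE \<noteq> {}"
    then obtain a b where "{a, b} \<in> PE f" "{a, b} \<in> CE" by (auto simp: PE_def)
    then show False using PE_classes[OF that] CE_classes by fastforce
  qed
  show "QE \<inter> CE = {}"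
  proof (rule ccontr)
    assume "QE \<inter> CE \<noteq> {}"
    then obtain a b where "{a, b} \<in> QE" "{a, b} \<in> CE" by (auto simp: QE_def)
    then show False using QE_classes CE_classes by fastforce
  qed
qed

lemma distinct_ends: "distinct (map ends (hs_edges n rows))"
  unfolding hs_edges_def map_append distinct_append set_append set_map set_path_edges set_pair_edges set_chord_edges
  using distinct_path distinct_pair distinct_chord PE_QE disjoint_CE by fastforce

definition G :: "nat cgraph" where
  "G = graph_of (hs_instance n rows 0)"

lemma graph_of_hs: "graph_of (hs_instance n rows k) = G"
  by (simp add: G_def graph_of_def hs_instance_def)

lemma edges_G: "edges G = (\<Union>f\<in>{1..m}. PE f) \<union> QE \<union> CE"
  unfolding G_def graph_of_def hs_instance_def hs_edges_def
  by (simp add: image_Un set_path_edges set_pair_edges set_chord_edges Un_assoc)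

lemma verts_G: "verts G = {..<3 * n * Suc m}"
  by (simp add: G_def graph_of_def hs_instance_def)

text \<open>The color is a definite description; it is well defined because no edge is listed
  twice.\<close>

lemma color_G:
  assumes "(u, v, i) \<in> set (hs_edges n rows)"
  shows "color G {u, v} = i"
proof -
  have inj: "inj_on ends (set (hs_edges n rows))" using distinct_ends by (simp add: distinct_map)
  have "(THE j. \<exists>u' v'. (u', v', j) \<in> set (hs_edges n rows) \<and> {u, v} = {u', v'}) = i"
  proof (rule the_equality)
    fix j assume "\<exists>u' v'. (u', v', j) \<in> set (hs_edges n rows) \<and> {u, v} = {u', v'}"
    then obtain u' v' where "(u', v', j) \<in> set (hs_edges n rows)" "{u, v} = {u', v'}" by blast
    then show "j = i" using inj_onD[OF inj, of "(u, v, i)" "(u', v', j)"] assms by auto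
  qed (use assms in blast)
  then show ?thesis by (simp add: G_def graph_of_def hs_instance_def)
qed

lemma color_PE:
  assumes "1 \<le> f" "f \<le> m" "u < n"
  shows "color G {Y f u, Z f u} = 2" "color G {Z f u, X f (nxt n u)} = (if Suc u = n then 4 else 3)"
proof -
  have "(Y f u, Z f u, 2) \<in> set (hs_edges n rows)" "(Z f u, X f (nxt n u), if Suc u = n then 4 else 3) \<in> set (hs_edges n rows)"
    using assms unfolding hs_edges_def set_append Un_iff path_edges_iff by blast+
  then show "color G {Y f u, Z f u} = 2" "color G {Z f u, X f (nxt n u)} = (if Suc u = n then 4 else 3)"
    using color_G by blast+
qed

lemma color_QE:
  assumes "f \<le> m" "u < n"
  shows "color G {V f u 0, V f u 1} = 1"
proof -
  have "(V f u 0, V f u 1, 1) \<in> set (hs_edges n rows)"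
    using assms unfolding hs_edges_def set_append Un_iff pair_edges_iff by blast
  then show ?thesis by (rule color_G)
qed

lemma color_CE:
  assumes "e \<in> CE"
  shows "color G e = 1"
proof -
  have "e \<in> ends ` set (chord_edges n m)" using assms set_chord_edges by simp
  then obtain a b c where e: "e = {a, b}" "(a, b, c) \<in> set (chord_edges n m)" by auto
  then have "c = 1" by (auto simp: chord_edges_iff)
  then show ?thesis using color_G[of a b c] e by (simp add: hs_edges_def)
qed

section \<open>The cycles of the rows\<close>

definition C :: "nat \<Rightarrow> nat set set" where
  "C f = PE f \<union> {{X f u, Y f u} | u. u < n}"

definition VC :: "nat \<Rightarrow> nat set" where
  "VC f = (\<Union>u<n. {X f u, Y f u, Z f u})"

definition cyc :: "nat \<Rightarrow> nat list" where
  "cyc f = concat (map (\<lambda>u. [Y f u, Z f u, X f (nxt n u)]) [0..<n])"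

lemma cyc_map: "cyc f = map (\<lambda>i. if i mod 3 = 0 then Y f (i div 3) else if i mod 3 = 1 then Z f (i div 3)
    else X f (nxt n (i div 3))) [0..<3 * n]"
  unfolding cyc_def by (rule concat_triples)

lemma length_cyc: "length (cyc f) = 3 * n"
  by (simp add: cyc_map)

lemma set_cyc: "set (cyc f) = VC f"
proof
  show "set (cyc f) \<subseteq> VC f" using nxt_less by (fastforce simp: cyc_def VC_def)
  show "VC f \<subseteq> set (cyc f)"
  proof
    fix v assume "v \<in> VC f"
    then obtain u where u: "u < n" "v \<in> {X f u, Y f u, Z f u}" by (auto simp: VC_def)
    obtain w where w: "w < n" "nxt n w = u" using nxt_surj u by blast
    show "v \<in> set (cyc f)"
      using u w by (auto simp: cyc_def intro: bexI[of _ u] bexI[of _ w])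
  qed
qed

lemma nxt_inj: "u < n \<Longrightarrow> w < n \<Longrightarrow> nxt n u = nxt n w \<Longrightarrow> u = w"
  by (auto simp: nxt_def split: if_splits)

lemma distinct_cyc: "distinct (cyc f)"
  unfolding cyc_def
proof (intro distinct_concat_map)
  fix i j assume "i \<in> set [0..<n]" "j \<in> set [0..<n]" "i \<noteq> j"
  then show "set [Y f i, Z f i, X f (nxt n i)] \<inter> set [Y f j, Z f j, X f (nxt n j)] = {}"
    using nxt_inj by (auto simp: XYZ_eq_iff nxt_less)
qed (auto simp: XYZ_eq_iff nxt_less)

lemma cyclic_cyc: "cyclic_sequence (cyc f)"
  using n5 by (simp add: cyclic_sequence_def distinct_cyc length_cyc)

lemma cycle_edges_cyc: "cycle_edges (cyc f) = C f"
proof -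
  let ?e = "\<lambda>i. {cyc f ! i, cyc f ! (Suc i mod (3 * n))}"
  have n: "cyc f ! (3 * u) = Y f u" "cyc f ! (3 * u + 1) = Z f u" "cyc f ! (3 * u + 2) = X f (nxt n u)" if "u < n" for u
  proof -
    have "(3 * u + 1) div 3 = u" "(3 * u + 1) mod 3 = 1" "(3 * u + 2) div 3 = u" "(3 * u + 2) mod 3 = 2" by presburger+
    then show "cyc f ! (3 * u) = Y f u" "cyc f ! (3 * u + 1) = Z f u" "cyc f ! (3 * u + 2) = X f (nxt n u)"
      using that by (simp_all add: cyc_map)
  qed
  have "?e (3 * u) = {Y f u, Z f u}" "?e (3 * u + 1) = {Z f u, X f (nxt n u)}"
      "?e (3 * u + 2) = {X f (nxt n u), Y f (nxt n u)}" if "u < n" for u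
  proof -
    have "Suc (3 * u) mod (3 * n) = 3 * u + 1" "Suc (3 * u + 1) mod (3 * n) = 3 * u + 2" using that by auto
    then show "?e (3 * u) = {Y f u, Z f u}" "?e (3 * u + 1) = {Z f u, X f (nxt n u)}" using n[OF that] by simp_all
    have "Suc (3 * u + 2) mod (3 * n) = 3 * nxt n u" using that by (auto simp: nxt_def Suc_mod_eq)
    then show "?e (3 * u + 2) = {X f (nxt n u), Y f (nxt n u)}" using n[OF that] n(1)[OF nxt_less[OF that]] by simp
  qed
  note e = this
  show ?thesis
  proof
    show "cycle_edges (cyc f) \<subseteq> C f"
    proof
      fix x assume "x \<in> cycle_edges (cyc f)"
      then obtain i where i: "i < 3 * n" "x = ?e i" by (auto simp: cycle_edges_def length_cyc)
      have u: "i div 3 < n" using i by auto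
      have "i = 3 * (i div 3) \<or> i = 3 * (i div 3) + 1 \<or> i = 3 * (i div 3) + 2" by presburger
      then consider "x = {Y f (i div 3), Z f (i div 3)}" | "x = {Z f (i div 3), X f (nxt n (i div 3))}"
        | "x = {X f (nxt n (i div 3)), Y f (nxt n (i div 3))}" using e[OF u] i(2) by metis
      then show "x \<in> C f" using u nxt_less[OF u] by cases (auto simp: C_def PE_def)
    qed
    show "C f \<subseteq> cycle_edges (cyc f)"
    proof
      have in_cyc: "?e i \<in> cycle_edges (cyc f)" if "i < 3 * n" for i
        using that unfolding cycle_edges_def length_cyc by blast
      fix x assume "x \<in> C f"
      then consider u where "u < n" "x = {Y f u, Z f u}" | u where "u < n" "x = {Z f u, X f (nxt n u)}"
        | u where "u < n" "x = {X f u, Y f u}" by (auto simp: C_def PE_def)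
      then show "x \<in> cycle_edges (cyc f)"
      proof cases
        case 1 then show ?thesis using in_cyc[of "3 * u"] e(1)[of u] by simp
      next
        case 2 then show ?thesis using in_cyc[of "3 * u + 1"] e(2)[of u] by simp
      next
        case 3
        obtain w where w: "w < n" "nxt n w = u" using nxt_surj 3 by blast
        then show ?thesis using in_cyc[of "3 * w + 2"] e(3)[of w] 3 by simp
      qed
    qed
  qed
qed

lemma card_C: "card (C f) = 3 * n"
  using card_cycle_edges[OF cyclic_cyc] by (simp add: cycle_edges_cyc length_cyc)

lemma XY_QE: "f \<le> m \<Longrightarrow> u < n \<Longrightarrow> {X f u, Y f u} \<in> QE"
  by (auto simp: QE_def vx_def vy_def)

lemma C_subset: "1 \<le> f \<Longrightarrow> f \<le> m \<Longrightarrow> C f \<subseteq> edges G - CE"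
  using XY_QE disjoint_CE unfolding C_def edges_G by fastforce

lemma Union_C: "\<Union>(C f) = VC f"
  using Union_cycle_edges[OF cyclic_cyc] by (simp add: cycle_edges_cyc set_cyc)

lemma VC_class: "v \<in> VC f \<Longrightarrow> cl v = 0 \<or> cl v = f"
  by (auto simp: VC_def cl_XYZ)

text \<open>A path edge of another row contains a private vertex of that row, a chord joins two
  private classes, and a pair edge whose first vertex is on the cycle is the edge of its own
  column.\<close>

lemma induced_C:
  assumes "1 \<le> f" "f \<le> m"
  shows "{e \<in> edges G. e \<subseteq> VC f} = C f"
proof
  show "C f \<subseteq> {e \<in> edges G. e \<subseteq> VC f}" using C_subset[OF assms] Union_C by blast
  show "{e \<in> edges G. e \<subseteq> VC f} \<subseteq> C f"
  proof
    fix e assume "e \<in> {e \<in> edges G. e \<subseteq> VC f}"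
    then have e: "e \<in> edges G" "e \<subseteq> VC f" by auto
    from e(1) consider g where "1 \<le> g" "g \<le> m" "e \<in> PE g" | "e \<in> QE" | "e \<in> CE" by (auto simp: edges_G)
    then show "e \<in> C f"
    proof cases
      case 1
      then obtain u where u: "u < n" "Z g u \<in> e" using Z_in_PE by blast
      then have "cl (Z g u) = 0 \<or> cl (Z g u) = f" using VC_class e(2) by blast
      then have "g = f" using u 1 by (auto simp: cl_XYZ)
      then show ?thesis using 1 by (simp add: C_def)
    next
      case 2
      then obtain g u where gu: "g \<le> m" "u < n" "e = {V g u 0, V g u 1}" by (auto simp: QE_def)
      then have "V g u 0 \<in> VC f" using e(2) by simp
      then obtain w where "w < n" "V g u 0 = X f w"
        using gu by (auto simp: VC_def vx_def vy_def vz_def V_eq_iff)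
      then have "e = {X f u, Y f u}" using gu by (auto simp: vx_def vy_def V_eq_iff)
      then show ?thesis using gu by (auto simp: C_def)
    next
      case 3
      then obtain a b where ab: "e = {a, b}" "{a, b} \<in> CE" by (auto simp: CE_def)
      then have "cl a = 0 \<or> cl a = f" "cl b = 0 \<or> cl b = f" using VC_class e(2) by auto
      then show ?thesis using CE_classes[OF ab(2)] by auto
    qed
  qed
qed

lemma color_C:
  assumes "1 \<le> f" "f \<le> m"
  shows "color G ` C f = {1..4}"
proof
  have "color G {X f u, Y f u} = 1" if "u < n" for u
    using that assms by (auto simp: vx_def vy_def intro: color_QE[simplified])
  note XY = this
  show "color G ` C f \<subseteq> {1..4}"
    using color_PE[OF assms] XY by (auto simp: C_def PE_def)
  \<comment> \<open>Column \<open>0\<close> shows colors \<open>1\<close> to \<open>3\<close>, the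
    last column color \<open>4\<close>.\<close>
  have "1 = color G {X f 0, Y f 0}" "2 = color G {Y f 0, Z f 0}" "3 = color G {Z f 0, X f (nxt n 0)}"
    "4 = color G {Z f (n - 1), X f (nxt n (n - 1))}"
    using color_PE[OF assms] XY n5 by auto
  moreover have "{X f 0, Y f 0} \<in> C f" "{Y f 0, Z f 0} \<in> C f" "{Z f 0, X f (nxt n 0)} \<in> C f"
    "{Z f (n - 1), X f (nxt n (n - 1))} \<in> C f"
    unfolding C_def PE_def using n5 by (auto intro: bexI[of _ 0] bexI[of _ "n - 1"])
  ultimately have "{1, 2, 3, 4} \<subseteq> color G ` C f" by (metis empty_subsetI image_eqI insert_subset)
  moreover have "{1..4::nat} = {1, 2, 3, 4}" by auto
  ultimately show "{1..4} \<subseteq> color G ` C f" by simp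
qed

lemma colored_cycle_C:
  assumes "1 \<le> f" "f \<le> m" "C f \<subseteq> edges H" "color H = color G"
  shows "colored_cycle H 4 (3 * n) (C f)"
  unfolding colored_cycle_def using assms color_C[OF assms(1,2)] cyclic_cyc length_cyc cycle_edges_cyc by fastforce

text \<open>
  An induced cycle meeting two private classes has at most two vertices in one of them and at most two
  outside of it, hence at most four private vertices; but every third vertex is private.
\<close>

lemma induced_cycle_unique:
  assumes H: "CE \<subseteq> E" "E \<subseteq> edges G" and vs: "cyclic_sequence vs" "length vs = 3 * n"
    and ind: "{e \<in> E. e \<subseteq> set vs} = cycle_edges vs"
  shows "\<exists>f. 1 \<le> f \<and> f \<le> m \<and> cycle_edges vs = C f"
proof -
  let ?F = "cycle_edges vs"
  have FE: "?F \<subseteq> E" and FG: "?F \<subseteq> edges G" using ind H by auto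
  have d: "distinct vs" using vs by (simp add: cyclic_sequence_def)
  \<comment> \<open>Pair edges form a matching.\<close>
  have QE_same: "q = r" if "{v, q} \<in> QE" "{v, r} \<in> QE" for v q r
    using that by (auto simp: QE_def doubleton_eq_iff V_eq_iff)
  have class0: "{a, b} \<in> QE" if "{a, b} \<in> edges G" "cl a = 0" "cl b = 0" for a b
  proof -
    have "{a, b} \<notin> CE" using CE_classes that by fastforce
    moreover have "{a, b} \<notin> PE f" if "1 \<le> f" for f
    proof
      assume "{a, b} \<in> PE f"
      then obtain u where "u < n" "Z f u \<in> {a, b}" using Z_in_PE by blast
      then show False using \<open>cl a = 0\<close> \<open>cl b = 0\<close> that by (auto simp: cl_XYZ)
    qed
    ultimately show ?thesis using that(1) by (auto simp: edges_G)
  qed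
  have consecutive: "{vs ! i, vs ! Suc i} \<in> ?F" if "Suc i < 3 * n" for i
    using that vs(2) unfolding cycle_edges_def by (auto intro!: exI[of _ i])
  \<comment> \<open>Inside class \<open>0\<close> there are only pair edges, a matching, so no three
    consecutive vertices stay there.\<close>
  have window: "\<exists>j \<in> {i, Suc i, Suc (Suc i)}. 1 \<le> cl (vs ! j)" if "Suc (Suc i) < 3 * n" for i
  proof (rule ccontr)
    assume "\<not> ?thesis"
    then have "cl (vs ! i) = 0" "cl (vs ! Suc i) = 0" "cl (vs ! Suc (Suc i)) = 0" by auto
    then have "{vs ! Suc i, vs ! i} \<in> QE" "{vs ! Suc i, vs ! Suc (Suc i)} \<in> QE"
      using class0 consecutive[of i] consecutive[of "Suc i"] that FG by (auto simp: insert_commute)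
    then have "vs ! i = vs ! Suc (Suc i)" by (rule QE_same)
    then show False using d that vs(2) by (simp add: nth_eq_iff_index_eq)
  qed
  define Q where "Q = {v \<in> set vs. 1 \<le> cl v}"
  \<comment> \<open>One private vertex from each of five disjoint windows.\<close>
  have "\<forall>t. \<exists>j. t < 5 \<longrightarrow> j \<in> {3 * t, Suc (3 * t), Suc (Suc (3 * t))} \<and> 1 \<le> cl (vs ! j)"
  proof
    fix t
    have "t < 5 \<Longrightarrow> Suc (Suc (3 * t)) < 3 * n" using n5 by simp
    then show "\<exists>j. t < 5 \<longrightarrow> j \<in> {3 * t, Suc (3 * t), Suc (Suc (3 * t))} \<and> 1 \<le> cl (vs ! j)"
      using window[of "3 * t"] by blast
  qed
  then obtain g where g: "\<And>t. t < 5 \<Longrightarrow> g t \<in> {3 * t, Suc (3 * t), Suc (Suc (3 * t))} \<and> 1 \<le> cl (vs ! g t)" by metis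
  have gl: "g t < 3 * n" if "t < 5" for t using g[OF that] that n5 by auto
  have "inj_on (\<lambda>t. vs ! g t) {..<5}"
  proof (rule inj_onI)
    fix s t :: nat assume st: "s \<in> {..<5}" "t \<in> {..<5}" "vs ! g s = vs ! g t"
    then have "g s = g t" using d gl vs(2) by (simp add: nth_eq_iff_index_eq)
    then show "s = t" using g[of s] g[of t] st by auto
  qed
  then have "card ((\<lambda>t. vs ! g t) ` {..<5}) = 5" by (simp add: card_image)
  moreover have "(\<lambda>t. vs ! g t) ` {..<5} \<subseteq> Q" using g gl vs(2) by (auto simp: Q_def)
  moreover have finQ: "finite Q" by (simp add: Q_def)
  ultimately have Q5: "5 \<le> card Q" by (metis card_mono)
  have cl_le: "cl v \<le> m" if v: "v \<in> set vs" for v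
  proof -
    obtain e where e: "e \<in> ?F" "v \<in> e" using v Union_cycle_edges[OF vs(1)] by blast
    then have "e \<in> edges G" using FG by blast
    then show ?thesis using e(2) by (auto simp: edges_G PE_def QE_def CE_def cl_XYZ nxt_less V_parts)
  qed
  \<comment> \<open>A private vertex of another class is joined to \<open>p\<close> by a chord,
    which is still present in \<open>E\<close>. As the cycle is induced, it contains this chord, and
    \<open>p\<close> has only two neighbours on it.\<close>
  have few: "card {q \<in> Q. cl q \<noteq> cl p} \<le> 2" if p: "p \<in> Q" for p
  proof -
    have "{p, q} \<in> ?F" if "q \<in> Q" "cl q \<noteq> cl p" for q
    proof -
      have "{p, q} \<in> CE"
      proof (cases "cl p < cl q")
        case True
        then show ?thesis using p that cl_le unfolding CE_def Q_def by blast
      next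
        case False
        then have "{q, p} \<in> CE" using p that cl_le unfolding CE_def Q_def
          by (metis (mono_tags, lifting) linorder_neqE_nat mem_Collect_eq)
        then show ?thesis by (simp add: insert_commute)
      qed
      then have "{p, q} \<in> {e \<in> E. e \<subseteq> set vs}" using H(1) p that by (auto simp: Q_def)
      then show ?thesis using ind by blast
    qed
    then have sub: "{q \<in> Q. cl q \<noteq> cl p} \<subseteq> {x. {p, x} \<in> ?F}" by auto
    have "p \<in> set vs" using p by (simp add: Q_def)
    then obtain q r where "q \<noteq> r" "{x. {p, x} \<in> ?F} = {q, r}" using cycle_neighbours[OF vs(1)] by metis
    with sub have "card {q \<in> Q. cl q \<noteq> cl p} \<le> card {q, r}" by (metis card_mono finite.emptyI finite.insertI)
    then show ?thesis using \<open>q \<noteq> r\<close> by simp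
  qed
  have same: "cl p = cl p'" if "p \<in> Q" "p' \<in> Q" for p p'
  proof (rule ccontr)
    assume "cl p \<noteq> cl p'"
    then have "Q = {q \<in> Q. cl q \<noteq> cl p} \<union> {q \<in> Q. cl q \<noteq> cl p'}" by auto
    then have "card Q \<le> card {q \<in> Q. cl q \<noteq> cl p} + card {q \<in> Q. cl q \<noteq> cl p'}" by (metis card_Un_le)
    then show False using few[OF that(1)] few[OF that(2)] Q5 by linarith
  qed
  obtain p where p: "p \<in> Q" using Q5 by fastforce
  define f where "f = cl p"
  have f: "1 \<le> f" "f \<le> m" using p cl_le by (auto simp: f_def Q_def)
  have cls: "cl v = 0 \<or> cl v = f" if "v \<in> set vs" for v
    using same[OF _ p, of v] that by (cases "cl v = 0") (auto simp: Q_def f_def)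
  have "set vs \<subseteq> VC f"
  proof
    fix v assume v: "v \<in> set vs"
    obtain q r where qr: "q \<noteq> r" "{x. {v, x} \<in> ?F} = {q, r}" using cycle_neighbours[OF vs(1) v] by metis
    have kind: "{v, x} \<in> PE f \<or> {v, x} \<in> QE" if "{v, x} \<in> ?F" for x
    proof -
      have x: "x \<in> set vs" using that Union_cycle_edges[OF vs(1)] by blast
      have "{v, x} \<notin> CE" using cls[OF x] cls[OF v] CE_classes by fastforce
      moreover have "g = f" if g: "{v, x} \<in> PE g" "1 \<le> g" for g
      proof -
        obtain u where "u < n" "Z g u \<in> {v, x}" using Z_in_PE[OF g(1)] by blast
        then show ?thesis using cls[OF x] cls[OF v] g(2) by (auto simp: cl_XYZ)
      qed
      ultimately show ?thesis using that FG by (auto simp: edges_G)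
    qed
    \<comment> \<open>The two cycle edges at \<open>v\<close> cannot both belong to the matching, so
      one is a path edge of row \<open>f\<close>.\<close>
    have "{v, q} \<in> ?F" "{v, r} \<in> ?F" using qr by auto
    moreover have "\<not> ({v, q} \<in> QE \<and> {v, r} \<in> QE)" using QE_same qr(1) by blast
    ultimately obtain x where "{v, x} \<in> PE f" using kind by blast
    then have "v \<in> \<Union>(C f)" by (auto simp: C_def)
    then show "v \<in> VC f" by (simp add: Union_C)
  qed
  \<comment> \<open>Equal cardinality turns the inclusion into an equality, here for the vertices
    and below for the edges.\<close>
  moreover have "card (set vs) = 3 * n" "card (VC f) = 3 * n" "finite (VC f)"
    using distinct_card[OF d] distinct_card[OF distinct_cyc[of f]] vs(2) length_cyc[of f] set_cyc[of f]
    by (auto simp: VC_def)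
  ultimately have S: "set vs = VC f" by (simp add: card_subset_eq)
  have "?F \<subseteq> {e \<in> edges G. e \<subseteq> VC f}" using ind H(2) S by blast
  then have "?F \<subseteq> C f" using induced_C[OF f] by simp
  moreover have "card ?F = card (C f)" using card_cycle_edges[OF vs(1)] vs(2) card_C by simp
  moreover have "finite (C f)" using finite_cycle_edges[of "cyc f"] by (simp add: cycle_edges_cyc)
  ultimately have "?F = C f" by (simp add: card_subset_eq)
  then show ?thesis using f by blast
qed

lemma induced_in_C:
  assumes "1 \<le> f" "f \<le> m" "C f \<subseteq> edges H" "edges H \<subseteq> edges G"
  shows "induced_in H (C f)"
  unfolding induced_in_def Union_C using induced_C[OF assms(1,2)] assms(3,4) by blast

text \<open>Applies whenever no chord is deleted: to sets of conflict edges for non-cascading, and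
  to sets of shared edges for hitting sets.\<close>

lemma induced_colored_unique:
  assumes "X' \<inter> CE = {}" "F \<subseteq> edges G - X'" "\<exists>vs. cyclic_sequence vs \<and> length vs = 3 * n \<and> F = cycle_edges vs"
    "induced_in (delete_edges G X') F"
  shows "\<exists>f. 1 \<le> f \<and> f \<le> m \<and> F = C f"
proof -
  obtain vs where vs: "cyclic_sequence vs" "length vs = 3 * n" "F = cycle_edges vs" using assms(3) by blast
  have "{e \<in> edges G - X'. e \<subseteq> set vs} = cycle_edges vs"
    using assms(4) Union_cycle_edges[OF vs(1)] by (simp add: induced_in_def delete_edges_def vs(3))
  moreover have "CE \<subseteq> edges G - X'" using assms(1) by (auto simp: edges_G)
  ultimately show ?thesis using induced_cycle_unique[of "edges G - X'" vs] vs by blast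
qed

lemma induced_colored_cycles_G: "induced_colored_cycles G 4 (3 * n) = C ` {1..m}"
proof
  show "C ` {1..m} \<subseteq> induced_colored_cycles G 4 (3 * n)"
  proof (clarsimp simp: induced_colored_cycles_def)
    fix f assume f: "Suc 0 \<le> f" "f \<le> m"
    then have "C f \<subseteq> edges G" using C_subset[of f] by auto
    then show "colored_cycle G 4 (3 * n) (C f) \<and> induced_in G (C f)"
      using f colored_cycle_C[of f G] induced_in_C[of f G] by simp
  qed
  have "delete_edges G {} = G" by (simp add: delete_edges_def)
  then have "\<exists>f. 1 \<le> f \<and> f \<le> m \<and> F = C f" if "F \<in> induced_colored_cycles G 4 (3 * n)" for F
    using induced_colored_unique[of "{}" F] that by (simp add: induced_colored_cycles_def colored_cycle_def)
  then show "induced_colored_cycles G 4 (3 * n) \<subseteq> C ` {1..m}" by fastforce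
qed

lemma conflict_not_chord: "conflict_edges G 4 (3 * n) \<inter> CE = {}"
  using C_subset by (fastforce simp: conflict_edges_def induced_colored_cycles_G)

text \<open>Conflict edges are never chords, so a cycle that is induced after their deletion is
  still some \<open>C f\<close>, and these are induced in \<open>G\<close> already.\<close>

lemma non_cascading_G: "non_cascading G 4 (3 * n)"
  unfolding non_cascading_def
proof (intro allI impI notI)
  fix F X' assume F: "colored_cycle G 4 (3 * n) F \<and> \<not> induced_in G F" and X': "X' \<subseteq> conflict_edges G 4 (3 * n)"
    and ind: "induced_in (delete_edges G X') F"
  have "F \<subseteq> edges G - X'" using ind by (auto simp: induced_in_def delete_edges_def)
  moreover have "X' \<inter> CE = {}" using X' conflict_not_chord by blast
  ultimately obtain f where "1 \<le> f" "f \<le> m" "F = C f"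
    using induced_colored_unique[of X' F] ind F by (auto simp: colored_cycle_def)
  then show False using F induced_in_C[of f G] C_subset by auto
qed

lemma colored_graph_G: "colored_graph 4 G"
  unfolding colored_graph_def
proof (intro conjI ballI)
  show "finite (verts G)" by (simp add: verts_G)
  have cl_verts: "v \<in> verts G" if "cl v \<le> m" for v
  proof -
    obtain i where "i < 3 * n" "v = 3 * n * cl v + i" by (rule chord_decomp)
    moreover have "3 * n * cl v \<le> 3 * n * m" using that by simp
    ultimately have "v < 3 * n * m + 3 * n" by linarith
    then show ?thesis by (simp add: verts_G)
  qed
  fix e assume "e \<in> edges G"
  then show "e \<subseteq> verts G"
    by (auto simp: edges_G PE_def QE_def CE_def cl_XYZ nxt_less V_parts intro!: cl_verts)
  show "card e = 2"
    using \<open>e \<in> edges G\<close> by (auto simp: edges_G PE_def QE_def CE_def XYZ_eq_iff nxt_less V_eq_iff card_insert_if)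
next
  show "color G ` edges G = {1..4}"
  proof
    have "color G e \<in> {1..4}" if "e \<in> edges G" for e
      using that color_PE color_QE color_CE unfolding edges_G PE_def QE_def by auto
    then show "color G ` edges G \<subseteq> {1..4}" by blast
    have "color G ` C 1 \<subseteq> color G ` edges G" using C_subset[of 1] m1 by (intro image_mono) auto
    then show "{1..4} \<subseteq> color G ` edges G" using color_C[of 1] m1 by simp
  qed
qed

lemma C_inj: "inj_on C {1..m}"
proof (rule inj_onI)
  fix f g assume fg: "f \<in> {1..m}" "g \<in> {1..m}" "C f = C g"
  have "Z f 0 \<in> VC f" using n5 by (auto simp: VC_def)
  then have "Z f 0 \<in> VC g" using fg(3) Union_C by metis
  then have "cl (Z f 0) = 0 \<or> cl (Z f 0) = g" by (rule VC_class)
  then show "f = g" using fg n5 by (auto simp: cl_XYZ)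
qed

text \<open>An edge with a private vertex lies on at most one of the cycles and can be traded for
  any member of that row; a shared edge stands for its own column.\<close>

lemma edge_representative: "\<exists>u < n. \<forall>f. 1 \<le> f \<and> f \<le> m \<and> e \<in> C f \<longrightarrow> mem f u"
proof (cases "\<exists>f. 1 \<le> f \<and> f \<le> m \<and> e \<in> C f")
  case False
  then show ?thesis using n5 by (intro exI[of _ 0]) auto
next
  case True
  then obtain f where f: "1 \<le> f" "f \<le> m" "e \<in> C f" by blast
  show ?thesis
  proof (cases "\<exists>v \<in> e. cl v = f")
    case True
    then obtain v where v: "v \<in> e" "cl v = f" by blast
    have "g = f" if "1 \<le> g" "e \<in> C g" for g
      using VC_class[of v g] that v Union_C f(1) by fastforce
    then show ?thesis using ex_mem[OF f(1,2)] by blast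
  next
    case False
    have "\<exists>u < n. e = {X f u, Y f u}"
      using f(3) False by (auto simp: C_def PE_def cl_XYZ)
    then obtain u where u: "u < n" "e = {X f u, Y f u}" by blast
    have "mem f u" using False u by (auto simp: cl_XYZ split: if_splits)
    then have e: "e = {V 0 u 0, V 0 u 1}" using u by (simp add: vx_def vy_def)
    have "mem g u" if "1 \<le> g" "e \<in> C g" for g
    proof -
      have "V 0 u 0 \<in> VC g" using that(2) e Union_C by blast
      then show ?thesis using u(1) that(1) by (auto simp: VC_def vx_def vy_def vz_def V_eq_iff split: if_splits)
    qed
    then show ?thesis using u(1) by blast
  qed
qed

lemma deletion_iff_hittable: "has_cycle_deletion G 4 (3 * n) k \<longleftrightarrow> hittable n rows k"
proof
  assume "has_cycle_deletion G 4 (3 * n) k"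
  then obtain S where S: "S \<subseteq> edges G" "card S \<le> k" "induced_colored_cycles (delete_edges G S) 4 (3 * n) = {}"
    by (auto simp: has_cycle_deletion_def)
  have "edges G \<subseteq> Pow (verts G)" using colored_graph_G by (auto simp: colored_graph_def)
  then have "finite S" using S(1) by (metis finite_Pow_iff finite_lessThan finite_subset verts_G)
  have "\<forall>e. \<exists>u < n. \<forall>f. 1 \<le> f \<and> f \<le> m \<and> e \<in> C f \<longrightarrow> mem f u" using edge_representative by blast
  then obtain \<phi> where \<phi>: "\<And>e. \<phi> e < n" "\<And>e f. 1 \<le> f \<Longrightarrow> f \<le> m \<Longrightarrow> e \<in> C f \<Longrightarrow> mem f (\<phi> e)" by metis
  show "hittable n rows k"
    unfolding hittable_def
  proof (intro exI[of _ "\<phi> ` S"] conjI ballI)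
    show "\<phi> ` S \<subseteq> {..<n}" using \<phi>(1) by auto
    show "card (\<phi> ` S) \<le> k" using card_image_le[OF \<open>finite S\<close>, of \<phi>] S(2) by simp
    fix row assume "row \<in> set rows"
    then obtain i where i: "i < m" "row = rows ! i" by (auto simp: in_set_conv_nth)
    \<comment> \<open>The deletion set may contain chords, but a cycle that it misses stays induced,
      since its vertices span no further edges of \<open>G\<close>.\<close>
    have "C (Suc i) \<inter> S \<noteq> {}"
    proof
      assume *: "C (Suc i) \<inter> S = {}"
      then have "C (Suc i) \<subseteq> edges (delete_edges G S)" using C_subset[of "Suc i"] i by (auto simp: delete_edges_def)
      then have "C (Suc i) \<in> induced_colored_cycles (delete_edges G S) 4 (3 * n)"
        using i by (auto simp: induced_colored_cycles_def delete_edges_def intro!: colored_cycle_C induced_in_C)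
      then show False using S(3) by blast
    qed
    then obtain e where e: "e \<in> C (Suc i)" "e \<in> S" by blast
    then have "mem (Suc i) (\<phi> e)" using \<phi>(2) i by simp
    then have "row ! \<phi> e" using mem_row[of "Suc i" "\<phi> e"] i \<phi>(1) by simp
    then show "\<exists>u \<in> \<phi> ` S. row ! u" using e by blast
  qed
next
  assume "hittable n rows k"
  then obtain H where H: "H \<subseteq> {..<n}" "card H \<le> k" "\<forall>row \<in> set rows. \<exists>u \<in> H. row ! u" by (auto simp: hittable_def)
  \<comment> \<open>Only shared edges are deleted, so every cycle of the relevant length that is
    induced afterwards is again some \<open>C f\<close>.\<close>
  let ?S = "(\<lambda>u. {V 0 u 0, V 0 u 1}) ` H"
  have SQ: "?S \<subseteq> QE" using H(1) by (auto simp: QE_def)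
  have "induced_colored_cycles (delete_edges G ?S) 4 (3 * n) = {}"
  proof (rule ccontr)
    assume "\<not> ?thesis"
    then obtain F where F: "colored_cycle (delete_edges G ?S) 4 (3 * n) F" "induced_in (delete_edges G ?S) F"
      by (auto simp: induced_colored_cycles_def)
    have FS: "F \<subseteq> edges G - ?S" using F(1) by (auto simp: colored_cycle_def delete_edges_def)
    moreover have "?S \<inter> CE = {}" using SQ disjoint_CE by blast
    ultimately obtain f where f: "1 \<le> f" "f \<le> m" "F = C f"
      using induced_colored_unique[of ?S F] F by (auto simp: colored_cycle_def)
    have "rows ! (f - 1) \<in> set rows" using f by simp
    then obtain u where u: "u \<in> H" "(rows ! (f - 1)) ! u" using H(3) by blast
    then have "u < n" "mem f u" using H(1) mem_row[OF f(1,2)] by auto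
    then have "{V 0 u 0, V 0 u 1} \<in> C f" by (auto simp: C_def vx_def vy_def)
    then show False using FS f(3) u(1) by blast
  qed
  moreover have "card ?S \<le> k" using card_image_le[of H "\<lambda>u. {V 0 u 0, V 0 u 1}"] H(1,2) finite_subset by fastforce
  moreover have "?S \<subseteq> edges G" using SQ by (auto simp: edges_G)
  ultimately show "has_cycle_deletion G 4 (3 * n) k" unfolding has_cycle_deletion_def by blast
qed

lemma hs_instance_valid: "hs_instance n rows k \<in> ccd_instances"
proof -
  have "num_colors (hs_instance n rows k) = 4" "edge_list (hs_instance n rows k) = hs_edges n rows"
    by (simp_all add: hs_instance_def)
  then show ?thesis using distinct_ends colored_graph_G by (simp add: ccd_instances_def graph_of_hs)
qed

lemma instance_cycles_hs: "instance_cycles (hs_instance n rows k) = C ` {1..m}"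
  using induced_colored_cycles_G by (simp add: instance_cycles_def graph_of_hs) (simp add: hs_instance_def)

lemma card_instance_cycles: "card (instance_cycles (hs_instance n rows k)) \<le> order (hs_instance n rows k)"
proof -
  have "card (instance_cycles (hs_instance n rows k)) = m" using C_inj by (simp add: instance_cycles_hs card_image)
  also have "\<dots> \<le> 3 * n * Suc m" using n5 mult_le_mono[of 1 "3 * n" m "Suc m"] by linarith
  finally show ?thesis by (simp add: hs_instance_def)
qed

end

section \<open>From circuits of weft two to hitting sets\<close>

subsection \<open>Normal forms and forced values\<close>

text \<open>Gates as data with a tree; the tags agree with those of \<open>enc_gate\<close>.\<close>

fun gcode :: "gate \<Rightarrow> nat \<times> nat list" where
  "gcode Input = (0, [])"
| "gcode (Neg j) = (1, [j])"
| "gcode (Conj js) = (2, js)"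
| "gcode (Disj js) = (3, js)"

definition gate_at :: "(nat \<times> nat list) list \<Rightarrow> nat \<Rightarrow> nat \<times> nat list" where
  "gate_at D h = get (0, []) D h"

text \<open>
  A triple \<open>(i, a, b)\<close> describes slot \<open>i\<close> of a set of inputs: \<open>a\<close> and \<open>b\<close> are consecutive members, shifted
  by one so that \<open>0\<close> can serve as the left end.  It shows that the member \<open>a\<close> is true and everything
  strictly between \<open>a\<close> and \<open>b\<close> is false.  \<open>forced e D p s h\<close>: the triples in \<open>p\<close> alone show, by recursion to
  depth \<open>e\<close>, that node \<open>h\<close> has value \<open>s\<close>.
\<close>

fun forced :: "nat \<Rightarrow> (nat \<times> nat list) list \<Rightarrow> (nat \<times> nat \<times> nat) list \<Rightarrow> bool \<Rightarrow> nat \<Rightarrow> bool" where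
  "forced 0 D p s h = False"
| "forced (Suc e) D p s h =
    (if fst (gate_at D h) = 0 then
      (if s then \<exists>x \<in> set p. fst (snd x) = Suc h else \<exists>x \<in> set p. fst (snd x) < Suc h \<and> Suc h < snd (snd x))
    else if fst (gate_at D h) = 1 then \<forall>j \<in> set (snd (gate_at D h)). forced e D p (\<not> s) j
    else if (fst (gate_at D h) = 2) = s then \<forall>j \<in> set (snd (gate_at D h)). forced e D p s j
    else \<exists>j \<in> set (snd (gate_at D h)). forced e D p s j)"

text \<open>
  For a node of weft at most one, \<open>cnf\<close> lists clauses whose literals are nodes of weft zero.  Only small
  disjunctions are distributed over, so the size stays polynomial.
\<close>

fun cnf :: "nat \<Rightarrow> (nat \<times> nat list) list \<Rightarrow> bool \<Rightarrow> nat \<Rightarrow> (nat \<times> bool) list list" where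
  "cnf 0 D s h = []"
| "cnf (Suc e) D s h =
    (if fst (gate_at D h) = 0 then [[(h, s)]]
    else if fst (gate_at D h) = 1 then concat (map (\<lambda>j. cnf e D (\<not> s) j) (snd (gate_at D h)))
    else if (fst (gate_at D h) = 2) = s then concat (map (\<lambda>j. cnf e D s j) (snd (gate_at D h)))
    else if length (snd (gate_at D h)) \<le> 2 then
      map (\<lambda>z. fst z @ snd z) (List.product (cnf e D s (get 0 (snd (gate_at D h)) 0)) (cnf e D s (get 0 (snd (gate_at D h)) 1)))
    else [map (\<lambda>j. (j, s)) (snd (gate_at D h))])"

text \<open>A list of normal forms, read as a disjunction. Disjunctions of any size concatenate
  these lists. Below a large conjunction the weft is at most one, so the clauses of the children
  merge into one normal form; only small conjunctions are distributed.\<close>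

fun dcnf :: "nat \<Rightarrow> (nat \<times> nat list) list \<Rightarrow> bool \<Rightarrow> nat \<Rightarrow> (nat \<times> bool) list list list" where
  "dcnf 0 D s h = []"
| "dcnf (Suc e) D s h =
    (if fst (gate_at D h) = 0 then [[[(h, s)]]]
    else if fst (gate_at D h) = 1 then concat (map (\<lambda>j. dcnf e D (\<not> s) j) (snd (gate_at D h)))
    else if (fst (gate_at D h) = 2) \<noteq> s then concat (map (\<lambda>j. dcnf e D s j) (snd (gate_at D h)))
    else if length (snd (gate_at D h)) \<le> 2 then
      map (\<lambda>z. fst z @ snd z) (List.product (dcnf e D s (get 0 (snd (gate_at D h)) 0)) (dcnf e D s (get 0 (snd (gate_at D h)) 1)))
    else [concat (map (\<lambda>j. cnf e D s j) (snd (gate_at D h)))])"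

declare forced.simps(2) [simp del] cnf.simps(2) [simp del] dcnf.simps(2) [simp del]

lemma forced_mono: "forced e D p s h \<Longrightarrow> set p \<subseteq> set p' \<Longrightarrow> forced e D p' s h"
proof (induction e arbitrary: s h)
  case (Suc e)
  have IH: "forced e D p s h \<Longrightarrow> forced e D p' s h" for s h using Suc by blast
  show ?case using Suc.prems IH by (simp only: forced.simps split: if_splits) blast+
qed simp

text \<open>A recursive form of the bounds on depth and weft, matching the recursion of the normal
  forms.\<close>

fun depth_weft_le :: "circuit \<Rightarrow> nat \<Rightarrow> nat \<Rightarrow> nat \<Rightarrow> bool" where
  "depth_weft_le C 0 w h \<longleftrightarrow> preds (C ! h) = []"
| "depth_weft_le C (Suc e) w h \<longleftrightarrow> (if large (C ! h) then 0 < w \<and> (\<forall>j \<in> set (preds (C ! h)). depth_weft_le C e (w - 1) j)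
    else \<forall>j \<in> set (preds (C ! h)). depth_weft_le C e w j)"

lemma depth_weft_le_mono: "depth_weft_le C e w h \<Longrightarrow> e \<le> e' \<Longrightarrow> w \<le> w' \<Longrightarrow> depth_weft_le C e' w' h"
proof (induction e arbitrary: e' w w' h)
  case 0
  then show ?case by (cases e') (auto simp: large_def)
next
  case (Suc e)
  then obtain f where f: "e' = Suc f" "e \<le> f" by (cases e') auto
  show ?case
  proof (cases "large (C ! h)")
    case True
    then have "0 < w" "\<forall>j \<in> set (preds (C ! h)). depth_weft_le C e (w - 1) j" using Suc.prems by auto
    then show ?thesis using True f Suc.prems(3) Suc.IH[of "w - 1" _ f "w' - 1"] by auto
  next
    case False
    then show ?thesis using f Suc.prems Suc.IH[of w _ f w'] by auto
  qed
qed

locale wcircuit =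
  fixes C :: circuit
  assumes circuit: "circuit C"
begin

abbreviation "nc \<equiv> length C"
abbreviation "D \<equiv> map gcode C"

lemma nc_pos: "0 < nc" using circuit by (auto simp: circuit_def)

lemma pred_less: "i < nc \<Longrightarrow> j \<in> set (preds (C ! i)) \<Longrightarrow> j < i"
  using circuit by (auto simp: circuit_def)

lemma gate_length: "i < nc \<Longrightarrow> C ! i = Conj js \<or> C ! i = Disj js \<Longrightarrow> 2 \<le> length js"
  using circuit unfolding circuit_def by (metis nth_mem)

lemma gate_at_D: "h < nc \<Longrightarrow> gate_at D h = gcode (C ! h)"
  by (simp add: gate_at_def)

lemma preds_Nil: "h < nc \<Longrightarrow> preds (C ! h) = [] \<Longrightarrow> C ! h = Input"
  using gate_length[of h] by (cases "C ! h") auto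

lemma gate_two:
  assumes "h < nc" "C ! h = Conj js \<or> C ! h = Disj js" "\<not> large (C ! h)"
  obtains a b where "js = [a, b]" "a < nc" "b < nc"
proof -
  have "length js = 2" using gate_length[OF assms(1,2)] assms(2,3) by (auto simp: large_def)
  then obtain a b where "js = [a, b]" by (auto simp: numeral_2_eq_2 length_Suc_conv)
  moreover have "a < h" "b < h" using pred_less[OF assms(1)] assms(2) calculation by auto
  ultimately show thesis using that assms(1) by simp
qed

lemma gate_cases:
  assumes "h < nc"
  obtains (Input) "C ! h = Input" "gate_at D h = (0, [])"
  | (Neg) j where "C ! h = Neg j" "gate_at D h = (1, [j])" "preds (C ! h) = [j]"
  | (gate) js where "C ! h = Conj js \<or> C ! h = Disj js" "fst (gate_at D h) \<noteq> 0" "fst (gate_at D h) \<noteq> 1"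
      "snd (gate_at D h) = js" "preds (C ! h) = js" "large (C ! h) \<longleftrightarrow> 2 < length js"
  using that gate_at_D[OF assms] by (cases "C ! h") (auto simp: large_def)

subsubsection \<open>Depth and weft along paths\<close>

definition paths_to :: "nat \<Rightarrow> nat list set" where
  "paths_to h = {p. p \<noteq> [] \<and> set p \<subseteq> {..<nc} \<and> hd p \<in> inputs C \<and> last p = h \<and>
    (\<forall>i. Suc i < length p \<longrightarrow> p ! i \<in> set (preds (C ! (p ! Suc i))))}"

lemma paths_to_snoc:
  assumes "q \<in> paths_to j" "j \<in> set (preds (C ! h))" "h < nc"
  shows "q @ [h] \<in> paths_to h"
proof -
  have q: "q \<noteq> []" "last q = j" using assms(1) by (auto simp: paths_to_def)
  have "(q @ [h]) ! i \<in> set (preds (C ! ((q @ [h]) ! Suc i)))" if "Suc i < length (q @ [h])" for i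
  proof (cases "Suc i < length q")
    case True
    then show ?thesis using assms(1) by (auto simp: paths_to_def nth_append)
  next
    case False
    then have "i = length q - 1" "Suc i = length q" using that q by auto
    then show ?thesis using q assms(2) by (simp add: nth_append last_conv_nth)
  qed
  then show ?thesis using assms q by (auto simp: paths_to_def)
qed

text \<open>Every node that is not an input has a predecessor. Hence each gate lies on a path from
  an input, and such paths are what depth and weft count.\<close>

lemma paths_to_ex: "h < nc \<Longrightarrow> \<exists>p. p \<in> paths_to h"
proof (induction h rule: less_induct)
  case (less h)
  show ?case
  proof (cases "preds (C ! h) = []")
    case True
    then have "[h] \<in> paths_to h" using preds_Nil[OF less.prems] less.prems by (auto simp: paths_to_def inputs_def)
    then show ?thesis by blast
  next
    case False
    then obtain j where j: "j \<in> set (preds (C ! h))" by (meson last_in_set)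
    then have "j < h" using pred_less less.prems by blast
    then obtain q where "q \<in> paths_to j" using less by (meson less_trans)
    then show ?thesis using paths_to_snoc j less.prems by blast
  qed
qed

lemma depth_weft_leI:
  assumes "h < nc" "\<forall>p \<in> paths_to h. length p \<le> Suc e \<and> length (filter (\<lambda>i. large (C ! i)) p) \<le> w"
  shows "depth_weft_le C e w h"
  using assms
proof (induction e arbitrary: h w)
  case 0
  show ?case
  proof (rule ccontr)
    assume "\<not> depth_weft_le C 0 w h"
    then obtain j where j: "j \<in> set (preds (C ! h))" by (metis depth_weft_le.simps(1) last_in_set)
    then have "j < nc" using pred_less 0(1) by fastforce
    then obtain q where q: "q \<in> paths_to j" using paths_to_ex by blast
    then have "q @ [h] \<in> paths_to h" using paths_to_snoc j 0(1) by blast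
    then have "length (q @ [h]) \<le> 1" using 0(2) by fastforce
    then show False using q by (auto simp: paths_to_def)
  qed
next
  case (Suc e)
  have *: "j < nc \<and> (\<forall>q \<in> paths_to j. length q \<le> Suc e \<and>
      length (filter (\<lambda>i. large (C ! i)) q) + (if large (C ! h) then 1 else 0) \<le> w)" if j: "j \<in> set (preds (C ! h))" for j
  proof
    show "j < nc" using pred_less[OF Suc.prems(1) j] Suc.prems(1) by simp
    show "\<forall>q \<in> paths_to j. length q \<le> Suc e \<and> length (filter (\<lambda>i. large (C ! i)) q) + (if large (C ! h) then 1 else 0) \<le> w"
    proof
      fix q assume "q \<in> paths_to j"
      then have "q @ [h] \<in> paths_to h" using paths_to_snoc j Suc.prems(1) by blast
      then show "length q \<le> Suc e \<and> length (filter (\<lambda>i. large (C ! i)) q) + (if large (C ! h) then 1 else 0) \<le> w"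
        using Suc.prems(2) by (auto dest!: bspec)
    qed
  qed
  show ?case
  proof (cases "large (C ! h)")
    case True
    then obtain j where "j \<in> set (preds (C ! h))" by (cases "preds (C ! h)") (auto simp: large_def)
    then have "0 < w" using *[of j] True paths_to_ex[of j] by fastforce
    moreover have "depth_weft_le C e (w - 1) j" if "j \<in> set (preds (C ! h))" for j
      using *[OF that] True by (intro Suc.IH) auto
    ultimately show ?thesis using True by simp
  next
    case False
    then show ?thesis using * by (auto intro!: Suc.IH)
  qed
qed

lemma depth_weft_le_output:
  assumes "weft C \<le> w" "depth C \<le> d"
  shows "depth_weft_le C d w (nc - 1)"
proof (rule depth_weft_leI)
  show "nc - 1 < nc" using nc_pos by simp
  have eq: "paths_to (nc - 1) = input_output_paths C" by (simp add: paths_to_def input_output_paths_def)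
  \<comment> \<open>Paths follow the topological order, so there are finitely many, and the maxima
    in \<open>depth\<close> and \<open>weft\<close> bound each of them.\<close>
  have "distinct p \<and> set p \<subseteq> {..<nc}" if "p \<in> paths_to h" for p h
  proof -
    have "p ! i < p ! Suc i" if "Suc i < length p" for i
      using \<open>p \<in> paths_to h\<close> that pred_less by (auto simp: paths_to_def subset_iff)
    then have "sorted_wrt (<) p" by (simp add: sorted_wrt_iff_nth_Suc_transp transp_on_less)
    then show ?thesis using that by (auto simp: paths_to_def strict_sorted_iff)
  qed
  then have "finite (paths_to h)" for h
    by (intro finite_subset[OF _ finite_subset_distinct[of "{..<nc}"]]) auto
  then have fin: "finite (input_output_paths C)" using eq by metis
  show "\<forall>p \<in> paths_to (nc - 1). length p \<le> Suc d \<and> length (filter (\<lambda>i. large (C ! i)) p) \<le> w"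
  proof
    fix p assume "p \<in> paths_to (nc - 1)"
    then have p: "p \<in> input_output_paths C" using eq by simp
    have "length p - 1 \<le> depth C" unfolding depth_def using fin p by (intro Max_ge) auto
    moreover have "length (filter (\<lambda>i. large (C ! i)) p) \<le> weft C" unfolding weft_def using fin p by (intro Max_ge) auto
    ultimately show "length p \<le> Suc d \<and> length (filter (\<lambda>i. large (C ! i)) p) \<le> w" using assms by simp
  qed
qed

subsubsection \<open>Correctness of the normal forms\<close>

lemma valuation_ex: "\<exists>v. valuation C A v"
proof -
  let ?rhs = "\<lambda>v i. case C ! i of Input \<Rightarrow> i \<in> A | Neg j \<Rightarrow> \<not> v j | Conj js \<Rightarrow> (\<forall>j \<in> set js. v j) | Disj js \<Rightarrow> (\<exists>j \<in> set js. v j)"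
  have "\<exists>v. \<forall>i < l. v i \<longleftrightarrow> ?rhs v i" if "l \<le> nc" for l
    using that
  proof (induction l)
    case (Suc l)
    then obtain v where v: "\<forall>i < l. v i \<longleftrightarrow> ?rhs v i" by auto
    let ?v = "v(l := ?rhs v l)"
    have "?rhs ?v i = ?rhs v i" if "i \<le> l" for i
    proof -
      have "?v j = v j" if "j \<in> set (preds (C ! i))" for j
        using pred_less[of i j] that \<open>i \<le> l\<close> Suc.prems by simp
      then show ?thesis by (cases "C ! i") (simp_all del: fun_upd_apply)
    qed
    then have "?v i \<longleftrightarrow> ?rhs ?v i" if "i < Suc l" for i
      using that v by (cases "i = l") (auto simp: less_Suc_eq)
    then show ?case by blast
  qed simp
  then show ?thesis unfolding valuation_def by blast
qed

context
  fixes A :: "nat set" and v :: "nat \<Rightarrow> bool"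
  assumes v: "valuation C A v"
begin

lemma v_gate:
  "h < nc \<Longrightarrow> C ! h = Input \<Longrightarrow> v h \<longleftrightarrow> h \<in> A"
  "h < nc \<Longrightarrow> C ! h = Neg j \<Longrightarrow> v h \<longleftrightarrow> \<not> v j"
  "h < nc \<Longrightarrow> C ! h = Conj js \<Longrightarrow> v h \<longleftrightarrow> (\<forall>j \<in> set js. v j)"
  "h < nc \<Longrightarrow> C ! h = Disj js \<Longrightarrow> v h \<longleftrightarrow> (\<exists>j \<in> set js. v j)"
  using v by (auto simp: valuation_def)

text \<open>By De Morgan, a false disjunction behaves like a true conjunction; comparing tag and
  sign treats both gates and both values at once.\<close>

lemma v_signed:
  assumes "h < nc" "C ! h = Conj js \<or> C ! h = Disj js"
  shows "v h = s \<longleftrightarrow> (if (fst (gate_at D h) = 2) = s then \<forall>j \<in> set js. v j = s else \<exists>j \<in> set js. v j = s)"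
  using assms gate_at_D[OF assms(1)] by (cases s) (auto simp: v_gate)

lemma forced_sound:
  assumes p: "\<And>i a b h. (i, a, b) \<in> set p \<Longrightarrow> (a = Suc h \<longrightarrow> h \<in> A) \<and> (a < Suc h \<and> Suc h < b \<longrightarrow> h \<notin> A)"
  shows "h < nc \<Longrightarrow> forced e D p s h \<Longrightarrow> v h = s"
proof (induction e arbitrary: s h)
  case (Suc e)
  have IH: "v j = s" if "j \<in> set (preds (C ! h))" "forced e D p s j" for s j
    using Suc.IH that pred_less[OF Suc.prems(1)] Suc.prems(1) by (meson less_trans)
  from Suc.prems(1) show ?case
  proof (cases rule: gate_cases)
    case Input
    then show ?thesis using Suc.prems p by (cases s) (fastforce simp: v_gate forced.simps(2))+
  next
    case (Neg j)
    then show ?thesis using Suc.prems IH[of j "\<not> s"] by (auto simp: v_gate forced.simps(2))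
  next
    case (gate js)
    then show ?thesis using Suc.prems IH v_signed[of h js s] by (auto simp: forced.simps(2) split: if_splits)
  qed
qed simp

text \<open>Without large gates the fan-in is at most two, so a node of depth \<open>e\<close>
  depends on at most \<open>2 ^ e\<close> inputs, and one slot shows the value of each.\<close>

lemma forced_complete:
  fixes w :: "nat \<Rightarrow> nat \<times> nat \<times> nat"
  assumes w: "\<And>h. h < nc \<Longrightarrow> \<exists>i \<in> S. if h \<in> A then fst (snd (w i)) = Suc h else fst (snd (w i)) < Suc h \<and> Suc h < snd (snd (w i))"
  shows "h < nc \<Longrightarrow> depth_weft_le C e 0 h \<Longrightarrow> \<exists>I. set I \<subseteq> S \<and> length I \<le> 2 ^ e \<and> forced (Suc e) D (map w I) (v h) h"
proof (induction e arbitrary: h)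
  have inp: "\<exists>I. set I \<subseteq> S \<and> length I \<le> 2 ^ e \<and> forced (Suc e) D (map w I) (v h) h" if "h < nc" "C ! h = Input" for e h
  proof -
    obtain i where "i \<in> S" "if h \<in> A then fst (snd (w i)) = Suc h else fst (snd (w i)) < Suc h \<and> Suc h < snd (snd (w i))"
      using w[OF \<open>h < nc\<close>] by blast
    then show ?thesis using that gate_at_D[of h] v_gate(1)[OF that] by (intro exI[of _ "[i]"]) (auto simp: forced.simps(2))
  qed
  {
    case 0
    then have "C ! h = Input" using preds_Nil by simp
    then show ?case using inp 0 by blast
  next
    case (Suc e)
    have nl: "\<not> large (C ! h)" using Suc.prems by (auto split: if_splits)
    have IH: "\<exists>I. set I \<subseteq> S \<and> length I \<le> 2 ^ e \<and> forced (Suc e) D (map w I) (v j) j" if "j \<in> set (preds (C ! h))" for j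
    proof (rule Suc.IH)
      show "j < nc" using pred_less[OF Suc.prems(1) that] Suc.prems(1) by simp
      show "depth_weft_le C e 0 j" using Suc.prems(2) nl that by simp
    qed
    have two: "\<exists>I. set I \<subseteq> S \<and> length I \<le> 2 ^ Suc e \<and> forced (Suc e) D (map w I) (v a) a \<and> forced (Suc e) D (map w I) (v b) b"
      if ab: "a \<in> set (preds (C ! h))" "b \<in> set (preds (C ! h))" for a b
    proof -
      obtain I where I: "set I \<subseteq> S" "length I \<le> 2 ^ e" "forced (Suc e) D (map w I) (v a) a" using IH[OF ab(1)] by blast
      obtain J where J: "set J \<subseteq> S" "length J \<le> 2 ^ e" "forced (Suc e) D (map w J) (v b) b" using IH[OF ab(2)] by blast
      show ?thesis using I J
        using forced_mono[of "Suc e" D "map w I" "v a" a "map w (I @ J)"] forced_mono[of "Suc e" D "map w J" "v b" b "map w (I @ J)"]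
        by (intro exI[of _ "I @ J"]) simp
    qed
    from Suc.prems(1) show ?case
    proof (cases rule: gate_cases)
      case Input
      then show ?thesis using inp Suc.prems by blast
    next
      case (Neg j)
      obtain I where "set I \<subseteq> S" "length I \<le> 2 ^ e" "forced (Suc e) D (map w I) (v j) j" using IH[of j] Neg by auto
      then show ?thesis using Neg v_gate(2)[OF Suc.prems(1) Neg(1)]
        by (intro exI[of _ I]) (auto simp: forced.simps(2)[of "Suc e"])
    next
      case (gate js)
      obtain a b where ab: "js = [a, b]" using gate_two[OF Suc.prems(1) gate(1) nl] by metis
      obtain I where I: "set I \<subseteq> S" "length I \<le> 2 ^ Suc e" "\<forall>j \<in> set js. forced (Suc e) D (map w I) (v j) j"
        using two[of a b] ab gate(5) by auto
      have "if (fst (gate_at D h) = 2) = v h then \<forall>j \<in> set js. v j = v h else \<exists>j \<in> set js. v j = v h"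
        by (rule iffD1[OF v_signed[OF Suc.prems(1) gate(1)] refl])
      then have "if (fst (gate_at D h) = 2) = v h then \<forall>j \<in> set js. forced (Suc e) D (map w I) (v h) j
          else \<exists>j \<in> set js. forced (Suc e) D (map w I) (v h) j"
        using I(3) by (cases "v h"; cases "fst (gate_at D h) = 2") force+
      then have "forced (Suc (Suc e)) D (map w I) (v h) h"
        unfolding forced.simps(2)[of "Suc e"] gate(4) using gate(2,3) by (simp only: if_False)
      then show ?thesis using I(1,2) by blast
    qed
  }
qed

definition true_clause :: "(nat \<times> bool) list \<Rightarrow> bool" where
  "true_clause c \<longleftrightarrow> (\<exists>at \<in> set c. v (fst at) = snd at)"

definition true_cnf :: "(nat \<times> bool) list list \<Rightarrow> bool" where
  "true_cnf K \<longleftrightarrow> (\<forall>c \<in> set K. true_clause c)"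

lemma true_cnf_append [simp]: "true_cnf (K @ L) \<longleftrightarrow> true_cnf K \<and> true_cnf L"
  by (auto simp: true_cnf_def)

lemma true_cnf_concat [simp]: "true_cnf (concat Ks) \<longleftrightarrow> (\<forall>K \<in> set Ks. true_cnf K)"
  by (auto simp: true_cnf_def)

lemma true_cnf_product: "true_cnf (map (\<lambda>z. fst z @ snd z) (List.product K L)) \<longleftrightarrow> true_cnf K \<or> true_cnf L"
  unfolding true_cnf_def true_clause_def by fastforce

text \<open>The recursion parameter is \<open>Suc e\<close>, because even a node of depth
  \<open>0\<close> takes one call.\<close>

lemma cnf_correct: "h < nc \<Longrightarrow> depth_weft_le C e 1 h \<Longrightarrow> true_cnf (cnf (Suc e) D s h) \<longleftrightarrow> v h = s"
proof (induction e arbitrary: s h)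
  have inp: "true_cnf (cnf (Suc e) D s h) \<longleftrightarrow> v h = s" if "h < nc" "C ! h = Input" for e s h
    using that gate_at_D[of h] by (auto simp: cnf.simps(2) dcnf.simps(2) true_cnf_def true_clause_def)
  {
    case 0
    then have "C ! h = Input" using preds_Nil by simp
    then show ?case using inp 0 by blast
  next
    case (Suc e)
    have IH: "true_cnf (cnf (Suc e) D s j) \<longleftrightarrow> v j = s" if "j \<in> set (preds (C ! h))" for s j
    proof -
      have "depth_weft_le C e 1 j" using Suc.prems(2) that depth_weft_le_mono[of C e 0 j e 1] by (auto split: if_splits)
      then show ?thesis using Suc.IH pred_less[OF Suc.prems(1) that] Suc.prems(1) by simp
    qed
    from Suc.prems(1) show ?case
    proof (cases rule: gate_cases)
      case Input
      then show ?thesis using inp Suc.prems by blast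
    next
      case (Neg j)
      then show ?thesis using IH[of j] v_gate(2)[OF Suc.prems(1) Neg(1)] by (auto simp: cnf.simps(2)[of "Suc e"])
    next
      case (gate js)
      note v_h = v_signed[OF Suc.prems(1) gate(1), of s]
      consider "(fst (gate_at D h) = 2) = s" | "(fst (gate_at D h) = 2) \<noteq> s" "large (C ! h)" | "(fst (gate_at D h) = 2) \<noteq> s" "\<not> large (C ! h)" by blast
      then show ?thesis
      proof cases
        case 1
        then show ?thesis using gate v_h IH by (simp add: cnf.simps(2)[of "Suc e"])
      next
        case 2
        then show ?thesis using gate v_h by (auto simp: cnf.simps(2)[of "Suc e"] true_cnf_def true_clause_def)
      next
        case 3
        obtain a b where ab: "js = [a, b]" using gate_two[OF Suc.prems(1) gate(1) 3(2)] by metis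
        show ?thesis using 3 gate v_h IH[of a] IH[of b] ab by (simp add: cnf.simps(2)[of "Suc e"] true_cnf_product)
      qed
    qed
  }
qed

lemma dcnf_correct: "h < nc \<Longrightarrow> depth_weft_le C e 2 h \<Longrightarrow> (\<exists>K \<in> set (dcnf (Suc e) D s h). true_cnf K) \<longleftrightarrow> v h = s"
proof (induction e arbitrary: s h)
  have inp: "(\<exists>K \<in> set (dcnf (Suc e) D s h). true_cnf K) \<longleftrightarrow> v h = s" if "h < nc" "C ! h = Input" for e s h
    using that gate_at_D[of h] by (auto simp: cnf.simps(2) dcnf.simps(2) true_cnf_def true_clause_def)
  have product: "(\<exists>K \<in> set (map (\<lambda>z. fst z @ snd z) (List.product Ks Ls)). true_cnf K) \<longleftrightarrow>
      (\<exists>K \<in> set Ks. true_cnf K) \<and> (\<exists>K \<in> set Ls. true_cnf K)" for Ks Ls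
    by force
  {
    case 0
    then have "C ! h = Input" using preds_Nil by simp
    then show ?case using inp 0 by blast
  next
    case (Suc e)
    have IH: "(\<exists>K \<in> set (dcnf (Suc e) D s j). true_cnf K) \<longleftrightarrow> v j = s" if "j \<in> set (preds (C ! h))" for s j
    proof -
      have "depth_weft_le C e 2 j" using Suc.prems(2) that depth_weft_le_mono[of C e 1 j e 2] by (auto split: if_splits simp: numeral_2_eq_2)
      then show ?thesis using Suc.IH pred_less[OF Suc.prems(1) that] Suc.prems(1) by simp
    qed
    have IH1: "true_cnf (cnf (Suc e) D s j) \<longleftrightarrow> v j = s" if "j \<in> set (preds (C ! h))" "large (C ! h)" for s j
    proof -
      have "depth_weft_le C e 1 j" using Suc.prems(2) that by (auto split: if_splits simp: numeral_2_eq_2)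
      then show ?thesis using cnf_correct pred_less[OF Suc.prems(1) that(1)] Suc.prems(1) by simp
    qed
    have bex_concat: "(\<exists>K \<in> set (concat (map F js)). true_cnf K) \<longleftrightarrow> (\<exists>j \<in> set js. \<exists>K \<in> set (F j). true_cnf K)" for F js
      by auto
    from Suc.prems(1) show ?case
    proof (cases rule: gate_cases)
      case Input
      then show ?thesis using inp Suc.prems by blast
    next
      case (Neg j)
      then show ?thesis using IH[of j "\<not> s"] v_gate(2)[OF Suc.prems(1) Neg(1)] by (auto simp: dcnf.simps(2)[of "Suc e"])
    next
      case (gate js)
      note v_h = v_signed[OF Suc.prems(1) gate(1), of s]
      consider "(fst (gate_at D h) = 2) \<noteq> s" | "(fst (gate_at D h) = 2) = s" "large (C ! h)" | "(fst (gate_at D h) = 2) = s" "\<not> large (C ! h)" by blast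
      then show ?thesis
      proof cases
        case 1
        then show ?thesis using gate v_h IH by (simp add: dcnf.simps(2)[of "Suc e"] bex_concat del: set_concat)
      next
        case 2
        then show ?thesis using gate v_h IH1 by (simp add: dcnf.simps(2)[of "Suc e"])
      next
        case 3
        obtain a b where ab: "js = [a, b]" using gate_two[OF Suc.prems(1) gate(1) 3(2)] by metis
        show ?thesis using 3 gate v_h IH[of a] IH[of b] ab
          by (simp add: dcnf.simps(2)[of "Suc e"] product del: set_map set_product)
      qed
    qed
  }
qed

end

text \<open>A large disjunction uses up the weft, so its children have weft zero.
  \<open>forced_complete\<close> needs this for the literals.\<close>

lemma cnf_atoms: "h < nc \<Longrightarrow> depth_weft_le C e 1 h \<Longrightarrow> c \<in> set (cnf (Suc e) D s h) \<Longrightarrow> at \<in> set c \<Longrightarrow> fst at < nc \<and> depth_weft_le C e 0 (fst at)"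
proof (induction e arbitrary: s h c)
  have inp: "fst at < nc \<and> depth_weft_le C e 0 (fst at)" if "h < nc" "C ! h = Input" "c \<in> set (cnf (Suc e) D s h)" "at \<in> set c" for e s h c
  proof -
    have "depth_weft_le C 0 0 h" using that by simp
    then have "depth_weft_le C e 0 h" by (rule depth_weft_le_mono) auto
    moreover have "at = (h, s)" using that gate_at_D[of h] by (auto simp: cnf.simps(2) dcnf.simps(2))
    ultimately show ?thesis using that by simp
  qed
  {
    case 0
    then have "C ! h = Input" using preds_Nil by simp
    then show ?case using inp 0 by blast
  next
    case (Suc e)
    have IH: "fst at < nc \<and> depth_weft_le C (Suc e) 0 (fst at)"
      if "j \<in> set (preds (C ! h))" "c \<in> set (cnf (Suc e) D s j)" "at \<in> set c" for s j c
    proof -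
      have "depth_weft_le C e 1 j" using Suc.prems(2) that depth_weft_le_mono[of C e 0 j e 1] by (auto split: if_splits)
      then have "fst at < nc \<and> depth_weft_le C e 0 (fst at)" using Suc.IH[of j c s] pred_less[OF Suc.prems(1) that(1)] Suc.prems(1) that by simp
      then show ?thesis using depth_weft_le_mono by (metis le_refl lessI less_imp_le)
    qed
    have L: "j < nc \<and> depth_weft_le C (Suc e) 0 j" if "j \<in> set (preds (C ! h))" "large (C ! h)" for j
    proof -
      have "depth_weft_le C e 0 j" using Suc.prems(2) that by (auto split: if_splits)
      then have "depth_weft_le C (Suc e) 0 j" by (rule depth_weft_le_mono) auto
      then show ?thesis using pred_less[OF Suc.prems(1) that(1)] Suc.prems(1) by simp
    qed
    from Suc.prems(1) show ?case
    proof (cases rule: gate_cases)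
      case Input
      then show ?thesis using inp Suc.prems by blast
    next
      case (Neg j)
      then show ?thesis using IH[of j c] Suc.prems(3,4) by (auto simp: cnf.simps(2)[of "Suc e"] simp del: depth_weft_le.simps)
    next
      case (gate js)
      consider "(fst (gate_at D h) = 2) = s" | "(fst (gate_at D h) = 2) \<noteq> s" "large (C ! h)" | "(fst (gate_at D h) = 2) \<noteq> s" "\<not> large (C ! h)" by blast
      then show ?thesis
      proof cases
        case 1
        then obtain j where "j \<in> set js" "c \<in> set (cnf (Suc e) D s j)" using gate Suc.prems(3) by (auto simp: cnf.simps(2)[of "Suc e"])
        then show ?thesis using IH gate(5) Suc.prems(4) by (simp del: depth_weft_le.simps)
      next
        case 2
        then have "c = map (\<lambda>j. (j, s)) js" using gate Suc.prems(3) by (simp add: cnf.simps(2)[of "Suc e"])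
        then show ?thesis using L 2 gate(5) Suc.prems(4) by (auto simp del: depth_weft_le.simps)
      next
        case 3
        obtain a b where ab: "js = [a, b]" using gate_two[OF Suc.prems(1) gate(1) 3(2)] by metis
        then have "c \<in> set (map (\<lambda>z. fst z @ snd z) (List.product (cnf (Suc e) D s a) (cnf (Suc e) D s b)))"
          using 3 gate Suc.prems(3) by (simp add: cnf.simps(2)[of "Suc e"])
        then obtain z where z: "c = fst z @ snd z" "z \<in> set (cnf (Suc e) D s a) \<times> set (cnf (Suc e) D s b)"
          unfolding set_map set_product by (rule imageE)
        then show ?thesis using IH[of a "fst z"] IH[of b "snd z"] gate(5) ab Suc.prems(4) by (auto simp: mem_Times_iff simp del: depth_weft_le.simps)
      qed
    qed
  }
qed

lemma dcnf_atoms: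
  "h < nc \<Longrightarrow> depth_weft_le C e 2 h \<Longrightarrow> K \<in> set (dcnf (Suc e) D s h) \<Longrightarrow> c \<in> set K \<Longrightarrow> at \<in> set c \<Longrightarrow> fst at < nc \<and> depth_weft_le C e 0 (fst at)"
proof (induction e arbitrary: s h K)
  have inp: "fst at < nc \<and> depth_weft_le C e 0 (fst at)"
    if "h < nc" "C ! h = Input" "K \<in> set (dcnf (Suc e) D s h)" "c \<in> set K" "at \<in> set c" for e s h K
  proof -
    have "depth_weft_le C 0 0 h" using that by simp
    then have "depth_weft_le C e 0 h" by (rule depth_weft_le_mono) auto
    moreover have "at = (h, s)" using that gate_at_D[of h] by (auto simp: cnf.simps(2) dcnf.simps(2))
    ultimately show ?thesis using that by simp
  qed
  {
    case 0
    then have "C ! h = Input" using preds_Nil by simp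
    then show ?case using inp 0 by blast
  next
    case (Suc e)
    have IH: "fst at < nc \<and> depth_weft_le C (Suc e) 0 (fst at)"
      if "j \<in> set (preds (C ! h))" "K \<in> set (dcnf (Suc e) D s j)" "c \<in> set K" for s j K
    proof -
      have "depth_weft_le C e 2 j" using Suc.prems(2) that depth_weft_le_mono[of C e 1 j e 2] by (auto split: if_splits simp: numeral_2_eq_2)
      then have "fst at < nc \<and> depth_weft_le C e 0 (fst at)"
        using Suc.IH[of j K s] pred_less[OF Suc.prems(1) that(1)] Suc.prems(1,5) that by simp
      then show ?thesis using depth_weft_le_mono by (metis le_refl lessI less_imp_le)
    qed
    have L: "fst at < nc \<and> depth_weft_le C (Suc e) 0 (fst at)"
      if "j \<in> set (preds (C ! h))" "large (C ! h)" "c \<in> set (cnf (Suc e) D s j)" for s j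
    proof -
      have "depth_weft_le C e 1 j" using Suc.prems(2) that by (auto split: if_splits simp: numeral_2_eq_2)
      then have "fst at < nc \<and> depth_weft_le C e 0 (fst at)"
        using cnf_atoms[of j e c s at] pred_less[OF Suc.prems(1) that(1)] Suc.prems that by simp
      then show ?thesis using depth_weft_le_mono by (metis le_refl lessI less_imp_le)
    qed
    from Suc.prems(1) show ?case
    proof (cases rule: gate_cases)
      case Input
      then show ?thesis using inp Suc.prems by blast
    next
      case (Neg j)
      then show ?thesis using IH[of j K] Suc.prems(3,4) by (auto simp: dcnf.simps(2)[of "Suc e"] simp del: depth_weft_le.simps)
    next
      case (gate js)
      consider "(fst (gate_at D h) = 2) \<noteq> s" | "(fst (gate_at D h) = 2) = s" "large (C ! h)" | "(fst (gate_at D h) = 2) = s" "\<not> large (C ! h)" by blast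
      then show ?thesis
      proof cases
        case 1
        then obtain j where "j \<in> set js" "K \<in> set (dcnf (Suc e) D s j)" using gate Suc.prems(3) by (auto simp: dcnf.simps(2)[of "Suc e"])
        then show ?thesis using IH gate(5) Suc.prems(4) by (simp del: depth_weft_le.simps)
      next
        case 2
        then have "K = concat (map (\<lambda>j. cnf (Suc e) D s j) js)" using gate Suc.prems(3) by (simp add: dcnf.simps(2)[of "Suc e"])
        then obtain j where "j \<in> set js" "c \<in> set (cnf (Suc e) D s j)" using Suc.prems(4) by auto
        then show ?thesis using L 2 gate(5) by (simp del: depth_weft_le.simps)
      next
        case 3
        obtain a b where ab: "js = [a, b]" using gate_two[OF Suc.prems(1) gate(1) 3(2)] by metis
        then have "K \<in> set (map (\<lambda>z. fst z @ snd z) (List.product (dcnf (Suc e) D s a) (dcnf (Suc e) D s b)))"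
          using 3 gate Suc.prems(3) by (simp add: dcnf.simps(2)[of "Suc e"])
        then obtain z where z: "K = fst z @ snd z" "z \<in> set (dcnf (Suc e) D s a) \<times> set (dcnf (Suc e) D s b)"
          unfolding set_map set_product by (rule imageE)
        then show ?thesis using IH[of a "fst z"] IH[of b "snd z"] gate(5) ab Suc.prems(4) by (auto simp: mem_Times_iff simp del: depth_weft_le.simps)
      qed
    qed
  }
qed

end

subsection \<open>The hitting set instance\<close>

text \<open>Every block must be hit and the budget equals the number of blocks, so a hitting set is
  the graph of a selection \<open>\<sigma>\<close>. The remaining rows then state arbitrary
  disjunctions about the selected elements.\<close>

lemma hittable_blocks:
  fixes Bl :: "'b list" and Vs :: "'v list" and \<Phi> :: "('b \<times> 'v \<Rightarrow> bool) list"
  defines "U \<equiv> List.product Bl Vs"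
  defines "rows \<equiv> map (\<lambda>I. map (\<lambda>z. fst z = I) U) Bl @ map (\<lambda>\<phi>. map \<phi> U) \<Phi>"
  assumes Bl: "distinct Bl"
  shows "hittable (length U) rows (length Bl) \<longleftrightarrow>
    (\<exists>\<sigma>. (\<forall>I \<in> set Bl. \<sigma> I \<in> set Vs) \<and> (\<forall>\<phi> \<in> set \<Phi>. \<exists>I \<in> set Bl. \<phi> (I, \<sigma> I)))"
proof
  assume "hittable (length U) rows (length Bl)"
  then obtain H where H: "H \<subseteq> {..<length U}" "card H \<le> length Bl" "\<forall>row \<in> set rows. \<exists>u \<in> H. row ! u"
    by (auto simp: hittable_def)
  have "\<forall>I. \<exists>u. I \<in> set Bl \<longrightarrow> u \<in> H \<and> fst (U ! u) = I"
  proof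
    fix I
    show "\<exists>u. I \<in> set Bl \<longrightarrow> u \<in> H \<and> fst (U ! u) = I"
    proof (cases "I \<in> set Bl")
      case True
      then have "map (\<lambda>z. fst z = I) U \<in> set rows" by (auto simp: rows_def)
      then obtain u where "u \<in> H" "map (\<lambda>z. fst z = I) U ! u" using H(3) by blast
      then show ?thesis using H(1) by (intro exI[of _ u]) auto
    qed simp
  qed
  then obtain pick where pick: "\<And>I. I \<in> set Bl \<Longrightarrow> pick I \<in> H \<and> fst (U ! pick I) = I" by metis
  have "inj_on pick (set Bl)" using pick by (metis inj_onI)
  then have "card (pick ` set Bl) = length Bl" by (simp add: card_image distinct_card[OF Bl])
  moreover have "pick ` set Bl \<subseteq> H" using pick by blast
  moreover have "finite H" using H(1) finite_subset by blast
  \<comment> \<open>No budget remains beyond one element per block.\<close>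
  ultimately have Heq: "pick ` set Bl = H" using H(2) card_seteq by metis
  define \<sigma> where "\<sigma> I = snd (U ! pick I)" for I
  have Upick: "U ! pick I = (I, \<sigma> I)" "(I, \<sigma> I) \<in> set U" if "I \<in> set Bl" for I
  proof -
    show "U ! pick I = (I, \<sigma> I)" using pick[OF that] by (metis \<sigma>_def prod.collapse)
    then show "(I, \<sigma> I) \<in> set U" using pick[OF that] H(1) by (metis lessThan_iff nth_mem subset_iff)
  qed
  have "\<exists>I \<in> set Bl. \<phi> (I, \<sigma> I)" if "\<phi> \<in> set \<Phi>" for \<phi>
  proof -
    have "map \<phi> U \<in> set rows" using that unfolding rows_def by auto
    then obtain u where u: "u \<in> H" "map \<phi> U ! u" using H(3) by blast
    then obtain I where I: "I \<in> set Bl" "u = pick I" using Heq by blast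
    have "\<phi> (U ! u)" using u H(1) by auto
    then show ?thesis using I Upick by auto
  qed
  moreover have "\<sigma> I \<in> set Vs" if "I \<in> set Bl" for I using Upick(2)[OF that] by (simp add: U_def)
  ultimately show "\<exists>\<sigma>. (\<forall>I \<in> set Bl. \<sigma> I \<in> set Vs) \<and> (\<forall>\<phi> \<in> set \<Phi>. \<exists>I \<in> set Bl. \<phi> (I, \<sigma> I))" by blast
next
  assume "\<exists>\<sigma>. (\<forall>I \<in> set Bl. \<sigma> I \<in> set Vs) \<and> (\<forall>\<phi> \<in> set \<Phi>. \<exists>I \<in> set Bl. \<phi> (I, \<sigma> I))"
  then obtain \<sigma> where \<sigma>: "\<And>I. I \<in> set Bl \<Longrightarrow> \<sigma> I \<in> set Vs" "\<And>\<phi>. \<phi> \<in> set \<Phi> \<Longrightarrow> \<exists>I \<in> set Bl. \<phi> (I, \<sigma> I)" by blast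
  have "\<forall>I. \<exists>u. I \<in> set Bl \<longrightarrow> u < length U \<and> U ! u = (I, \<sigma> I)"
  proof
    fix I
    have "I \<in> set Bl \<Longrightarrow> (I, \<sigma> I) \<in> set U" using \<sigma>(1) by (simp add: U_def)
    then show "\<exists>u. I \<in> set Bl \<longrightarrow> u < length U \<and> U ! u = (I, \<sigma> I)" by (metis in_set_conv_nth)
  qed
  then obtain pick where pick: "\<And>I. I \<in> set Bl \<Longrightarrow> pick I < length U \<and> U ! pick I = (I, \<sigma> I)" by metis
  show "hittable (length U) rows (length Bl)"
    unfolding hittable_def
  proof (intro exI[of _ "pick ` set Bl"] conjI ballI)
    show "pick ` set Bl \<subseteq> {..<length U}" using pick by auto
    show "card (pick ` set Bl) \<le> length Bl" by (metis card_image_le card_length finite_set le_trans)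
    fix row assume "row \<in> set rows"
    then consider I where "I \<in> set Bl" "row = map (\<lambda>z. fst z = I) U" | \<phi> where "\<phi> \<in> set \<Phi>" "row = map \<phi> U"
      by (auto simp: rows_def)
    then show "\<exists>u \<in> pick ` set Bl. row ! u"
    proof cases
      case 1
      then have "row ! pick I" using pick[of I] by simp
      then show ?thesis using 1 by blast
    next
      case 2
      then obtain I where I: "I \<in> set Bl" "\<phi> (I, \<sigma> I)" using \<sigma>(2) by blast
      then have "row ! pick I" using pick[of I] 2 by simp
      then show ?thesis using I by blast
    qed
  qed
qed

type_synonym triple = "nat \<times> nat \<times> nat"
type_synonym choice = "nat list \<times> nat \<times> triple list"

text \<open>The \<open>k + 1\<close> slots are the gaps around \<open>k\<close> true inputs. Slots
  may repeat within a block, so shorter witnesses can be padded.\<close>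

definition blocks :: "nat \<Rightarrow> nat \<Rightarrow> nat list list" where
  "blocks r k = List.n_lists r [0..<Suc k]"

text \<open>End points range over the left end \<open>0\<close>, the shifted nodes \<open>1\<close>
  to \<open>l\<close>, and the right end \<open>l + 1\<close>.\<close>

definition triples :: "nat \<Rightarrow> nat \<Rightarrow> triple list" where
  "triples k l = List.product [0..<Suc k] (List.product [0..<l + 2] [0..<l + 2])"

text \<open>
  A block is a list of \<open>r\<close> slots.  Its value selects one of the \<open>N\<close> conjunctive normal forms, the index \<open>N\<close> being
  an invalid dummy that keeps all rows non-empty, and a triple for every slot of the block.
\<close>

definition vals :: "nat \<Rightarrow> nat \<Rightarrow> nat \<Rightarrow> nat \<Rightarrow> (nat \<times> triple list) list" where
  "vals r k l N = List.product [0..<Suc N] (List.n_lists r (triples k l))"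

text \<open>Triples that fit pairwise chain up: neighbouring slots share an end point, slot
  \<open>0\<close> begins at the left end, slot \<open>k\<close> stops at the right end, and every
  other left end is an input.\<close>

definition fits :: "nat \<Rightarrow> (nat \<times> nat list) list \<Rightarrow> triple \<Rightarrow> triple \<Rightarrow> bool" where
  "fits k D x y \<longleftrightarrow> (fst x = fst y \<longrightarrow> snd x = snd y) \<and> (fst y = Suc (fst x) \<longrightarrow> snd (snd x) = fst (snd y)) \<and>
    fst (snd x) < snd (snd x) \<and> (fst x = 0 \<longrightarrow> fst (snd x) = 0) \<and> (fst x = k \<longrightarrow> snd (snd x) = Suc (length D)) \<and>
    (fst x \<noteq> 0 \<longrightarrow> fst (snd x) \<noteq> 0 \<and> fst (gate_at D (fst (snd x) - 1)) = 0)"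

text \<open>The conditions on \<open>e\<close> alone make an invalid element, such as one with the
  dummy index, incompatible with itself, so that it is never selected.\<close>

definition compat :: "nat \<Rightarrow> (nat \<times> nat list) list \<Rightarrow> nat \<Rightarrow> choice \<Rightarrow> choice \<Rightarrow> bool" where
  "compat k D N e e' \<longleftrightarrow> fst (snd e) = fst (snd e') \<and> fst (snd e) < N \<and> map fst (snd (snd e)) = fst e \<and>
    (\<forall>x \<in> set (snd (snd e)). \<forall>y \<in> set (snd (snd e')). fits k D x y)"

text \<open>A positive form of "not both selected": one of the two blocks holds another
  value.\<close>

definition conflict_pred :: "choice \<times> choice \<Rightarrow> choice \<Rightarrow> bool" where
  "conflict_pred ee z \<longleftrightarrow> (fst z = fst (fst ee) \<and> snd z \<noteq> snd (fst ee)) \<or> (fst z = fst (snd ee) \<and> snd z \<noteq> snd (snd ee))"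

text \<open>All blocks agree on the chosen normal form, so the clauses of the other forms are met by
  every block.\<close>

definition clause_pred :: "nat \<Rightarrow> (nat \<times> nat list) list \<Rightarrow> nat \<times> (nat \<times> bool) list \<Rightarrow> choice \<Rightarrow> bool" where
  "clause_pred d D gc z \<longleftrightarrow> fst (snd z) \<noteq> fst gc \<or>
    (\<exists>at \<in> set (snd gc). forced (Suc d) D (snd (snd z)) (snd at) (fst at))"

definition circuit_cnfs :: "nat \<Rightarrow> (nat \<times> nat list) list \<Rightarrow> (nat \<times> bool) list list list" where
  "circuit_cnfs d D = dcnf (Suc d) D True (length D - 1)"

definition indexed_clauses :: "(nat \<times> bool) list list list \<Rightarrow> (nat \<times> (nat \<times> bool) list) list" where
  "indexed_clauses Ks = concat (map (\<lambda>g. map (\<lambda>c. (g, c)) (get [] Ks g)) [0..<length Ks])"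

definition choices :: "nat \<Rightarrow> (nat \<times> nat list) list \<Rightarrow> nat \<Rightarrow> choice list" where
  "choices d D k = List.product (blocks (2 ^ d) k) (vals (2 ^ d) k (length D) (length (circuit_cnfs d D)))"

definition circuit_rows :: "nat \<Rightarrow> (nat \<times> nat list) list \<Rightarrow> nat \<Rightarrow> bool list list" where
  "circuit_rows d D k =
    map (\<lambda>I. map (\<lambda>z. fst z = I) (choices d D k)) (blocks (2 ^ d) k) @
    map (\<lambda>ee. map (\<lambda>z. conflict_pred ee z) (choices d D k))
      (filter (\<lambda>ee. \<not> compat k D (length (circuit_cnfs d D)) (fst ee) (snd ee)) (List.product (choices d D k) (choices d D k))) @
    map (\<lambda>gc. map (\<lambda>z. clause_pred d D gc z) (choices d D k)) (indexed_clauses (circuit_cnfs d D))"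

lemma set_blocks: "set (blocks r k) = {I. length I = r \<and> (\<forall>i \<in> set I. i \<le> k)}"
  by (auto simp: blocks_def set_n_lists less_Suc_eq_le simp del: upt_Suc)

lemma length_blocks: "length (blocks r k) = Suc k ^ r"
  by (simp add: blocks_def length_n_lists)

lemma distinct_blocks: "distinct (blocks r k)"
  by (simp add: blocks_def distinct_n_lists)

lemma set_triples: "(i, a, b) \<in> set (triples k l) \<longleftrightarrow> i \<le> k \<and> a < l + 2 \<and> b < l + 2"
  by (auto simp: triples_def less_Suc_eq_le simp del: upt_Suc)

lemma set_vals: "(g, p) \<in> set (vals r k l N) \<longleftrightarrow> g \<le> N \<and> length p = r \<and> set p \<subseteq> set (triples k l)"
  by (auto simp: vals_def set_n_lists less_Suc_eq_le simp del: upt_Suc)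

lemma set_indexed_clauses: "(g, c) \<in> set (indexed_clauses Ks) \<longleftrightarrow> g < length Ks \<and> c \<in> set (Ks ! g)"
  by (auto simp: indexed_clauses_def)

context wcircuit
begin

context
  fixes d k :: nat
  assumes weft: "weft C \<le> 2" and depth: "depth C \<le> d"
begin

abbreviation "r \<equiv> (2::nat) ^ d"
abbreviation "Ks \<equiv> circuit_cnfs d D"
abbreviation "N \<equiv> length Ks"
abbreviation "Bl \<equiv> blocks r k"
abbreviation "Vs \<equiv> vals r k nc N"
abbreviation "U \<equiv> choices d D k"
abbreviation "rows \<equiv> circuit_rows d D k"

definition preds_list :: "(choice \<Rightarrow> bool) list" where
  "preds_list = map conflict_pred (filter (\<lambda>ee. \<not> compat k D N (fst ee) (snd ee)) (List.product U U)) @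
    map (clause_pred d D) (indexed_clauses Ks)"

lemma U_eq: "U = List.product Bl Vs"
  by (simp add: choices_def)

lemma rows_eq: "rows = map (\<lambda>I. map (\<lambda>z. fst z = I) U) Bl @ map (\<lambda>\<phi>. map \<phi> U) preds_list"
  by (simp add: circuit_rows_def preds_list_def o_def)

lemma output_depth_weft: "depth_weft_le C d 2 (nc - 1)"
  using depth_weft_le_output weft depth by simp

lemma output_true_iff:
  assumes "valuation C A v"
  shows "(\<exists>g < N. true_cnf v (Ks ! g)) \<longleftrightarrow> v (nc - 1)"
proof -
  have "(\<exists>K \<in> set (dcnf (Suc d) D True (nc - 1)). true_cnf v K) \<longleftrightarrow> v (nc - 1) = True"
    by (rule dcnf_correct[OF assms _ output_depth_weft]) (use nc_pos in simp)
  then show ?thesis by (simp add: circuit_cnfs_def set_conv_nth) blast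
qed

lemma Ks_atoms:
  assumes "g < N" "c \<in> set (Ks ! g)" "at \<in> set c"
  shows "fst at < nc \<and> depth_weft_le C d 0 (fst at)"
proof (rule dcnf_atoms[OF _ output_depth_weft _ assms(2,3)])
  show "Ks ! g \<in> set (dcnf (Suc d) D True (nc - 1))" using assms(1) by (simp add: circuit_cnfs_def)
qed (use nc_pos in simp)

text \<open>Pairwise compatibility makes the union of all selected triples a function from slots to
  intervals in increasing order; the inner end points are the assignment.\<close>

lemma selection_to_assignment:
  assumes \<sigma>: "\<forall>I \<in> set Bl. \<sigma> I \<in> set Vs" "\<forall>\<phi> \<in> set preds_list. \<exists>I \<in> set Bl. \<phi> (I, \<sigma> I)"
  shows "\<exists>A \<subseteq> inputs C. card A = k \<and> satisfies A C"
proof -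
  have mem_U: "(I, \<sigma> I) \<in> set U" if "I \<in> set Bl" for I using \<sigma>(1) that by (simp add: U_eq)
  have compat: "compat k D N (I, \<sigma> I) (I', \<sigma> I')" if "I \<in> set Bl" "I' \<in> set Bl" for I I'
  proof (rule ccontr)
    assume "\<not> ?thesis"
    then have "conflict_pred ((I, \<sigma> I), (I', \<sigma> I')) \<in> set preds_list"
      using mem_U that by (auto simp: preds_list_def)
    then obtain J where "conflict_pred ((I, \<sigma> I), (I', \<sigma> I')) (J, \<sigma> J)" using \<sigma>(2) by blast
    then show False by (auto simp: conflict_pred_def)
  qed
  define T where "T = (\<Union>I \<in> set Bl. set (snd (\<sigma> I)))"
  define g where "g = fst (\<sigma> (replicate r 0))"
  have rep: "replicate r i \<in> set Bl" if "i \<le> k" for i using that by (simp add: set_blocks)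
  have g: "g < N" "fst (\<sigma> I) = g" if "I \<in> set Bl" for I
    using compat[OF that rep[of 0]] by (auto simp: compat_def g_def)
  have fits: "fits k D x y" if "x \<in> T" "y \<in> T" for x y
    using that compat by (auto simp: T_def compat_def)
  have slots: "map fst (snd (\<sigma> I)) = I" if "I \<in> set Bl" for I
    using compat[OF that that] by (simp add: compat_def)
  have T_dom: "i \<le> k \<and> a < nc + 2 \<and> b < nc + 2" if t: "(i, a, b) \<in> T" for i a b
  proof -
    obtain I where I: "I \<in> set Bl" "(i, a, b) \<in> set (snd (\<sigma> I))" using t by (auto simp: T_def)
    then have "(fst (\<sigma> I), snd (\<sigma> I)) \<in> set Vs" using \<sigma>(1) by simp
    then have "(i, a, b) \<in> set (triples k nc)" using I(2) unfolding set_vals by blast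
    then show ?thesis unfolding set_triples .
  qed
  have "\<exists>ab. (i, ab) \<in> T" if "i \<le> k" for i
  proof -
    have "i \<in> set (map fst (snd (\<sigma> (replicate r i))))" using slots[OF rep[OF that]] by simp
    then obtain x where x: "x \<in> set (snd (\<sigma> (replicate r i)))" "fst x = i" unfolding set_map by blast
    then have "x \<in> T" using rep[OF \<open>i \<le> k\<close>] unfolding T_def by blast
    then show ?thesis using x(2) by (metis prod.collapse)
  qed
  then obtain ab where ab: "\<And>i. i \<le> k \<Longrightarrow> (i, ab i) \<in> T" by metis
  define \<alpha> \<beta> where "\<alpha> i = fst (ab i)" and "\<beta> i = snd (ab i)" for i
  have T: "(i, \<alpha> i, \<beta> i) \<in> T" if "i \<le> k" for i using ab[OF that] by (simp add: \<alpha>_def \<beta>_def)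
  have T_fun: "a = \<alpha> i \<and> b = \<beta> i" if "(i, a, b) \<in> T" for i a b
    using fits[OF that T[of i]] T_dom[OF that] by (auto simp: fits_def)
  have less: "\<alpha> i < \<beta> i" "i = 0 \<longrightarrow> \<alpha> i = 0" "i \<noteq> 0 \<longrightarrow> \<alpha> i \<noteq> 0 \<and> fst (gate_at D (\<alpha> i - 1)) = 0"
    if "i \<le> k" for i using fits[OF T[OF that] T[OF that]] by (auto simp: fits_def)
  have succ: "\<beta> i = \<alpha> (Suc i)" if "Suc i \<le> k" for i using fits[OF T[of i] T[of "Suc i"]] that by (auto simp: fits_def)
  have mono: "\<alpha> i < \<alpha> j" if "i < j" "j \<le> k" for i j
    using that
  proof (induction j)
    case (Suc j)
    have "\<alpha> j < \<alpha> (Suc j)" using less(1)[of j] succ[of j] Suc.prems by simp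
    then show ?case using Suc by (cases "i = j") auto
  qed simp
  \<comment> \<open>Slot \<open>0\<close> starts at the left end, so the members are the left ends
    of the slots \<open>1\<close> to \<open>k\<close>, shifted back by one.\<close>
  define A where "A = (\<lambda>i. \<alpha> i - 1) ` {1..k}"
  have pos: "\<alpha> i \<ge> 1" if "i \<in> {1..k}" for i using less(3)[of i] that by auto
  have "inj_on (\<lambda>i. \<alpha> i - 1) {1..k}"
  proof (rule inj_onI)
    fix i j assume ij: "i \<in> {1..k}" "j \<in> {1..k}" "\<alpha> i - 1 = \<alpha> j - 1"
    then have "\<alpha> i = \<alpha> j" using pos[OF ij(1)] pos[OF ij(2)] by linarith
    then show "i = j" using mono[of i j] mono[of j i] ij by (cases i j rule: linorder_cases) auto
  qed
  then have cardA: "card A = k" by (simp add: A_def card_image)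
  have AI: "A \<subseteq> inputs C"
  proof
    fix h assume "h \<in> A"
    then obtain i where i: "i \<in> {1..k}" "h = \<alpha> i - 1" by (auto simp: A_def)
    have "\<alpha> i < \<beta> i" "\<beta> i < nc + 2" using less(1)[of i] T_dom[OF T[of i]] i by auto
    then have "h < nc" using i pos[OF i(1)] by simp
    moreover have "fst (gate_at D h) = 0" using less(3)[of i] i by auto
    then have "C ! h = Input" using gate_at_D[OF \<open>h < nc\<close>] by (cases "C ! h") auto
    ultimately show "h \<in> inputs C" by (simp add: inputs_def)
  qed
  have sound: "(a = Suc h \<longrightarrow> h \<in> A) \<and> (a < Suc h \<and> Suc h < b \<longrightarrow> h \<notin> A)" if "(i, a, b) \<in> T" for i a b h
  proof
    have i: "i \<le> k" "a = \<alpha> i" "b = \<beta> i" using T_dom[OF that] T_fun[OF that] by auto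
    show "a = Suc h \<longrightarrow> h \<in> A"
    proof
      assume "a = Suc h"
      then have "i \<in> {1..k}" using i less(2)[of i] by (cases i) auto
      then show "h \<in> A" using i \<open>a = Suc h\<close> by (auto simp: A_def image_iff intro!: bexI[of _ i])
    qed
    \<comment> \<open>By monotonicity no left end lies strictly between those of consecutive slots,
      and none lies beyond that of the last slot.\<close>
    show "a < Suc h \<and> Suc h < b \<longrightarrow> h \<notin> A"
    proof (intro impI notI)
      assume h: "a < Suc h \<and> Suc h < b" "h \<in> A"
      then obtain j where j: "j \<in> {1..k}" "h = \<alpha> j - 1" by (auto simp: A_def)
      then have hj: "Suc h = \<alpha> j" using pos[OF j(1)] by simp
      show False
      proof (cases "j \<le> i")
        case True
        then have "\<alpha> j \<le> \<alpha> i" using mono[of j i] i by (cases "j = i") auto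
        then show False using h hj i by simp
      next
        case False
        then have "\<alpha> (Suc i) \<le> \<alpha> j" using mono[of "Suc i" j] j by (cases "Suc i = j") auto
        moreover have "\<beta> i = \<alpha> (Suc i)" using succ[of i] False j by simp
        ultimately show False using h hj i by simp
      qed
    qed
  qed
  obtain v where v: "valuation C A v" using valuation_ex by blast
  have "true_cnf v (Ks ! g)"
    unfolding true_cnf_def[OF v] true_clause_def[OF v]
  proof
    fix c assume c: "c \<in> set (Ks ! g)"
    have gN: "g < N" using g(1)[OF rep[of 0]] by simp
    then have "clause_pred d D (g, c) \<in> set preds_list" using c by (auto simp: preds_list_def set_indexed_clauses)
    then obtain I where I: "I \<in> set Bl" "clause_pred d D (g, c) (I, \<sigma> I)" using \<sigma>(2) by blast
    then obtain at where at: "at \<in> set c" "forced (Suc d) D (snd (\<sigma> I)) (snd at) (fst at)"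
      using g(2)[OF I(1)] by (auto simp: clause_pred_def)
    have "v (fst at) = snd at"
    proof (rule forced_sound[OF v _ _ at(2)])
      show "fst at < nc" using Ks_atoms[OF gN c at(1)] by simp
      fix i a b h assume "(i, a, b) \<in> set (snd (\<sigma> I))"
      then have "(i, a, b) \<in> T" using I(1) unfolding T_def by blast
      then show "(a = Suc h \<longrightarrow> h \<in> A) \<and> (a < Suc h \<and> Suc h < b \<longrightarrow> h \<notin> A)" by (rule sound)
    qed
    then show "\<exists>at \<in> set c. v (fst at) = snd at" using at(1) by blast
  qed
  then have "v (nc - 1)" using output_true_iff[OF v] g(1)[OF rep[of 0]] by blast
  then have "satisfies A C" using v by (auto simp: satisfies_def)
  then show ?thesis using AI cardA by blast
qed

lemma assignment_to_selection:
  assumes A: "A \<subseteq> inputs C" "card A = k" "satisfies A C"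
  shows "\<exists>\<sigma>. (\<forall>I \<in> set Bl. \<sigma> I \<in> set Vs) \<and> (\<forall>\<phi> \<in> set preds_list. \<exists>I \<in> set Bl. \<phi> (I, \<sigma> I))"
proof -
  obtain v where v: "valuation C A v" "v (nc - 1)" using A(3) by (auto simp: satisfies_def)
  then obtain g where g: "g < N" "true_cnf v (Ks ! g)" using output_true_iff[OF v(1)] by blast
  have fin: "finite A" by (rule finite_subset[OF A(1)]) (simp add: inputs_def)
  define xs where "xs = sorted_list_of_set A"
  have xs: "sorted_wrt (<) xs" "set xs = A" "length xs = k" using fin A(2) by (auto simp: xs_def)
  \<comment> \<open>The shifted members framed by both ends; slot \<open>i\<close> is the gap from
    entry \<open>i\<close> to entry \<open>Suc i\<close>.\<close>
  define zs where "zs = 0 # map Suc xs @ [Suc nc]"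
  have A_nc: "h < nc" "C ! h = Input" if "h \<in> A" for h using A(1) that by (auto simp: inputs_def)
  have lz: "length zs = k + 2" by (simp add: zs_def xs)
  have sz: "sorted_wrt (<) zs"
    using xs A_nc by (auto simp: zs_def sorted_wrt_append sorted_wrt_map)
  have zs_less: "zs ! i < zs ! j" if "i < j" "j < k + 2" for i j
    using sorted_wrt_nth_less[OF sz that(1)] that(2) lz by simp
  have zs_set: "z < nc + 2" if "z \<in> set zs" for z using that xs(2) A_nc less_SucI by (fastforce simp: zs_def)
  have zs_mid: "zs ! Suc i = Suc (xs ! i)" if "i < k" for i using that xs(3) by (simp add: zs_def nth_append)
  have zs_end: "zs ! Suc k = Suc nc" using xs(3) by (simp add: zs_def nth_append)
  have zs_0: "zs ! 0 = 0" by (simp add: zs_def)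
  define w where "w i = (i, zs ! i, zs ! Suc i)" for i
  have fits: "fits k D (w i) (w j)" if "i \<le> k" "j \<le> k" for i j
  proof -
    have "fst (gate_at D (zs ! i - 1)) = 0 \<and> zs ! i \<noteq> 0" if i0: "i \<noteq> 0"
    proof -
      obtain i' where i': "i = Suc i'" using i0 not0_implies_Suc by blast
      then have "xs ! i' \<in> A" using \<open>i \<le> k\<close> xs by (metis Suc_le_lessD nth_mem)
      then show ?thesis using zs_mid[of i'] i' \<open>i \<le> k\<close> A_nc[of "xs ! i'"] gate_at_D[of "xs ! i'"] by simp
    qed
    then show ?thesis using that zs_less[of i "Suc i"] zs_end zs_0 by (auto simp: fits_def w_def)
  qed
  have w_triple: "w i \<in> set (triples k nc)" if "i \<le> k" for i
    using that zs_set lz by (simp add: w_def set_triples)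
  define \<sigma> where "\<sigma> I = (g, map w I)" for I
  have dom: "\<forall>I \<in> set Bl. \<sigma> I \<in> set Vs"
    using g(1) w_triple by (auto simp: \<sigma>_def set_vals set_blocks)
  have comp: "compat k D N (I, \<sigma> I) (I', \<sigma> I')" if "I \<in> set Bl" "I' \<in> set Bl" for I I'
    using that g(1) fits by (auto simp: compat_def \<sigma>_def set_blocks w_def[abs_def] o_def)
  have conflict: "\<exists>J \<in> set Bl. conflict_pred (e, e') (J, \<sigma> J)"
    if e: "e \<in> set U" "e' \<in> set U" "\<not> compat k D N e e'" for e e'
  proof (rule ccontr)
    assume none: "\<not> ?thesis"
    have "fst e \<in> set Bl" "fst e' \<in> set Bl" using e by (auto simp: U_eq)
    then have "\<sigma> (fst e) = snd e" "\<sigma> (fst e') = snd e'" using none by (auto simp: conflict_pred_def)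
    then have "compat k D N e e'" using comp[of "fst e" "fst e'"] \<open>fst e \<in> set Bl\<close> \<open>fst e' \<in> set Bl\<close> by simp
    then show False using e by simp
  qed
  have zero: "replicate r 0 \<in> set Bl" by (simp add: set_blocks)
  have slot: "\<exists>i \<in> {0..k}. if h \<in> A then fst (snd (w i)) = Suc h else fst (snd (w i)) < Suc h \<and> Suc h < snd (snd (w i))"
    if h: "h < nc" for h
  proof (cases "h \<in> A")
    case True
    then obtain i where "i < k" "xs ! i = h" using xs by (metis in_set_conv_nth)
    then show ?thesis using True zs_mid[of i] by (intro bexI[of _ "Suc i"]) (auto simp: w_def)
  next
    case False
    have neq: "zs ! i \<noteq> Suc h" if "i < k + 2" for i
    proof -
      have "zs ! i \<in> set zs" using that lz by simp
      then show ?thesis using False xs(2) h by (auto simp: zs_def)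
    qed
    \<comment> \<open>The entries start below \<open>Suc h\<close> and end above it, so they cross
      it in some slot; by \<open>neq\<close> they never hit it.\<close>
    have "\<exists>i \<le> k. zs ! i < Suc h \<and> \<not> zs ! Suc i < Suc h"
    proof (rule ccontr)
      assume "\<not> ?thesis"
      then have step: "zs ! i < Suc h \<Longrightarrow> zs ! Suc i < Suc h" if "i \<le> k" for i using that by blast
      have "zs ! i < Suc h" if "i \<le> Suc k" for i using that by (induction i) (auto simp: zs_0 intro: step)
      then show False using zs_end h by (metis Suc_less_SucD le_refl less_asym)
    qed
    then obtain i where i: "i \<le> k" "zs ! i < Suc h" "\<not> zs ! Suc i < Suc h" by blast
    then have "Suc h < zs ! Suc i" using neq[of "Suc i"] by simp
    then show ?thesis using i False by (intro bexI[of _ i]) (auto simp: w_def)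
  qed
  have clause: "\<exists>J \<in> set Bl. clause_pred d D (g', c) (J, \<sigma> J)" if g': "g' < N" "c \<in> set (Ks ! g')" for g' c
  proof (cases "g' = g")
    case False
    \<comment> \<open>Any block serves, since all of them select \<open>g\<close> and not
      \<open>g'\<close>.\<close>
    then show ?thesis using zero by (intro bexI[of _ "replicate r 0"]) (auto simp: clause_pred_def \<sigma>_def)
  next
    case True
    then obtain at where at: "at \<in> set c" "v (fst at) = snd at"
      using g(2) g'(2) unfolding true_cnf_def[OF v(1)] true_clause_def[OF v(1)] by blast
    have "fst at < nc" "depth_weft_le C d 0 (fst at)" using Ks_atoms[OF g' at(1)] by auto
    then obtain I where I: "set I \<subseteq> {0..k}" "length I \<le> 2 ^ d" "forced (Suc d) D (map w I) (v (fst at)) (fst at)"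
      using forced_complete[OF v(1), of "{0..k}" w "fst at" d] slot by blast
    \<comment> \<open>Padding with slot \<open>0\<close> gives the witness the exact block length;
      by \<open>forced_mono\<close> it keeps forcing the literal.\<close>
    define J where "J = I @ replicate (r - length I) 0"
    have "J \<in> set Bl" using I(1,2) by (auto simp: J_def set_blocks)
    moreover have "forced (Suc d) D (map w J) (snd at) (fst at)"
      using forced_mono[OF I(3), of "map w J"] at(2) by (auto simp: J_def)
    ultimately show ?thesis using at(1) by (intro bexI[of _ J]) (auto simp: clause_pred_def \<sigma>_def)
  qed
  have "\<exists>I \<in> set Bl. \<phi> (I, \<sigma> I)" if \<phi>: "\<phi> \<in> set preds_list" for \<phi>
  proof -
    consider e e' where "e \<in> set U" "e' \<in> set U" "\<not> compat k D N e e'" "\<phi> = conflict_pred (e, e')"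
      | g c where "g < N" "c \<in> set (Ks ! g)" "\<phi> = clause_pred d D (g, c)"
      using \<phi> by (auto simp: preds_list_def set_indexed_clauses)
    then show ?thesis using conflict clause by cases blast+
  qed
  then show ?thesis using dom by blast
qed

lemma circuit_hittable:
  "hittable (length U) rows (Suc k ^ r) \<longleftrightarrow> (\<exists>A \<subseteq> inputs C. card A = k \<and> satisfies A C)"
proof -
  let ?sel = "\<exists>\<sigma>. (\<forall>I \<in> set Bl. \<sigma> I \<in> set Vs) \<and> (\<forall>\<phi> \<in> set preds_list. \<exists>I \<in> set Bl. \<phi> (I, \<sigma> I))"
  have "hittable (length U) rows (length Bl) \<longleftrightarrow> ?sel"
    unfolding rows_eq unfolding U_eq by (rule hittable_blocks[OF distinct_blocks])
  moreover have "?sel \<longleftrightarrow> (\<exists>A \<subseteq> inputs C. card A = k \<and> satisfies A C)"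
  proof
    assume ?sel
    then obtain \<sigma> where "\<forall>I \<in> set Bl. \<sigma> I \<in> set Vs" "\<forall>\<phi> \<in> set preds_list. \<exists>I \<in> set Bl. \<phi> (I, \<sigma> I)" by (elim exE conjE)
    then show "\<exists>A \<subseteq> inputs C. card A = k \<and> satisfies A C" by (rule selection_to_assignment)
  next
    assume "\<exists>A \<subseteq> inputs C. card A = k \<and> satisfies A C"
    then show ?sel by (elim exE conjE) (rule assignment_to_selection)
  qed
  ultimately show ?thesis by (simp only: length_blocks)
qed

text \<open>A conflict row is non-empty because every block has a second value, a clause row because
  of the dummy index \<open>N\<close>.\<close>

lemma circuit_hs_valid: "hs_valid (length U) rows"
proof -
  have zero: "replicate r 0 \<in> set Bl" by (simp add: set_blocks)
  have V: "(x, replicate r (0, a, 0)) \<in> set Vs" if "x \<le> N" "a < nc + 2" for x a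
    using that by (auto simp: set_vals set_triples)
  have lens: "5 \<le> length Vs"
  proof -
    have n1: "1 \<le> nc" using nc_pos by linarith
    \<comment> \<open>A single node already gives three possible end points on each side, hence nine
      triples, more than the five columns required.\<close>
    have "3 * 3 \<le> (nc + 2) * (nc + 2)" by (rule mult_le_mono) (use n1 in auto)
    then have "5 \<le> Suc k * ((nc + 2) * (nc + 2))" by simp
    also have "\<dots> = length (triples k nc) ^ 1" by (simp add: triples_def)
    also have "\<dots> \<le> length (triples k nc) ^ r" by (intro power_increasing) (auto simp: triples_def)
    also have "\<dots> \<le> Suc N * length (triples k nc) ^ r" by simp
    also have "\<dots> = length Vs" by (simp add: vals_def length_n_lists)
    finally show ?thesis .
  qed
  have "Bl \<noteq> []" using zero by auto
  then have "1 \<le> length Bl" by (simp add: Suc_le_eq)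
  have "5 \<le> length U" using mult_le_mono[OF \<open>1 \<le> length Bl\<close> lens] by (simp add: U_eq)
  moreover have "rows \<noteq> []" using zero by (auto simp: rows_eq)
  moreover have "length row = length U \<and> (\<exists>u < length U. row ! u)" if "row \<in> set rows" for row
  proof -
    have ex: "\<exists>u < length U. map \<phi> U ! u" if "z \<in> set U" "\<phi> z" for \<phi> z
    proof -
      obtain u where "u < length U" "U ! u = z" using \<open>z \<in> set U\<close> by (auto simp: in_set_conv_nth)
      then show ?thesis using that by auto
    qed
    have Vne: "\<exists>v' \<in> set Vs. v' \<noteq> v" for v
    proof -
      let ?p = "\<lambda>a. (0, replicate r (0, a, 0)) :: nat \<times> triple list"
      have "?p 0 \<in> set Vs" "?p 1 \<in> set Vs" using V[of 0 0] V[of 0 1] by simp_all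
      moreover have "?p 0 \<noteq> ?p 1" by (simp add: replicate_eq_replicate)
      ultimately show ?thesis by metis
    qed
    from \<open>row \<in> set rows\<close> have "(\<exists>I \<in> set Bl. row = map (\<lambda>z. fst z = I) U) \<or>
        (\<exists>\<phi> \<in> set preds_list. row = map \<phi> U)" unfolding rows_eq by auto
    moreover have "(\<exists>e \<in> set U. \<exists>e' \<in> set U. \<phi> = conflict_pred (e, e')) \<or> (\<exists>g < N. \<exists>c. \<phi> = clause_pred d D (g, c))"
      if "\<phi> \<in> set preds_list" for \<phi>
      using that by (auto simp: preds_list_def set_indexed_clauses)
    ultimately consider I where "I \<in> set Bl" "row = map (\<lambda>z. fst z = I) U"
      | e e' where "e \<in> set U" "e' \<in> set U" "row = map (conflict_pred (e, e')) U"
      | g c where "g < N" "row = map (clause_pred d D (g, c)) U"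
      by metis
    then show ?thesis
    proof cases
      case 1
      obtain v' where "v' \<in> set Vs" using Vne by blast
      then have "(I, v') \<in> set U" using 1 by (simp add: U_eq)
      then show ?thesis using ex[of "(I, v')" "\<lambda>z. fst z = I"] 1 by simp
    next
      case 2
      obtain v' where "v' \<in> set Vs" "v' \<noteq> snd e" using Vne by blast
      then have "(fst e, v') \<in> set U" "conflict_pred (e, e') (fst e, v')" using 2 by (auto simp: U_eq conflict_pred_def)
      then show ?thesis using ex[of "(fst e, v')" "conflict_pred (e, e')"] 2 by simp
    next
      case 3
      have "(N, replicate r (0, 0, 0)) \<in> set Vs" using V by simp
      then have "(replicate r 0, N, replicate r (0, 0, 0)) \<in> set U" using zero by (simp add: U_eq)
      moreover have "clause_pred d D (g, c) (replicate r 0, N, replicate r (0, 0, 0))" using 3 by (simp add: clause_pred_def)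
      ultimately show ?thesis using ex[of "(replicate r 0, N, replicate r (0, 0, 0))" "clause_pred d D (g, c)"] 3 by simp
    qed
  qed
  ultimately show ?thesis unfolding hs_valid_def by blast
qed

end

end

section \<open>The reduction as a polynomial-time function\<close>

lemma ptime_uncurry2:
  assumes "ptime (\<lambda>z. f (fst z) (snd z))" "ptime a" "ptime b"
  shows "ptime (\<lambda>x. f (a x) (b x))"
  using ptime_comp[OF assms(1) ptime_Pair[OF assms(2,3)]] by simp

lemma ptime_uncurry3:
  assumes "ptime (\<lambda>z. f (fst z) (fst (snd z)) (snd (snd z)))" "ptime a" "ptime b" "ptime c"
  shows "ptime (\<lambda>x. f (a x) (b x) (c x))"
  using ptime_comp[OF assms(1) ptime_Pair[OF assms(2) ptime_Pair[OF assms(3,4)]]] by simp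

lemma ptime_uncurry4:
  assumes "ptime (\<lambda>z. f (fst z) (fst (snd z)) (fst (snd (snd z))) (snd (snd (snd z))))" "ptime a" "ptime b" "ptime c" "ptime d"
  shows "ptime (\<lambda>x. f (a x) (b x) (c x) (d x))"
  using ptime_comp[OF assms(1) ptime_Pair[OF assms(2) ptime_Pair[OF assms(3) ptime_Pair[OF assms(4,5)]]]] by simp

subsection \<open>Words as lists of numbers\<close>

fun gate_toks :: "gate \<Rightarrow> nat list" where
  "gate_toks Input = [0]"
| "gate_toks (Neg j) = [1, j]"
| "gate_toks (Conj js) = 2 # length js # js"
| "gate_toks (Disj js) = 3 # length js # js"

lemma enc_nats_untok: "concat (map enc_nat ns) = untok ns"
  by (simp add: untok_def)

lemma enc_circuit_untok: "enc_circuit C = untok (length C # concat (map gate_toks C))"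
proof -
  have "enc_gate g = untok (gate_toks g)" for g by (cases g) (auto simp: enc_list_def enc_nats_untok)
  then have "concat (map enc_gate gs) = untok (concat (map gate_toks gs))" for gs by (induction gs) auto
  then show ?thesis by (simp add: enc_circuit_def enc_list_def)
qed

definition parse_step :: "nat list \<times> (nat \<times> nat list) list \<Rightarrow> nat list \<times> (nat \<times> nat list) list" where
  "parse_step st = (case fst st of [] \<Rightarrow> st | t # ts \<Rightarrow>
    if t = 0 then (ts, (0, []) # snd st)
    else if t = 1 then (drop 1 ts, (1, take 1 ts) # snd st)
    else (case ts of [] \<Rightarrow> ([], snd st) | n # us \<Rightarrow> (drop n us, (t, take n us) # snd st)))"

text \<open>The token list also serves as a clock: every gate takes at least one token, and further
  rounds after the last gate change nothing. The leading token is the number of gates and is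
  skipped.\<close>

definition parse :: "nat list \<Rightarrow> (nat \<times> nat list) list" where
  "parse toks = rev (snd (foldl (\<lambda>st _. parse_step st) (tl toks, []) toks))"

lemma parse_step_gate: "parse_step (gate_toks g @ ts, acc) = (ts, gcode g # acc)"
  by (cases g) (auto simp: parse_step_def)

lemma parse_circuit: "parse (length C # concat (map gate_toks C)) = map gcode C"
proof -
  have fix_Nil: "foldl (\<lambda>st _. parse_step st) ([], acc) us = ([], acc)" for acc and us :: "nat list"
    by (induction us) (auto simp: parse_step_def)
  have *: "foldl (\<lambda>st _. parse_step st) (concat (map gate_toks C), acc) us = ([], rev (map gcode C) @ acc)"
    if "length C \<le> length us" for C acc and us :: "nat list"
    using that
  proof (induction C arbitrary: acc us)
    case Nil then show ?case by (simp add: fix_Nil)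
  next
    case (Cons g C)
    then obtain u us' where "us = u # us'" by (cases us) auto
    then show ?case using Cons by (simp add: parse_step_gate)
  qed
  have "1 \<le> length (gate_toks g)" for g by (cases g) auto
  then have "length C \<le> length (concat (map gate_toks C))" for C
  proof (induction C)
    case (Cons g C)
    then have "length C \<le> length (concat (map gate_toks C))" by blast
    then show ?case using Cons.prems[of g] by simp
  qed simp
  then have "length C \<le> length (length C # concat (map gate_toks C))" by (simp add: le_SucI)
  from *[OF this] show ?thesis by (simp add: parse_def)
qed

lemma gcode_inject: "gcode g = gcode h \<Longrightarrow> g = h"
  by (cases g; cases h) auto

text \<open>Problems are sets of words, so a word must determine its circuit; the parser inverts the
  encoding up to the injective \<open>gcode\<close>.\<close>

lemma enc_circuit_inject: "enc_circuit C = enc_circuit C' \<longleftrightarrow> C = C'"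
proof
  assume "enc_circuit C = enc_circuit C'"
  then have "map gcode C = map gcode C'"
    using parse_circuit[of C] parse_circuit[of C'] by (simp only: enc_circuit_untok untok_inject)
  then show "C = C'" using gcode_inject by (metis inj_onI inj_map_eq_map)
qed simp

lemma ptime_parse_step: "ptime parse_step"
  unfolding parse_step_def by (intro ptime_intros)

lemma ptime_parse: "ptime parse"
proof -
  have "ptime (\<lambda>toks. foldl (\<lambda>st _. parse_step st) (tl toks, []) toks)"
  proof (rule ptime_foldl_additive[where S = "\<lambda>_. 10"])
    have "ptime (\<lambda>z. parse_step (fst (snd z)))" by (rule ptime_comp[OF ptime_parse_step]) (intro ptime_intros)
    then show "ptime (\<lambda>z :: nat list \<times> (nat list \<times> (nat \<times> nat list) list) \<times> nat. parse_step (fst (snd z)))" .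
    fix st :: "nat list \<times> (nat \<times> nat list) list"
    obtain ts acc where st: "st = (ts, acc)" by fastforce
    show "sz (parse_step st) \<le> sz st + 10"
    proof (cases ts)
      case (Cons t us)
      have "sz (take n xs) + sz (drop n xs) = sz xs + 1" for n and xs :: "nat list" by (rule sz_take_drop)
      note td = this
      show ?thesis
      proof (cases us)
        case Nil
        then show ?thesis using Cons st by (simp add: parse_step_def)
      next
        case us: (Cons n vs)
        show ?thesis using Cons st us td[of n vs] td[of 1 us] by (simp add: parse_step_def)
      qed
    qed (simp add: st parse_step_def)
  qed (intro ptime_intros poly_bd_intros)+
  then show ?thesis unfolding parse_def by (intro ptime_rev ptime_snd)
qed

definition edge_toks :: "(nat \<times> nat \<times> nat) list \<Rightarrow> nat list" where
  "edge_toks es = concat (map (\<lambda>e. [fst e, fst (snd e), snd (snd e)]) es)"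

definition hs_toks :: "nat \<Rightarrow> bool list list \<Rightarrow> nat list" where
  "hs_toks n rows = 3 * n * Suc (length rows) # length (hs_edges n rows) # edge_toks (hs_edges n rows) @ [4, 3 * n]"

lemma enc_ccd_untok: "enc_ccd J = untok (order J # length (edge_list J) # edge_toks (edge_list J) @ [num_colors J, cycle_length J])"
proof -
  have "concat (map (\<lambda>(u, v, i). enc_nat u @ enc_nat v @ enc_nat i) es) = untok (edge_toks es)" for es
    by (induction es) (auto simp: edge_toks_def)
  then show ?thesis by (simp add: enc_ccd_def enc_list_def)
qed

lemma enc_ccd_hs: "enc_ccd (hs_instance n rows k) = untok (hs_toks n rows)"
  by (simp only: enc_ccd_untok hs_toks_def) (simp add: hs_instance_def)

lemma edge_toks_inject: "edge_toks es = edge_toks es' \<longleftrightarrow> es = es'"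
proof
  show "edge_toks es = edge_toks es' \<Longrightarrow> es = es'"
  proof (induction es arbitrary: es')
    case Nil then show ?case by (cases es') (auto simp: edge_toks_def)
  next
    case (Cons e es) then show ?case by (cases es') (auto simp: edge_toks_def prod_eq_iff)
  qed
qed simp

lemma ccd_word_inject: "ccd_word J = ccd_word J' \<longleftrightarrow> J = J'"
proof
  assume "ccd_word J = ccd_word J'"
  then have b: "budget J = budget J'" and "enc_ccd J = enc_ccd J'" by (auto simp: ccd_word_def)
  then have "order J # length (edge_list J) # edge_toks (edge_list J) @ [num_colors J, cycle_length J] =
      order J' # length (edge_list J') # edge_toks (edge_list J') @ [num_colors J', cycle_length J']"
    by (simp only: enc_ccd_untok untok_inject)
  then have "order J = order J'" "edge_list J = edge_list J'" "num_colors J = num_colors J'" "cycle_length J = cycle_length J'"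
    by (auto simp: edge_toks_inject)
  then show "J = J'" using b by simp
qed simp

lemma ptime_member: "ptime a \<Longrightarrow> ptime b \<Longrightarrow> ptime c \<Longrightarrow> ptime (\<lambda>x. member (a x) (b x) (c x))"
  unfolding member_def by (intro ptime_intros)

lemma ptime_hs_edges: "ptime a \<Longrightarrow> ptime b \<Longrightarrow> ptime (\<lambda>x. hs_edges (a x) (b x))"
proof (rule ptime_uncurry2[of hs_edges])
  show "ptime (\<lambda>z. hs_edges (fst z) (snd z))"
    unfolding hs_edges_def path_edges_def pair_edges_def chord_edges_def vx_def vy_def vz_def vtx_def nxt_def
    by (intro ptime_intros ptime_member)
qed

lemma ptime_hs_toks: "ptime a \<Longrightarrow> ptime b \<Longrightarrow> ptime (\<lambda>x. hs_toks (a x) (b x))"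
  unfolding hs_toks_def edge_toks_def by (intro ptime_intros ptime_hs_edges)

subsection \<open>Enumerating the cycles\<close>

text \<open>
  The path edges come first, row by row; each pair of consecutive edges \<open>(y, z, _)\<close>, \<open>(z, x, _)\<close>, that is six numbers,
  contributes three vertices to the cycle of its row.
\<close>

definition cycle_toks :: "nat list \<Rightarrow> nat \<Rightarrow> nat \<Rightarrow> nat list" where
  "cycle_toks toks n m = m # concat (map (\<lambda>f. 3 * n # concat (map (\<lambda>u.
    [get 0 toks (2 + (6 * n * f + 6 * u)), get 0 toks (2 + (6 * n * f + (6 * u + 1))), get 0 toks (2 + (6 * n * f + (6 * u + 4)))]) [0..<n])) [0..<m])"

text \<open>Counting replaces division: the last token is the cycle length \<open>3 * n\<close>, and
  the first token, used for the rows, is the order \<open>3 * n * Suc m\<close>.\<close>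

definition column_count :: "nat list \<Rightarrow> nat" where
  "column_count toks = length (filter (\<lambda>i. 3 * i < get 0 (rev toks) 0) [0..<get 0 (rev toks) 0])"

definition row_count :: "nat list \<Rightarrow> nat" where
  "row_count toks = length (filter (\<lambda>i. get 0 (rev toks) 0 * Suc i < get 0 toks 0) [0..<get 0 toks 0])"

lemma ptime_cycle_toks: "ptime (\<lambda>toks. cycle_toks toks (column_count toks) (row_count toks))"
proof -
  have 1: "ptime column_count" "ptime row_count"
    unfolding column_count_def row_count_def by (intro ptime_intros)+
  have "ptime (\<lambda>z. cycle_toks (fst z) (fst (snd z)) (snd (snd z)))"
    unfolding cycle_toks_def by (intro ptime_intros)
  from ptime_uncurry3[of cycle_toks, OF this ptime_id 1] show ?thesis .
qed

lemma length_filter_upt: "m \<le> M \<Longrightarrow> (\<And>i. P i \<longleftrightarrow> i < m) \<Longrightarrow> length (filter P [0..<M]) = m"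
proof -
  assume "m \<le> M" and P: "\<And>i. P i \<longleftrightarrow> i < m"
  have "length (filter P [0..<M]) = card {i. i < M \<and> P i}" by (simp add: length_filter_conv_card cong: conj_cong)
  also have "{i. i < M \<and> P i} = {..<m}" unfolding P using \<open>m \<le> M\<close> by auto
  finally show ?thesis by simp
qed

lemma concat_map_concat: "concat (map f (concat xss)) = concat (map (\<lambda>xs. concat (map f xs)) xss)"
  by (induction xss) auto

lemma nth_concat_uniform:
  assumes "\<And>i. length (F i) = l" "i < n" "j < l"
  shows "concat (map F [0..<n]) ! (l * i + j) = F i ! j"
  using assms(2)
proof (induction n)
  case (Suc n)
  have len: "length (concat (map F [0..<n])) = l * n" for n by (induction n) (auto simp: assms(1))
  show ?case
  proof (cases "i = n")
    case True
    then show ?thesis using len[of n] by (simp add: nth_append)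
  next
    case False
    then have "i < n" using Suc.prems by simp
    then have "l * i + j < l * n" using assms(3) by (metis add_less_cancel_left less_le_trans mult_Suc_right mult_le_mono2 Suc_leI add.commute)
    then show ?thesis using Suc.IH[OF \<open>i < n\<close>] len[of n] by (simp add: nth_append)
  qed
qed simp

context hs
begin

lemma counts: "column_count (hs_toks n rows) = n" "row_count (hs_toks n rows) = m"
proof -
  have last: "get 0 (rev (hs_toks n rows)) 0 = 3 * n" and first: "get 0 (hs_toks n rows) 0 = 3 * n * Suc m"
    by (simp_all add: hs_toks_def get_def)
  show "column_count (hs_toks n rows) = n" unfolding column_count_def last by (rule length_filter_upt) auto
  have "3 * n * Suc i < 3 * n * Suc m \<longleftrightarrow> i < m" for i using n5 by (simp only: mult_less_cancel1) auto
  moreover have "m \<le> 3 * n * Suc m" using n5 mult_le_mono[of 1 "3 * n" m "Suc m"] by linarith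
  ultimately show "row_count (hs_toks n rows) = m" unfolding row_count_def last first by (intro length_filter_upt) auto
qed

text \<open>The offset \<open>2\<close> skips the order and the number of edges; then each column of
  each row takes six tokens, three per edge.\<close>

lemma path_toks:
  assumes "f < m" "u < n" "j < 6"
  shows "2 + (6 * n * f + (6 * u + j)) < length (hs_toks n rows)"
    "hs_toks n rows ! (2 + (6 * n * f + (6 * u + j))) =
      [Y (Suc f) u, Z (Suc f) u, 2, Z (Suc f) u, X (Suc f) (nxt n u), if Suc u = n then 4 else 3] ! j"
proof -
  let ?G = "\<lambda>f u. [Y (Suc f) u, Z (Suc f) u, 2, Z (Suc f) u, X (Suc f) (nxt n u), if Suc u = n then 4 else 3]"
  let ?F = "\<lambda>f. concat (map (?G f) [0..<n])"
  have up: "[1..<Suc m] = map Suc [0..<m]" by (simp add: map_Suc_upt)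
  have P: "edge_toks (path_edges n rows) = concat (map ?F [0..<m])"
    unfolding edge_toks_def path_edges_def up by (simp add: concat_map_concat o_def)
  have lenF: "length (?F f) = 6 * n" for f by (simp add: length_concat o_def sum_list_triv)
  then have len: "length (concat (map ?F [0..<m])) = 6 * n * m" by (simp add: length_concat o_def sum_list_triv)
  have in1: "6 * u + j < 6 * n" using assms by simp
  have "6 * n * f + (6 * u + j) < 6 * n * Suc f" using in1 by simp
  also have "\<dots> \<le> 6 * n * m" using assms(1) by (intro mult_le_mono2) simp
  finally have in2: "6 * n * f + (6 * u + j) < 6 * n * m" .
  have toks: "hs_toks n rows = [3 * n * Suc m, length (hs_edges n rows)] @ concat (map ?F [0..<m]) @
      edge_toks (pair_edges n m) @ edge_toks (chord_edges n m) @ [4, 3 * n]"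
    unfolding hs_toks_def by (simp add: hs_edges_def edge_toks_def P[unfolded edge_toks_def])
  show "2 + (6 * n * f + (6 * u + j)) < length (hs_toks n rows)"
    unfolding toks using in2 len by simp
  have "hs_toks n rows ! (2 + (6 * n * f + (6 * u + j))) = concat (map ?F [0..<m]) ! (6 * n * f + (6 * u + j))"
    unfolding toks using in2 len by (simp add: nth_append)
  also have "\<dots> = ?F f ! (6 * u + j)" by (rule nth_concat_uniform[OF lenF assms(1) in1])
  also have "\<dots> = ?G f u ! j" by (rule nth_concat_uniform) (use assms in auto)
  finally show "hs_toks n rows ! (2 + (6 * n * f + (6 * u + j))) = ?G f u ! j" .
qed

lemma cycle_toks_correct:
  "cycle_toks (hs_toks n rows) n m = m # concat (map (\<lambda>vs. length vs # vs) (map cyc [1..<Suc m]))"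
proof -
  have "concat (map (\<lambda>u. [get 0 (hs_toks n rows) (2 + (6 * n * f + 6 * u)), get 0 (hs_toks n rows) (2 + (6 * n * f + (6 * u + 1))),
      get 0 (hs_toks n rows) (2 + (6 * n * f + (6 * u + 4)))]) [0..<n]) = cyc (Suc f)" if "f < m" for f
    unfolding cyc_def
  proof (intro arg_cong[of _ _ concat] map_cong refl)
    fix u assume "u \<in> set [0..<n]"
    then have u: "u < n" by simp
    show "[get 0 (hs_toks n rows) (2 + (6 * n * f + 6 * u)), get 0 (hs_toks n rows) (2 + (6 * n * f + (6 * u + 1))),
      get 0 (hs_toks n rows) (2 + (6 * n * f + (6 * u + 4)))] = [Y (Suc f) u, Z (Suc f) u, X (Suc f) (nxt n u)]"
      using path_toks[OF that u, of 0] path_toks[OF that u, of 1] path_toks[OF that u, of 4] by simp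
  qed
  then have *: "map (\<lambda>f. 3 * n # concat (map (\<lambda>u. [get 0 (hs_toks n rows) (2 + (6 * n * f + 6 * u)), get 0 (hs_toks n rows) (2 + (6 * n * f + (6 * u + 1))),
      get 0 (hs_toks n rows) (2 + (6 * n * f + (6 * u + 4)))]) [0..<n])) [0..<m] = map (\<lambda>f. 3 * n # cyc (Suc f)) [0..<m]"
    by (intro map_cong) auto
  have up: "[1..<Suc m] = map Suc [0..<m]" by (simp add: map_Suc_upt)
  show ?thesis unfolding cycle_toks_def * up by (simp add: length_cyc o_def)
qed

end

definition hs_instances :: "ccd_instance set" where
  "hs_instances = {hs_instance n rows k | n rows k. hs_valid n rows}"

lemma poly_time_enumerable_hs: "poly_time_enumerable hs_instances"
proof -
  let ?E = "\<lambda>w. untok (cycle_toks (tok w) (column_count (tok w)) (row_count (tok w)))"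
  have "ptime ?E" by (intro ptime_untok ptime_comp[OF ptime_cycle_toks] ptime_tok ptime_id)
  then obtain p M T where T: "poly_bd T" and p: "word_program p M T ?E" by (rule ptime_word_program)
  obtain c a where ca: "\<forall>n. T n \<le> c * Suc n ^ a" using T by (rule poly_bdE)
  show ?thesis
    unfolding poly_time_enumerable_def
  proof (rule exI[of _ p], rule exI[of _ a], rule exI[of _ "c * 2 ^ a"], rule ballI)
    fix J assume "J \<in> hs_instances"
    then obtain n rows k where J: "J = hs_instance n rows k" "hs_valid n rows" by (auto simp: hs_instances_def)
    interpret hs n rows by (rule hs.intro) (rule J(2))
    let ?w = "enc_ccd J"
    let ?vss = "map cyc [1..<Suc m]"
    have "?E ?w = untok (length ?vss # concat (map (\<lambda>vs. length vs # vs) ?vss))"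
      unfolding J(1) enc_ccd_hs tok_untok counts cycle_toks_correct by (simp del: upt_Suc)
    also have "\<dots> = enc_list (enc_list enc_nat) ?vss"
    proof -
      have "untok (concat (map (\<lambda>vs. length vs # vs) vss)) = concat (map (enc_list enc_nat) vss)" for vss
        by (induction vss) (auto simp: enc_list_def enc_nats_untok)
      then show ?thesis unfolding enc_list_def[of "enc_list enc_nat"] by (simp only: untok_simps)
    qed
    finally have E: "?E ?w = enc_list (enc_list enc_nat) ?vss" .
    have "\<forall>i. 0 < i \<and> i < M \<longrightarrow> input1 ?w i = []" by (simp add: input1_def)
    then have "runs p (input1 ?w) (T (length (input1 ?w 0))) ((input1 ?w)(0 := ?E (input1 ?w 0)))"
      using p unfolding word_program_def by blast
    then have "runs p (input1 ?w) (T (length ?w)) ((input1 ?w)(0 := enc_list (enc_list enc_nat) ?vss))"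
      by (simp only: E input1_def fun_upd_same)
    then obtain t where t: "t \<le> T (length ?w)" "exec p (input1 ?w) t ((input1 ?w)(0 := enc_list (enc_list enc_nat) ?vss))"
      unfolding runs_def by blast
    have "1 \<le> length ?w" by (simp add: enc_ccd_def enc_nat_def)
    \<comment> \<open>The required bound has no shift by one. Since the word is non-empty, the
      factor \<open>2 ^ a\<close> makes up for it.\<close>
    then have "Suc (length ?w) ^ a \<le> (2 * length ?w) ^ a" by (intro power_mono) auto
    then have "c * Suc (length ?w) ^ a \<le> c * 2 ^ a * length ?w ^ a" by (simp add: power_mult_distrib mult.assoc)
    then have tt: "t \<le> c * 2 ^ a * length ?w ^ a" using t(1) ca le_trans by blast
    have ce: "map cycle_edges ?vss = map C [1..<Suc m]" by (simp add: cycle_edges_cyc del: upt_Suc)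
    have st: "set [1..<Suc m] = {1..m}" by auto
    have "distinct (map cycle_edges ?vss)" unfolding ce distinct_map st using C_inj by (simp del: upt_Suc)
    moreover have "cycle_edges ` set ?vss = instance_cycles J"
    proof -
      have "cycle_edges ` set ?vss = set (map cycle_edges ?vss)" by (simp only: set_map)
      also have "\<dots> = instance_cycles J" unfolding ce set_map st J(1) instance_cycles_hs ..
      finally show ?thesis .
    qed
    moreover have "\<forall>vs \<in> set ?vss. cyclic_sequence vs" using cyclic_cyc by auto
    ultimately show "\<exists>vss t s. exec p (input1 (enc_ccd J)) t s \<and> s 0 = enc_list (enc_list enc_nat) vss \<and>
        t \<le> c * 2 ^ a * length (enc_ccd J) ^ a \<and> (\<forall>vs \<in> set vss. cyclic_sequence vs) \<and>
        distinct (map cycle_edges vss) \<and> cycle_edges ` set vss = instance_cycles J"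
      using t(2) tt by (intro exI conjI) (assumption | simp only: fun_upd_same)+
  qed
qed

subsection \<open>Hardness\<close>

lemma ptime_gate_at [ptime_intros]: "ptime a \<Longrightarrow> ptime b \<Longrightarrow> ptime (\<lambda>x. gate_at (a x) (b x))"
  unfolding gate_at_def by (intro ptime_intros)

text \<open>The depth \<open>e\<close> is a constant, so the recursion unfolds into a composition of
  fixed depth.\<close>

lemma ptime_forced:
  "ptime a \<Longrightarrow> ptime b \<Longrightarrow> ptime c \<Longrightarrow> ptime h \<Longrightarrow> ptime (\<lambda>x. forced e (a x) (b x) (c x) (h x))"
proof (rule ptime_uncurry4[of "forced e"])
  show "ptime (\<lambda>z. forced e (fst z) (fst (snd z)) (fst (snd (snd z))) (snd (snd (snd z))))"
  proof (induction e)
    case 0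
    show ?case unfolding forced.simps by (intro ptime_intros)
  next
    case (Suc e)
    note IH = ptime_uncurry4[OF Suc]
    show ?case unfolding forced.simps by (intro ptime_intros IH)
  qed
qed

lemma ptime_cnf: "ptime a \<Longrightarrow> ptime b \<Longrightarrow> ptime c \<Longrightarrow> ptime (\<lambda>x. cnf e (a x) (b x) (c x))"
proof (rule ptime_uncurry3[of "cnf e"])
  show "ptime (\<lambda>z. cnf e (fst z) (fst (snd z)) (snd (snd z)))"
  proof (induction e)
    case 0
    show ?case unfolding cnf.simps by (intro ptime_intros)
  next
    case (Suc e)
    note IH = ptime_uncurry3[OF Suc]
    show ?case unfolding cnf.simps by (intro ptime_intros IH)
  qed
qed

lemma ptime_dcnf: "ptime a \<Longrightarrow> ptime b \<Longrightarrow> ptime c \<Longrightarrow> ptime (\<lambda>x. dcnf e (a x) (b x) (c x))"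
proof (rule ptime_uncurry3[of "dcnf e"])
  show "ptime (\<lambda>z. dcnf e (fst z) (fst (snd z)) (snd (snd z)))"
  proof (induction e)
    case 0
    show ?case unfolding dcnf.simps by (intro ptime_intros)
  next
    case (Suc e)
    note IH = ptime_uncurry3[OF Suc]
    show ?case unfolding dcnf.simps by (intro ptime_intros IH ptime_cnf)
  qed
qed

lemma ptime_blocks: "ptime k \<Longrightarrow> ptime (\<lambda>x. blocks r (k x))"
  unfolding blocks_def by (intro ptime_intros)

lemma ptime_circuit_cnfs: "ptime a \<Longrightarrow> ptime (\<lambda>x. circuit_cnfs d (a x))"
  unfolding circuit_cnfs_def by (intro ptime_intros ptime_dcnf)

lemma ptime_choices: "ptime a \<Longrightarrow> ptime k \<Longrightarrow> ptime (\<lambda>x. choices d (a x) (k x))"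
  unfolding choices_def vals_def triples_def by (intro ptime_intros ptime_blocks ptime_circuit_cnfs)

lemma ptime_circuit_rows: "ptime a \<Longrightarrow> ptime k \<Longrightarrow> ptime (\<lambda>x. circuit_rows d (a x) (k x))"
proof (rule ptime_uncurry2[of "circuit_rows d"])
  show "ptime (\<lambda>z. circuit_rows d (fst z) (snd z))"
    unfolding circuit_rows_def indexed_clauses_def clause_pred_def conflict_pred_def compat_def fits_def
    by (intro ptime_intros ptime_blocks ptime_circuit_cnfs ptime_choices ptime_forced)
qed

definition reduction :: "nat \<Rightarrow> bool list \<times> nat \<Rightarrow> bool list \<times> nat" where
  "reduction d z = (untok (hs_toks (length (choices d (parse (tok (fst z))) (snd z))) (circuit_rows d (parse (tok (fst z))) (snd z))),
    length (blocks (2 ^ d) (snd z)))"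

lemma ptime_reduction: "ptime (reduction d)"
proof -
  have "ptime (\<lambda>z :: bool list \<times> nat. parse (tok (fst z)))" by (rule ptime_comp[OF ptime_parse]) (intro ptime_intros)
  then show ?thesis unfolding reduction_def
    by (intro ptime_intros ptime_hs_toks ptime_choices ptime_circuit_rows ptime_blocks)
qed

text \<open>Membership in \<open>W 2\<close> fixes the depth \<open>d\<close>. With the block length
  \<open>2 ^ d\<close> constant, there are polynomially many choices, and the new budget depends on
  \<open>k\<close> alone.\<close>

lemma W_hard_hs: "W_hard_on 2 colored_cycle_deletion (ccd_word ` hs_instances)"
  unfolding W_hard_on_def
proof
  fix P assume "P \<in> W 2"
  then obtain d where P: "fpt_reducible P weighted_circuit_sat (bounded_circuits 2 d)" by (auto simp: W_def)
  show "fpt_reducible P colored_cycle_deletion (ccd_word ` hs_instances)"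
  proof (rule fpt_reducible_trans_ptime[OF P ptime_reduction[of d], where B = "\<lambda>k. Suc k ^ 2 ^ d"])
    show "poly_bd (\<lambda>k. Suc k ^ 2 ^ d)" by (intro poly_bd_intros)
    fix x k assume "(x, k) \<in> bounded_circuits 2 d"
    then obtain C where C: "x = enc_circuit C" "circuit C" "weft C \<le> 2" "depth C \<le> d" by (auto simp: bounded_circuits_def)
    interpret wcircuit C by (rule wcircuit.intro) (rule C(2))
    let ?n = "length (choices d (map gcode C) k)" and ?rows = "circuit_rows d (map gcode C) k"
    let ?J = "hs_instance ?n ?rows (Suc k ^ 2 ^ d)"
    have valid: "hs_valid ?n ?rows" by (rule circuit_hs_valid[OF C(3,4)])
    interpret hs ?n ?rows by (rule hs.intro) (rule valid)
    have "parse (tok x) = map gcode C" unfolding C(1) enc_circuit_untok tok_untok by (rule parse_circuit)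
    then have red: "reduction d (x, k) = ccd_word ?J"
      by (simp add: reduction_def ccd_word_def enc_ccd_hs length_blocks) (simp add: hs_instance_def)
    have "(x, k) \<in> weighted_circuit_sat \<longleftrightarrow> (\<exists>A \<subseteq> inputs C. card A = k \<and> satisfies A C)"
      using C(1,2) by (auto simp: weighted_circuit_sat_def enc_circuit_inject)
    also have "\<dots> \<longleftrightarrow> hittable ?n ?rows (Suc k ^ 2 ^ d)" using circuit_hittable[OF C(3,4)] by simp
    also have "\<dots> \<longleftrightarrow> has_cycle_deletion G 4 (3 * ?n) (Suc k ^ 2 ^ d)" using deletion_iff_hittable by simp
    also have "\<dots> \<longleftrightarrow> has_cycle_deletion (graph_of ?J) (num_colors ?J) (cycle_length ?J) (budget ?J)"
      unfolding graph_of_hs by (simp add: hs_instance_def)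
    also have "\<dots> \<longleftrightarrow> ccd_word ?J \<in> colored_cycle_deletion"
      using hs_instance_valid ccd_word_inject by (auto simp: colored_cycle_deletion_def image_iff)
    finally have "(x, k) \<in> weighted_circuit_sat \<longleftrightarrow> reduction d (x, k) \<in> colored_cycle_deletion" unfolding red .
    moreover have "reduction d (x, k) \<in> ccd_word ` hs_instances" unfolding red hs_instances_def using valid by blast
    moreover have "snd (reduction d (x, k)) \<le> Suc k ^ 2 ^ d" by (simp add: reduction_def length_blocks)
    ultimately show "reduction d (x, k) \<in> ccd_word ` hs_instances \<and> snd (reduction d (x, k)) \<le> Suc k ^ 2 ^ d \<and>
        ((x, k) \<in> weighted_circuit_sat \<longleftrightarrow> reduction d (x, k) \<in> colored_cycle_deletion)" by blast
  qed
qed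

text \<open>One class of instances meets all requirements at once. The induced cycles correspond to
  the rows, of which there are fewer than vertices, so the exponent \<open>1\<close>
  suffices.\<close>

theorem theorem20:
  "\<exists>(I :: ccd_instance set) (a :: nat).
    I \<subseteq> ccd_instances \<and>
    (\<forall>J \<in> I. num_colors J = 4 \<and>
      non_cascading (graph_of J) (num_colors J) (cycle_length J) \<and>
      card (instance_cycles J) \<le> order J ^ a) \<and>
    poly_time_enumerable I \<and>
    W_hard_on 2 colored_cycle_deletion (ccd_word ` I)"
proof (rule exI[of _ hs_instances], rule exI[of _ 1], intro conjI ballI)
  have ex: "\<exists>n rows k. J = hs_instance n rows k \<and> hs n rows" if "J \<in> hs_instances" for J
    using that by (auto simp: hs_instances_def hs_def)
  show "hs_instances \<subseteq> ccd_instances" using ex hs.hs_instance_valid by blast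
  fix J assume "J \<in> hs_instances"
  then obtain n rows k where J: "J = hs_instance n rows k" "hs n rows" using ex by blast
  interpret hs n rows by (rule J(2))
  show c: "num_colors J = 4" by (simp add: J(1) hs_instance_def)
  show "non_cascading (graph_of J) (num_colors J) (cycle_length J)"
    using non_cascading_G unfolding c J(1) graph_of_hs by (simp add: hs_instance_def)
  show "card (instance_cycles J) \<le> order J ^ 1" using card_instance_cycles unfolding J(1) by simp
qed (rule poly_time_enumerable_hs W_hard_hs)+

end
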